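(* Let $a,b,c\in\mathbb{R}$, $\alpha\in\mathbb{R}$ and $1\le p\le\infty$. Then the following conditions are equivalent: (i) The operator $T_{a,b,c}$ is bounded on $L^p(\mathcal{U},dV_\alpha)$. (ii) The operator $S_{a,b,c}$ is bounded on $L^p(\mathcal{U},dV_\alpha)$. (iii) The parameters satisfy $$-pa<\alpha+1<p(b+1)\quad\text{and}\quad c=n+1+a+b,$$ where, when $p=\infty$, these conditions are to be interpreted as $$a>0,\quad b>-1\quad\text{and}\quad c=n+1+a+b.$$
   Context: Fix a positive integer $n$. For $z,w\in\mathbb{C}^n$ write $\langle z,w\rangle=z_1\bar w_1+\cdots+z_n\bar w_n$ and $|z|=\sqrt{\langle z,z\rangle}$ (similarly on $\mathbb{C}^{n-1}$), and $z=(z',z_n)$ with $z'=(z_1,\dots,z_{n-1})\in\mathbb{C}^{n-1}$, $z_n\in\mathbb{C}$. The Siegel upper half-space is $\mathcal{U}=\{z\in\mathbb{C}^n:\operatorname{Im}z_n>|z'|^2\}$. For $z,w\in\mathcal{U}$ put $$\rho(z,w)=\tfrac{i}{2}(\bar w_n-z_n)-\langle z',w'\rangle,\qquad \rho(z)=\rho(z,z)=\operatorname{Im}z_n-|z'|^2 .$$ One has $\operatorname{Re}\rho(z,w)>0$ on $\mathcal{U}\times\mathcal{U}$, and real powers of $\rho(z,w)$ are taken with the principal branch. Let $dV$ be Lebesgue measure on $\mathbb{C}^n$ and, for $\alpha\in\mathbb{R}$, $dV_\alpha(z)=\rho(z)^\alpha\,dV(z)$. For $0<p<\infty$, $L^p(\mathcal{U},dV_\alpha)$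 is the space of Lebesgue measurable $f$ on $\mathcal{U}$ with $\|f\|_{p,\alpha}=\left(\int_{\mathcal{U}}|f|^p\,dV_\alpha\right)^{1/p}<\infty$; for $p=\infty$ it is the usual space $L^\infty(\mathcal{U})$ with the essential supremum norm. For real $a,b,c$ define $$T_{a,b,c}f(z)=\rho(z)^a\int_{\mathcal{U}}\frac{\rho(w)^b}{\rho(z,w)^c}f(w)\,dV(w),\qquad S_{a,b,c}f(z)=\rho(z)^a\int_{\mathcal{U}}\frac{\rho(w)^b}{|\rho(z,w)|^c}f(w)\,dV(w).$$ Boundedness of such an operator on $L^p(\mathcal{U},dV_\alpha)$ includes that the defining (Lebesgue) integral is well-defined for every $f\in L^p(\mathcal{U},dV_\alpha)$. *)

theory Defs
  imports "HOL-Analysis.Analysis" "HOL-Probability.Essential_Supremum"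
begin

type_synonym 'n cvec = "(complex, 'n) vec"

text \<open>
  The space of \<open>n\<close>-tuples of complex numbers is \<open>complex ^ 'n\<close> with \<open>n = CARD('n) \<ge> 1\<close>. The
  index type is linearly ordered, so that the last coordinate \<open>z\<^sub>n\<close> is the one at the greatest
  index. The remaining coordinates \<open>z'\<close> are not given a type of their own, so that \<open>n = 1\<close>
  (empty \<open>z'\<close>) is included.
\<close>

definition last_coord :: "'n::{finite,linorder} cvec \<Rightarrow> complex" where
  "last_coord z = z $ Max UNIV"

definition inner' :: "'n::{finite,linorder} cvec \<Rightarrow> 'n cvec \<Rightarrow> complex" where
  "inner' z w = (\<Sum>j\<in>UNIV - {Max UNIV}. z $ j * cnj (w $ j))"

definition norm' :: "'n::{finite,linorder} cvec \<Rightarrow> real" where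
  "norm' z = sqrt (Re (inner' z z))"

definition siegel :: "('n::{finite,linorder} cvec) set" where
  "siegel = {z. Im (last_coord z) > (norm' z)\<^sup>2}"

definition rho :: "'n::{finite,linorder} cvec \<Rightarrow> 'n cvec \<Rightarrow> complex" where
  "rho z w = \<i> / 2 * (cnj (last_coord w) - last_coord z) - inner' z w"

definition rho_diag :: "'n::{finite,linorder} cvec \<Rightarrow> real" where
  "rho_diag z = Im (last_coord z) - (norm' z)\<^sup>2"

lemma norm'_squared: "(norm' z)\<^sup>2 = (\<Sum>j\<in>UNIV - {Max UNIV}. (cmod (z $ j))\<^sup>2)"
proof -
  have "Re (inner' z z) = (\<Sum>j\<in>UNIV - {Max UNIV}. (cmod (z $ j))\<^sup>2)"
    unfolding inner'_def Re_sum by (intro sum.cong refl) (simp add: cmod_power2 flip: power2_eq_square)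
  then show ?thesis
    by (simp add: norm'_def sum_nonneg)
qed

lemma rho_same: "rho z z = of_real (rho_diag z)"
proof -
  have "inner' z z = of_real ((norm' z)\<^sup>2)"
    by (simp only: inner'_def norm'_squared complex_norm_square of_real_sum)
  then show ?thesis
    by (simp add: rho_def rho_diag_def complex_eq_iff)
qed

lemma rho_diag_pos: "z \<in> siegel \<Longrightarrow> rho_diag z > 0"
  by (simp add: siegel_def rho_diag_def)

text \<open>In particular the values of \<^const>\<open>rho\<close> avoid the branch cut of the complex power.\<close>

lemma Re_rho_pos:
  assumes "z \<in> siegel" "w \<in> siegel"
  shows "Re (rho z w) > 0"
proof -
  have "2 * Re (inner' z w) \<le> (norm' z)\<^sup>2 + (norm' w)\<^sup>2"
    unfolding norm'_squared inner'_def Re_sum sum_distrib_left sum.distrib[symmetric]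
  proof (rule sum_mono)
    fix j
    have "0 \<le> (Re (z $ j) - Re (w $ j))\<^sup>2 + (Im (z $ j) - Im (w $ j))\<^sup>2"
      by simp
    then show "2 * Re (z $ j * cnj (w $ j)) \<le> (cmod (z $ j))\<^sup>2 + (cmod (w $ j))\<^sup>2"
      unfolding cmod_power2 by (simp add: power2_eq_square algebra_simps)
  qed
  then show ?thesis
    using assms by (simp add: siegel_def rho_def)
qed

definition weighted_measure :: "real \<Rightarrow> ('n::{finite,linorder} cvec) measure" where
  "weighted_measure \<alpha> = density (lebesgue_on siegel) (\<lambda>z. ennreal (rho_diag z powr \<alpha>))"

text \<open>Functions on \<^const>\<open>siegel\<close> are total functions whose values elsewhere are ignored.\<close>

definition Lp_space ::
    "ereal \<Rightarrow> real \<Rightarrow> ('n::{finite,linorder} cvec \<Rightarrow> complex) set" where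
  "Lp_space p \<alpha> = {f \<in> borel_measurable (lebesgue_on siegel).
     if p = \<infinity> then esssup (lebesgue_on siegel) (\<lambda>z. ereal (cmod (f z))) < \<infinity>
     else (\<integral>\<^sup>+z. ennreal (cmod (f z) powr real_of_ereal p) \<partial>weighted_measure \<alpha>) < \<infinity>}"

definition Lp_norm ::
    "ereal \<Rightarrow> real \<Rightarrow> ('n::{finite,linorder} cvec \<Rightarrow> complex) \<Rightarrow> real" where
  "Lp_norm p \<alpha> f =
     (if p = \<infinity> then real_of_ereal (esssup (lebesgue_on siegel) (\<lambda>z. ereal (cmod (f z))))
      else (LINT z|weighted_measure \<alpha>. cmod (f z) powr real_of_ereal p)
             powr (1 / real_of_ereal p))"

definition T_integrand :: "real \<Rightarrow> real \<Rightarrow> ('n::{finite,linorder} cvec \<Rightarrow> complex) \<Rightarrow>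
    'n cvec \<Rightarrow> 'n cvec \<Rightarrow> complex" where
  "T_integrand b c f z w = of_real (rho_diag w powr b) / (rho z w powr of_real c) * f w"

definition S_integrand :: "real \<Rightarrow> real \<Rightarrow> ('n::{finite,linorder} cvec \<Rightarrow> complex) \<Rightarrow>
    'n cvec \<Rightarrow> 'n cvec \<Rightarrow> complex" where
  "S_integrand b c f z w = of_real (rho_diag w powr b / (cmod (rho z w) powr c)) * f w"

text \<open>
  An integral operator \<open>f \<mapsto> (\<lambda>z. \<rho>(z)\<^sup>a \<integral> k f z w dV(w))\<close> given by its integrand \<open>k\<close>. As
  elements of \<open>L\<^sup>p\<close> are considered up to null sets, the integral has to converge (absolutely) for
  almost every \<open>z\<close>; without this clause boundedness would say nothing about divergent integrals,
  which have the value \<open>0\<close>.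
\<close>

definition integral_op ::
    "real \<Rightarrow> (('n::{finite,linorder} cvec \<Rightarrow> complex) \<Rightarrow> 'n cvec \<Rightarrow> 'n cvec \<Rightarrow> complex) \<Rightarrow>
     ('n cvec \<Rightarrow> complex) \<Rightarrow> 'n cvec \<Rightarrow> complex" where
  "integral_op a k f z = of_real (rho_diag z powr a) * (LINT w|lebesgue_on siegel. k f z w)"

definition integral_op_bounded ::
    "ereal \<Rightarrow> real \<Rightarrow> real \<Rightarrow>
     (('n::{finite,linorder} cvec \<Rightarrow> complex) \<Rightarrow> 'n cvec \<Rightarrow> 'n cvec \<Rightarrow> complex) \<Rightarrow> bool" where
  "integral_op_bounded p \<alpha> a k \<longleftrightarrow>
     (\<forall>f\<in>Lp_space p \<alpha>.
        (AE z in lebesgue_on siegel. integrable (lebesgue_on siegel) (k f z)) \<and>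
        integral_op a k f \<in> Lp_space p \<alpha>) \<and>
     (\<exists>C. \<forall>f\<in>Lp_space p \<alpha>. Lp_norm p \<alpha> (integral_op a k f) \<le> C * Lp_norm p \<alpha> f)"

definition T_bounded :: "'n::{finite,linorder} itself \<Rightarrow> ereal \<Rightarrow> real \<Rightarrow> real \<Rightarrow> real \<Rightarrow> real \<Rightarrow> bool" where
  "T_bounded _ p \<alpha> a b c \<longleftrightarrow>
     integral_op_bounded p \<alpha> a
       (T_integrand b c :: ('n cvec \<Rightarrow> complex) \<Rightarrow> 'n cvec \<Rightarrow> 'n cvec \<Rightarrow> complex)"

definition S_bounded :: "'n::{finite,linorder} itself \<Rightarrow> ereal \<Rightarrow> real \<Rightarrow> real \<Rightarrow> real \<Rightarrow> real \<Rightarrow> bool" where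
  "S_bounded _ p \<alpha> a b c \<longleftrightarrow>
     integral_op_bounded p \<alpha> a
       (S_integrand b c :: ('n cvec \<Rightarrow> complex) \<Rightarrow> 'n cvec \<Rightarrow> 'n cvec \<Rightarrow> complex)"

definition parameters_admissible :: "nat \<Rightarrow> ereal \<Rightarrow> real \<Rightarrow> real \<Rightarrow> real \<Rightarrow> real \<Rightarrow> bool" where
  "parameters_admissible n p \<alpha> a b c \<longleftrightarrow>
     (if p = \<infinity> then a > 0 \<and> b > -1
      else - real_of_ereal p * a < \<alpha> + 1 \<and> \<alpha> + 1 < real_of_ereal p * (b + 1)) \<and>
     c = real n + 1 + a + b"

end

theory Submission
  imports Defs "HOL-Complex_Analysis.Cauchy_Integral_Theorem"
begin

text \<open>
  Everything rests on the integrals of \<open>rho_diag w powr s * cmod (rho z w) powr - t\<close>: they are finite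
  iff \<open>s > -1\<close> and \<open>t > n + 1 + s\<close>, and then of the size \<open>rho_diag z powr (n + 1 + s - t)\<close>. In
  Heisenberg coordinates \<open>cmod (rho z w)\<close> is comparable to the sum of \<open>rho_diag z\<close>, \<open>rho_diag w\<close>, the
  squares of the horizontal coordinates and the absolute value of the last real one, so that both directions
  reduce to products of integrals over the line.

  Sufficiency is Schur's test with a power of \<open>rho_diag\<close>. For necessity, the operator is applied to the
  indicator of a small box around \<open>(0, \<i> R)\<close>, on which \<open>rho z w\<close> is a constant up to a factor close to
  \<open>1\<close>, uniformly in \<open>z\<close>; hence there is no cancellation and \<open>T\<close> behaves like \<open>S\<close>. Letting \<open>R\<close> vary
  forces \<open>c = n + 1 + a + b\<close>, and the growth of the image function gives the lower bound on \<open>\<alpha>\<close> and, for \<open>p = 1\<close>,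
  the upper one. For \<open>1 < p < \<infinity>\<close> the upper bound comes from \<open>rho_diag w powr - (b + 1)\<close> truncated near the
  boundary, whose \<open>p\<close>-th power norm and image both grow like the logarithm of the truncation height;
  for \<open>p = \<infinity>\<close> the constant function \<open>1\<close> decides.
\<close>

section \<open>Heisenberg coordinates\<close>

text \<open>Statements (i) and (ii) are not compared with each other; each is shown equivalent to
  (iii). The kernels of \<open>T\<close> and \<open>S\<close> have the same modulus: upper bounds
  see only this modulus, and lower bounds need the phase merely to vary slowly near a fixed point,
  so one abstract kernel serves both.

  The obstacle is the upper bound on \<alpha> for 1 < p < \<infinity>. Integrability at infinity of
  the image of a fixed box gives c p > n + 1 + p a + \<alpha>. Inserting c = n + 1 + a + b turns
  this into \<alpha> < p b + (p - 1) (n + 1), which is the claim \<alpha> < p b + p - 1 only if p =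
  1. In the borderline case \<alpha> + 1 = p (b + 1) the power of \<open>rho_diag\<close> that makes
  the integral diverge just fails to lie in the space, so it has to be truncated. At logarithmic
  depth K the p-th power of its norm is at most of order K, but its image on a fixed box is at least
  of order K, with p-th power of order K^p; this is impossible for large K since p > 1.\<close>

lemma nn_integral_lborel_translate:
  fixes F :: "'a::euclidean_space \<Rightarrow> ennreal"
  assumes [measurable]: "F \<in> borel_measurable borel"
  shows "(\<integral>\<^sup>+x. F (x + c) \<partial>lborel) = (\<integral>\<^sup>+x. F x \<partial>lborel)"
proof -
  have "(\<integral>\<^sup>+x. F x \<partial>lborel) = (\<integral>\<^sup>+x. F x \<partial>distr lborel borel ((+) c))"
    by (simp add: lborel_distr_plus)
  also have "\<dots> = (\<integral>\<^sup>+x. F (x + c) \<partial>lborel)"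
    by (subst nn_integral_distr) (simp_all add: add.commute)
  finally show ?thesis by simp
qed

text \<open>
  The shift is averaged over a unit cube of translations along the range of \<open>e\<close>; after Tonelli
  it becomes a translation of the averaging variable, which disappears.
\<close>

lemma nn_integral_lborel_shear:
  fixes F :: "'a::euclidean_space \<Rightarrow> ennreal" and e :: "'c::euclidean_space \<Rightarrow> 'a" and g :: "'a \<Rightarrow> 'c"
  assumes [measurable]: "F \<in> borel_measurable borel" "e \<in> borel_measurable borel" "g \<in> borel_measurable borel"
    and e_add: "\<And>u v. e (u + v) = e u + e v"
    and g_inv: "\<And>w u. g (w + e u) = g w"
  shows "(\<integral>\<^sup>+w. F (w + e (g w)) \<partial>lborel) = (\<integral>\<^sup>+w. F w \<partial>lborel)"
proof -
  define B :: "'c set" where "B = cbox 0 (\<Sum>Basis)"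
  have B [measurable]: "B \<in> sets borel"
    by (simp add: B_def)
  have B1: "(\<integral>\<^sup>+u. indicator B u \<partial>lborel) = 1"
    by (simp add: B_def emeasure_lborel_cbox_eq inner_diff_left)
  have "(\<integral>\<^sup>+w. F (w + e (g w)) \<partial>lborel)
      = (\<integral>\<^sup>+u. indicator B u * (\<integral>\<^sup>+w. F (w + e (g w)) \<partial>lborel) \<partial>lborel)"
    by (subst nn_integral_multc) (simp_all add: B1)
  also have "\<dots> = (\<integral>\<^sup>+u. (\<integral>\<^sup>+w. indicator B u * F (w + e u + e (g w)) \<partial>lborel) \<partial>lborel)"
  proof (rule nn_integral_cong)
    fix u :: 'c
    have "(\<integral>\<^sup>+w. F (w + e (g w)) \<partial>lborel) = (\<integral>\<^sup>+w. F (w + e u + e (g (w + e u))) \<partial>lborel)"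
      by (rule nn_integral_lborel_translate[symmetric]) simp
    then show "indicator B u * (\<integral>\<^sup>+w. F (w + e (g w)) \<partial>lborel)
        = (\<integral>\<^sup>+w. indicator B u * F (w + e u + e (g w)) \<partial>lborel)"
      by (simp add: g_inv nn_integral_cmult)
  qed
  also have "\<dots> = (\<integral>\<^sup>+w. (\<integral>\<^sup>+u. indicator B u * F (w + e u + e (g w)) \<partial>lborel) \<partial>lborel)"
    by (rule lborel_pair.Fubini'[symmetric]) simp
  \<comment> \<open>Translating \<open>u\<close> by \<open>g w\<close> moves the shear out of
    \<open>F\<close> and into the indicator, by additivity of \<open>e\<close>. What is left in
    \<open>F\<close> is a shift by \<open>e u\<close> that does not depend on
    \<open>w\<close>.\<close>
  also have "\<dots> = (\<integral>\<^sup>+w. (\<integral>\<^sup>+u. indicator B (u - g w) * F (w + e u) \<partial>lborel) \<partial>lborel)"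
  proof (rule nn_integral_cong)
    fix w :: 'a
    have "(\<integral>\<^sup>+u. indicator B (u - g w) * F (w + e u) \<partial>lborel)
      = (\<integral>\<^sup>+u. indicator B (u + g w - g w) * F (w + e (u + g w)) \<partial>lborel)"
      by (rule nn_integral_lborel_translate[symmetric]) simp
    then show "(\<integral>\<^sup>+u. indicator B u * F (w + e u + e (g w)) \<partial>lborel)
      = (\<integral>\<^sup>+u. indicator B (u - g w) * F (w + e u) \<partial>lborel)"
      by (simp add: e_add add.assoc)
  qed
  also have "\<dots> = (\<integral>\<^sup>+u. (\<integral>\<^sup>+w. indicator B (u - g w) * F (w + e u) \<partial>lborel) \<partial>lborel)"
    by (rule lborel_pair.Fubini') simp
  also have "\<dots> = (\<integral>\<^sup>+u. (\<integral>\<^sup>+w. indicator B (u - g w) * F w \<partial>lborel) \<partial>lborel)"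
  proof (rule nn_integral_cong)
    fix u :: 'c
    have "(\<integral>\<^sup>+w. indicator B (u - g w) * F w \<partial>lborel)
      = (\<integral>\<^sup>+w. indicator B (u - g (w + e u)) * F (w + e u) \<partial>lborel)"
      by (rule nn_integral_lborel_translate[symmetric]) simp
    then show "(\<integral>\<^sup>+w. indicator B (u - g w) * F (w + e u) \<partial>lborel)
      = (\<integral>\<^sup>+w. indicator B (u - g w) * F w \<partial>lborel)"
      by (simp add: g_inv)
  qed
  also have "\<dots> = (\<integral>\<^sup>+w. (\<integral>\<^sup>+u. indicator B (u - g w) * F w \<partial>lborel) \<partial>lborel)"
    by (rule lborel_pair.Fubini'[symmetric]) simp
  also have "\<dots> = (\<integral>\<^sup>+w. F w \<partial>lborel)"
  proof (rule nn_integral_cong)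
    fix w :: 'a
    have "(\<integral>\<^sup>+u. indicator B (u + (- g w)) \<partial>lborel) = (\<integral>\<^sup>+u. indicator B u \<partial>lborel)"
      by (rule nn_integral_lborel_translate) simp
    then show "(\<integral>\<^sup>+u. indicator B (u - g w) * F w \<partial>lborel) = F w"
      by (simp add: nn_integral_multc B1 del: nn_integral_indicator)
  qed
  finally show ?thesis .
qed

section \<open>Real coordinates and the real and imaginary parts of \<open>rho\<close>\<close>

abbreviation last_axis :: "complex \<Rightarrow> 'n::{finite,linorder} cvec" where
  "last_axis \<equiv> axis (Max UNIV)"

text \<open>Stands in for the space of \<open>z'\<close>, which has no type of its own. It is empty
  if n = 1; products over it are then 1.\<close>

definition horizontal_Basis :: "('n::{finite,linorder} cvec) set" where
  "horizontal_Basis = Basis - {last_axis 1, last_axis \<i>}"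

lemma last_axis_Basis: "last_axis 1 \<in> Basis" "last_axis \<i> \<in> Basis"
  by (auto simp: Basis_vec_def)

lemma horizontal_Basis_finite [simp]: "finite horizontal_Basis"
  by (simp add: horizontal_Basis_def)

lemma card_horizontal_Basis: "card (horizontal_Basis :: ('n::{finite,linorder} cvec) set) = 2 * CARD('n) - 2"
proof -
  have "last_axis 1 \<noteq> (last_axis \<i> :: 'n cvec)"
    by (simp add: axis_eq_axis complex_eq_iff)
  then show ?thesis
    unfolding horizontal_Basis_def using last_axis_Basis
    by (simp add: card_Diff_subset mult.commute)
qed

lemma horizontal_Basis_eq:
  "horizontal_Basis = (\<Union>j\<in>UNIV - {Max UNIV}. {axis j 1, axis j \<i>} :: ('n::{finite,linorder} cvec) set)"
  by (auto simp: horizontal_Basis_def Basis_vec_def Basis_complex_def axis_eq_axis complex_eq_iff)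

lemma sum_horizontal_Basis:
  "(\<Sum>b\<in>(horizontal_Basis::('n::{finite,linorder} cvec) set). f b)
   = (\<Sum>j\<in>UNIV - {Max UNIV}. f (axis j 1) + f (axis j \<i>))"
  unfolding horizontal_Basis_eq
  by (subst sum.UNION_disjoint)
     (auto simp: axis_eq_axis complex_eq_iff intro!: sum.cong)

lemma inner_last_axis:
  "w \<bullet> last_axis 1 = Re (last_coord w)" "w \<bullet> last_axis \<i> = Im (last_coord w)"
  by (simp_all add: inner_axis last_coord_def inner_complex_def)

lemma norm'_horizontal: "(norm' w)\<^sup>2 = (\<Sum>b\<in>horizontal_Basis. (w \<bullet> b)\<^sup>2)"
  by (simp add: sum_horizontal_Basis norm'_squared inner_axis inner_complex_def cmod_power2)

lemma rho_cnj: "rho w z = cnj (rho z w)"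
  by (simp add: rho_def inner'_def complex_eq_iff mult.commute sum_subtractf field_simps)

lemma norm_rho_commute: "cmod (rho w z) = cmod (rho z w)"
  by (metis rho_cnj complex_mod_cnj)

text \<open>Polarisation of \<open>norm' (w - z)\<close>. On \<open>siegel\<close> all three
  summands are nonnegative, so each of them bounds \<open>cmod (rho z w)\<close> from below.\<close>

lemma Re_rho: "2 * Re (rho z w) = rho_diag z + rho_diag w + (norm' (w - z))\<^sup>2"
proof -
  have "(norm' (w - z))\<^sup>2 = (norm' w)\<^sup>2 + (norm' z)\<^sup>2 - 2 * Re (inner' z w)"
    unfolding norm'_squared inner'_def Re_sum sum_distrib_left sum.distrib[symmetric] sum_subtractf[symmetric]
    by (rule sum.cong) (simp_all only: cmod_power2, simp_all add: power2_eq_square algebra_simps)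
  then show ?thesis
    by (simp add: rho_def rho_diag_def)
qed

lemma Im_rho: "2 * Im (rho z w) = Re (last_coord w) - Re (last_coord z) - 2 * Im (inner' z w)"
  by (simp add: rho_def)

lemma siegel_iff: "z \<in> siegel \<longleftrightarrow> rho_diag z > 0"
  by (simp add: siegel_def rho_diag_def)

section \<open>Borel measurability of the basic functions\<close>

lemma borel_vec_nth [measurable (raw)]:
  fixes f :: "'a \<Rightarrow> complex ^ 'n"
  assumes [measurable]: "f \<in> borel_measurable M"
  shows "(\<lambda>x. f x $ j) \<in> borel_measurable M"
proof -
  have [measurable]: "(\<lambda>w :: complex ^ 'n. w $ j) \<in> borel_measurable borel"
    by (intro borel_measurable_continuous_onI continuous_intros)
  show ?thesis by measurable
qed

lemma borel_cnj [measurable (raw)]: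
  assumes [measurable]: "f \<in> borel_measurable M"
  shows "(\<lambda>x. cnj (f x)) \<in> borel_measurable M"
proof -
  have [measurable]: "cnj \<in> borel_measurable borel"
    by (intro borel_measurable_continuous_onI continuous_intros)
  show ?thesis by measurable
qed

lemma borel_last_coord [measurable (raw)]:
  "f \<in> borel_measurable M \<Longrightarrow> (\<lambda>x. last_coord (f x)) \<in> borel_measurable M"
  unfolding last_coord_def by measurable

lemma borel_inner' [measurable (raw)]:
  assumes [measurable]: "f \<in> borel_measurable M" "g \<in> borel_measurable M"
  shows "(\<lambda>x. inner' (f x) (g x)) \<in> borel_measurable M"
  unfolding inner'_def by measurable

lemma borel_rho [measurable (raw)]:
  assumes [measurable]: "f \<in> borel_measurable M" "g \<in> borel_measurable M"
  shows "(\<lambda>x. rho (f x) (g x)) \<in> borel_measurable M"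
  unfolding rho_def by measurable

lemma borel_norm' [measurable (raw)]:
  "f \<in> borel_measurable M \<Longrightarrow> (\<lambda>x. norm' (f x)) \<in> borel_measurable M"
  unfolding norm'_def by measurable

lemma borel_rho_diag [measurable (raw)]:
  assumes [measurable]: "f \<in> borel_measurable M"
  shows "(\<lambda>x. rho_diag (f x)) \<in> borel_measurable M"
proof -
  have "(\<lambda>x. norm' (f x)) \<in> borel_measurable M"
    by measurable
  then show ?thesis
    unfolding rho_diag_def by (intro borel_measurable_diff borel_measurable_power) measurable
qed

lemma siegel_borel [measurable]: "siegel \<in> sets borel"
proof -
  have "siegel = {z \<in> space borel. 0 < rho_diag z}"
    by (auto simp: siegel_iff)
  also have "\<dots> \<in> sets borel"
    by measurable
  finally show ?thesis .
qed

text \<open>Heisenberg coordinates: a shear in the last variable makes \<open>rho_diag w\<close> and \<open>2 * Im (rho z w)\<close> its imaginary and real part.\<close>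

lemma nn_integral_heisenberg:
  fixes z :: "'n::{finite,linorder} cvec" and f h \<phi> :: "real \<Rightarrow> ennreal"
  assumes [measurable]: "f \<in> borel_measurable borel" "h \<in> borel_measurable borel" "\<phi> \<in> borel_measurable borel"
  shows "(\<integral>\<^sup>+w. (\<Prod>b\<in>horizontal_Basis. f ((w - z) \<bullet> b)) * h (2 * Im (rho z w)) * \<phi> (rho_diag w) \<partial>lborel)
    = (\<integral>\<^sup>+x. f x \<partial>lborel) ^ (2 * CARD('n) - 2) * (\<integral>\<^sup>+x. h x \<partial>lborel) * (\<integral>\<^sup>+x. \<phi> x \<partial>lborel)"
proof -
  \<comment> \<open>One factor for each real coordinate, so that \<open>H\<close> is a product over
    \<open>Basis\<close>. The shift by \<open>z\<close> stays in the horizontal factors until each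
    has become an integral over the line.\<close>
  define G :: "'n cvec \<Rightarrow> real \<Rightarrow> ennreal" where
    "G b x = (if b = last_axis 1 then h x else if b = last_axis \<i> then \<phi> x else f (x - z \<bullet> b))" for b x
  have G [measurable]: "G b \<in> borel_measurable borel" for b
    unfolding G_def by (cases "b = last_axis 1"; cases "b = last_axis \<i>") simp_all
  have ne: "last_axis 1 \<noteq> (last_axis \<i> :: 'n cvec)"
    by (simp add: axis_eq_axis complex_eq_iff)
  have split: "(\<Prod>b\<in>Basis. P b) = (\<Prod>b\<in>horizontal_Basis. P b) * P (last_axis 1) * P (last_axis \<i>)"
    for P :: "'n cvec \<Rightarrow> ennreal"
  proof -
    have "Basis = insert (last_axis 1) (insert (last_axis \<i>) horizontal_Basis)"
      unfolding horizontal_Basis_def using last_axis_Basis by blast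
    then show ?thesis
      by (subst \<open>Basis = _\<close>) (use ne in \<open>simp add: horizontal_Basis_def mult_ac\<close>)
  qed
  define H where "H w = (\<Prod>b\<in>Basis. G b (w \<bullet> b))" for w
  have [measurable]: "H \<in> borel_measurable borel"
    unfolding H_def by measurable
  have H: "H w = (\<Prod>b\<in>horizontal_Basis. f ((w - z) \<bullet> b)) * h (Re (last_coord w)) * \<phi> (Im (last_coord w))" for w
    unfolding H_def split using ne
    by (auto simp: G_def inner_last_axis inner_diff_left horizontal_Basis_def intro!: arg_cong2[where f="(*)"] prod.cong)
  \<comment> \<open>Adding \<open>g w\<close> to the last coordinate makes its real part
    \<open>2 * Im (rho z w)\<close> and its imaginary part \<open>rho_diag w\<close>. As
    \<open>g\<close> depends on \<open>w\<close> only through the horizontal coordinates, it is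
    unchanged by such an addition, which is what the shear lemma asks for.\<close>
  define g where "g w = Complex (- Re (last_coord z) - 2 * Im (inner' z w)) (- (norm' w)\<^sup>2)" for w :: "'n cvec"
  have "g = (\<lambda>w. of_real (- Re (last_coord z) - 2 * Im (inner' z w)) + \<i> * of_real (- (norm' w)\<^sup>2))"
    by (auto simp: g_def complex_eq_iff)
  then have [measurable]: "g \<in> borel_measurable borel"
    by simp
  have hor: "(w + last_axis u) $ j = w $ j" if "j \<in> UNIV - {Max UNIV}" for w u and j :: 'n
    using that by (simp add: axis_def)
  have n': "norm' (w + last_axis u) = norm' w" for w :: "'n cvec" and u
    unfolding norm'_def inner'_def using hor by simp
  have i': "inner' z (w + last_axis u) = inner' z w" for w u
    unfolding inner'_def using hor by simp
  have l': "last_coord (w + last_axis u) = last_coord w + u" for w :: "'n cvec" and u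
    by (simp add: last_coord_def)
  have hb: "(w + last_axis u) \<bullet> b = w \<bullet> b" if "b \<in> horizontal_Basis" for w u and b :: "'n cvec"
    using that unfolding horizontal_Basis_eq by (auto simp: inner_axis) (auto simp: axis_def split: if_splits)
  have "H (w + last_axis (g w)) = (\<Prod>b\<in>horizontal_Basis. f ((w - z) \<bullet> b)) * h (2 * Im (rho z w)) * \<phi> (rho_diag w)" for w
    unfolding H l' by (auto simp: g_def Im_rho rho_diag_def inner_diff_left hb diff_add_eq
        intro!: arg_cong2[where f="(*)"] arg_cong[where f=h] prod.cong)
  then have "(\<integral>\<^sup>+w. (\<Prod>b\<in>horizontal_Basis. f ((w - z) \<bullet> b)) * h (2 * Im (rho z w)) * \<phi> (rho_diag w) \<partial>lborel)
     = (\<integral>\<^sup>+w. H (w + last_axis (g w)) \<partial>lborel)"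
    by simp
  also have "\<dots> = (\<integral>\<^sup>+w. H w \<partial>lborel)"
  proof (rule nn_integral_lborel_shear[where e=last_axis])
    show "(last_axis :: complex \<Rightarrow> 'n cvec) \<in> borel_measurable borel"
      by (intro borel_measurable_continuous_onI linear_continuous_on)
         (simp add: linear_linear linear_iff axis_def vec_eq_iff)
    show "last_axis (u + v) = last_axis u + (last_axis v :: 'n cvec)" for u v :: complex
      by (simp add: axis_def vec_eq_iff)
    show "g (w + last_axis u) = g w" for w u
      by (simp add: g_def n' i')
  qed simp_all
  also have "\<dots> = (\<Prod>b\<in>Basis. (\<integral>\<^sup>+x. G b x \<partial>lborel))"
    unfolding H_def by (rule nn_integral_lborel_prod) simp_all
  also have "\<dots> = (\<Prod>b\<in>horizontal_Basis. (\<integral>\<^sup>+x. G b x \<partial>lborel)) * (\<integral>\<^sup>+x. h x \<partial>lborel) * (\<integral>\<^sup>+x. \<phi> x \<partial>lborel)"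
  proof -
    have "G (last_axis 1) = h" "G (last_axis \<i>) = \<phi>"
      using ne by (simp_all add: G_def fun_eq_iff)
    then show ?thesis
      unfolding split by simp
  qed
  also have "(\<Prod>b\<in>horizontal_Basis. (\<integral>\<^sup>+x. G b x \<partial>lborel))
      = (\<Prod>b\<in>(horizontal_Basis::'n cvec set). (\<integral>\<^sup>+x. f x \<partial>lborel))"
  proof (rule prod.cong)
    fix b :: "'n cvec" assume "b \<in> horizontal_Basis"
    then show "(\<integral>\<^sup>+x. G b x \<partial>lborel) = (\<integral>\<^sup>+x. f x \<partial>lborel)"
      using nn_integral_lborel_translate[of f "- (z \<bullet> b)"] by (simp add: G_def horizontal_Basis_def)
  qed simp
  finally show ?thesis
    by (simp add: card_horizontal_Basis)
qed

section \<open>One-dimensional integrals\<close>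

text \<open>The sign of \<open>t\<close> is left open, hence the minimum. This is how a two-sided
  bound on \<open>rho_diag\<close> or \<open>cmod (rho z w)\<close> becomes a lower bound on any
  power with a positive constant.\<close>

lemma powr_lower_bound:
  fixes x :: real
  assumes "0 < A" "A \<le> x" "x \<le> B"
  shows "min (A powr t) (B powr t) \<le> x powr t"
proof (cases "t \<ge> 0")
  case True
  then have "A powr t \<le> x powr t" using assms by (intro powr_mono2) auto
  then show ?thesis by simp
next
  case False
  then have "B powr t \<le> x powr t" using assms by (intro powr_mono2') auto
  then show ?thesis by simp
qed

lemma powr_divide_minus:
  fixes x :: real
  assumes "x \<ge> 0" "c > 0"
  shows "(x / c) powr - t = c powr t * x powr - t"
  using assms by (simp add: powr_divide powr_minus_divide)

lemma nn_integral_powr_unit: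
  fixes s :: real assumes "s > -1"
  shows "(\<integral>\<^sup>+x. indicator {0..1} x * ennreal (x powr s) \<partial>lborel) = ennreal (1 / (s + 1))"
proof -
  have "((\<lambda>x. x powr s) has_integral (1 powr (s+1) / (s+1))) {0..1::real}"
    using assms by (intro has_integral_powr_from_0) auto
  then show ?thesis
    by (subst nn_integral_has_integral_lebesgue[symmetric, where f="\<lambda>x. x powr s" and \<Omega>="{0..1}"])
       (auto intro!: nn_integral_cong split: split_indicator)
qed

lemma nn_integral_powr_tail:
  fixes t :: real assumes "t > 1"
  shows "(\<integral>\<^sup>+x. indicator {1..} x * ennreal (x powr - t) \<partial>lborel) = ennreal (1 / (t - 1))"
proof -
  have "((\<lambda>x. x powr - t) has_integral -(1 powr (-t+1)) / (-t+1)) {1::real..}"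
    using assms by (intro has_integral_powr_to_inf) auto
  moreover have "-(1 powr (-t+1)) / (-t+1) = 1 / (t - 1)"
    using assms by (simp add: field_simps)
  ultimately have "((\<lambda>x. x powr - t) has_integral 1 / (t - 1)) {1::real..}"
    by simp
  then show ?thesis
    by (subst nn_integral_has_integral_lebesgue[symmetric, where f="\<lambda>x. x powr - t" and \<Omega>="{1..}"])
       (auto intro!: nn_integral_cong split: split_indicator)
qed

text \<open>The critical exponent. With \<open>e = exp (- K)\<close> the value is \<open>K\<close>,
  which drives both the divergence for smaller exponents and the growth of the truncated test
  functions.\<close>

lemma nn_integral_powr_minus_one:
  fixes e :: real assumes "0 < e" "e \<le> 1"
  shows "(\<integral>\<^sup>+x. indicator {e..1} x * ennreal (x powr - 1) \<partial>lborel) = ennreal (- ln e)"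
proof -
  have "(\<integral>\<^sup>+x. ennreal (x powr - 1) * indicator {e..1} x \<partial>lborel) = ln 1 - ln e"
    using assms by (intro nn_integral_FTC_Icc)
      (auto intro!: derivative_eq_intros simp: powr_minus_divide has_real_derivative_iff_has_vector_derivative[symmetric])
  then show ?thesis by (simp add: mult.commute)
qed

lemma ennreal_all_ge_imp_top:
  assumes "\<And>K. K \<ge> 0 \<Longrightarrow> ennreal K \<le> x"
  shows "x = \<infinity>"
proof (cases x)
  case (real r)
  then show ?thesis
    using assms[of "r + 1"] by simp
qed simp

text \<open>On the unit interval the integrand dominates the one with exponent -1, whose integral
  down to \<open>exp (- K)\<close> is \<open>K\<close>, for every \<open>K\<close>.\<close>

lemma nn_integral_powr_diverges:
  fixes s :: real assumes "s \<le> -1"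
  shows "(\<integral>\<^sup>+x. indicator {0<..<1} x * ennreal (x powr s) \<partial>lborel) = \<infinity>"
proof -
  have "ennreal K \<le> (\<integral>\<^sup>+x. indicator {0<..<1} x * ennreal (x powr s) \<partial>lborel)" if "K \<ge> 0" for K
  proof -
    have "ennreal K = (\<integral>\<^sup>+x. indicator {exp (-K)..1} x * ennreal (x powr - 1) \<partial>lborel)"
      using that by (subst nn_integral_powr_minus_one) auto
    also have "\<dots> \<le> (\<integral>\<^sup>+x. indicator {0<..<1} x * ennreal (x powr s) \<partial>lborel)"
    proof (rule nn_integral_mono_AE)
      show "AE x in lborel. indicator {exp (-K)..1} x * ennreal (x powr - 1) \<le> indicator {0<..<1} x * ennreal (x powr s)"
        using AE_lborel_singleton[of "1::real"]
      proof eventually_elim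
        case (elim x)
        have "x powr -1 \<le> x powr s" if "0 < x" "x < 1"
          using that assms by (intro powr_mono') auto
        moreover have "exp (-K) > 0" by simp
        ultimately show ?case
          using elim by (auto split: split_indicator intro!: ennreal_leI simp del: exp_gt_zero)
      qed
    qed
    finally show ?thesis .
  qed
  then show ?thesis
    by (rule ennreal_all_ge_imp_top)
qed

text \<open>Kept as an \<open>ennreal\<close> so that the scaling law
  \<open>nn_integral_abs_powr\<close> holds for all \<open>t\<close>; finiteness enters only with
  \<open>t > 1\<close>.\<close>

definition tail_integral :: "real \<Rightarrow> ennreal" where
  "tail_integral t = (\<integral>\<^sup>+x. ennreal ((1 + \<bar>x\<bar>) powr - t) \<partial>lborel)"

lemma tail_integral_finite:
  assumes "t > 1"
  shows "tail_integral t < \<infinity>"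
proof -
  define h where "h x = indicator {1..} x * ennreal (x powr - t)" for x
  have [measurable]: "h \<in> borel_measurable borel"
    unfolding h_def by measurable
  have h: "(\<integral>\<^sup>+x. h x \<partial>lborel) < \<infinity>"
    unfolding h_def by (simp add: nn_integral_powr_tail[OF assms])
  have "tail_integral t \<le> (\<integral>\<^sup>+x. h (1 + 1 * x) + h (1 + (- 1) * x) \<partial>lborel)"
    unfolding tail_integral_def h_def by (intro nn_integral_mono) (auto split: split_indicator simp: abs_if)
  also have "\<dots> = (\<integral>\<^sup>+x. h x \<partial>lborel) + (\<integral>\<^sup>+x. h x \<partial>lborel)"
    using nn_integral_real_affine[of h 1 1] nn_integral_real_affine[of h "-1" 1]
    by (subst nn_integral_add) auto
  also have "\<dots> < \<infinity>"
    using h by simp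
  finally show ?thesis .
qed

lemma nn_integral_abs_powr:
  fixes t \<delta> :: real
  assumes "\<delta> > 0"
  shows "(\<integral>\<^sup>+x. ennreal ((\<delta> + \<bar>x\<bar>) powr - t) \<partial>lborel) = ennreal (\<delta> powr (1 - t)) * tail_integral t"
proof -
  have "(\<integral>\<^sup>+x. ennreal ((\<delta> + \<bar>x\<bar>) powr - t) \<partial>lborel)
      = \<delta> * (\<integral>\<^sup>+x. ennreal ((\<delta> + \<bar>\<delta> * x\<bar>) powr - t) \<partial>lborel)"
    using nn_integral_real_affine[of "\<lambda>x. ennreal ((\<delta> + \<bar>x\<bar>) powr - t)" \<delta> 0] assms by simp
  also have "(\<integral>\<^sup>+x. ennreal ((\<delta> + \<bar>\<delta> * x\<bar>) powr - t) \<partial>lborel)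
      = (\<integral>\<^sup>+x. ennreal (\<delta> powr - t) * ennreal ((1 + \<bar>x\<bar>) powr - t) \<partial>lborel)"
  proof (rule nn_integral_cong)
    fix x
    have "\<delta> + \<bar>\<delta> * x\<bar> = \<delta> * (1 + \<bar>x\<bar>)"
      using assms by (simp add: abs_mult algebra_simps)
    then show "ennreal ((\<delta> + \<bar>\<delta> * x\<bar>) powr - t) = ennreal (\<delta> powr - t) * ennreal ((1 + \<bar>x\<bar>) powr - t)"
      using assms by (simp add: powr_mult ennreal_mult)
  qed
  also have "\<dots> = ennreal (\<delta> powr - t) * tail_integral t"
    unfolding tail_integral_def by (rule nn_integral_cmult) simp
  also have "ennreal \<delta> * (ennreal (\<delta> powr - t) * tail_integral t) = ennreal (\<delta> powr (1 - t)) * tail_integral t"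
  proof -
    have "\<delta> * \<delta> powr - t = \<delta> powr (1 - t)"
      using assms by (simp add: powr_mult_base)
    then show ?thesis
      using assms by (metis ennreal_mult less_imp_le mult.assoc powr_ge_zero)
  qed
  finally show ?thesis .
qed

lemma nn_integral_abs_powr_le:
  assumes "t > 1"
  obtains C where "C > 0" "\<And>\<delta>. \<delta> > 0 \<Longrightarrow>
    (\<integral>\<^sup>+x. ennreal ((\<delta> + \<bar>x\<bar>) powr - t) \<partial>lborel) \<le> ennreal (C * \<delta> powr (1 - t))"
proof -
  obtain D where D: "D \<ge> 0" "tail_integral t = ennreal D"
    using tail_integral_finite[OF assms] by (cases "tail_integral t") auto
  \<comment> \<open>Taking \<open>D + 1\<close> for \<open>D\<close> gives a positive constant
    without a lower bound on \<open>tail_integral t\<close>.\<close>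
  have "(\<integral>\<^sup>+x. ennreal ((\<delta> + \<bar>x\<bar>) powr - t) \<partial>lborel) \<le> ennreal ((D + 1) * \<delta> powr (1 - t))" if "\<delta> > 0" for \<delta>
    unfolding nn_integral_abs_powr[OF that] D(2)
    using D(1) by (subst ennreal_mult[symmetric]) (auto intro!: ennreal_leI simp: algebra_simps)
  then show thesis
    using that[of "D + 1"] D(1) by simp
qed

text \<open>Since \<open>(sqrt \<delta> + \<bar>x\<bar>)\<^sup>2 \<le> 2 * (\<delta> +
  x\<^sup>2)\<close>, this is the preceding bound at \<open>sqrt \<delta>\<close> with exponent
  \<open>2 * t\<close>. A horizontal coordinate thus gains only half a power of \<delta>.\<close>

lemma nn_integral_square_powr_le:
  assumes "t > 1 / 2"
  obtains C where "C > 0" "\<And>\<delta>. \<delta> > 0 \<Longrightarrow>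
    (\<integral>\<^sup>+x. ennreal ((\<delta> + x\<^sup>2) powr - t) \<partial>lborel) \<le> ennreal (C * \<delta> powr (1 / 2 - t))"
proof -
  have t1: "2 * t > 1" using assms by simp
  obtain C where C: "C > 0" "\<And>\<delta>. \<delta> > 0 \<Longrightarrow>
    (\<integral>\<^sup>+x. ennreal ((\<delta> + \<bar>x\<bar>) powr - (2 * t)) \<partial>lborel) \<le> ennreal (C * \<delta> powr (1 - 2 * t))"
    using nn_integral_abs_powr_le[OF t1] by blast
  have "(\<integral>\<^sup>+x. ennreal ((\<delta> + x\<^sup>2) powr - t) \<partial>lborel) \<le> ennreal ((2 powr t * C) * \<delta> powr (1 / 2 - t))"
    if \<delta>: "\<delta> > 0" for \<delta>
  proof -
    have "(\<integral>\<^sup>+x. ennreal ((\<delta> + x\<^sup>2) powr - t) \<partial>lborel)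
      \<le> (\<integral>\<^sup>+x. ennreal (2 powr t) * ennreal ((sqrt \<delta> + \<bar>x\<bar>) powr - (2 * t)) \<partial>lborel)"
    proof (rule nn_integral_mono)
      fix x :: real
      have p: "0 < sqrt \<delta> + \<bar>x\<bar>"
        using \<delta> by (simp add: add_pos_nonneg)
      have "0 \<le> (sqrt \<delta> - \<bar>x\<bar>)\<^sup>2" by simp
      then have "(sqrt \<delta> + \<bar>x\<bar>)\<^sup>2 / 2 \<le> \<delta> + x\<^sup>2"
        using \<delta> by (simp add: power2_eq_square algebra_simps)
      then have "(\<delta> + x\<^sup>2) powr - t \<le> ((sqrt \<delta> + \<bar>x\<bar>)\<^sup>2 / 2) powr - t"
        using p assms by (intro powr_mono2') auto
      also have "\<dots> = 2 powr t * ((sqrt \<delta> + \<bar>x\<bar>) powr 2) powr - t"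
        using p by (simp add: powr_divide_minus)
      also have "\<dots> = 2 powr t * (sqrt \<delta> + \<bar>x\<bar>) powr - (2 * t)"
        unfolding powr_powr by simp
      finally show "ennreal ((\<delta> + x\<^sup>2) powr - t) \<le> ennreal (2 powr t) * ennreal ((sqrt \<delta> + \<bar>x\<bar>) powr - (2 * t))"
        by (simp add: ennreal_mult[symmetric])
    qed
    also have "\<dots> \<le> ennreal (2 powr t) * ennreal (C * sqrt \<delta> powr (1 - 2 * t))"
      using C(2)[of "sqrt \<delta>"] \<delta> by (subst nn_integral_cmult) (auto intro!: mult_left_mono)
    also have "sqrt \<delta> powr (1 - 2 * t) = \<delta> powr (1 / 2 - t)"
      using \<delta> by (simp add: powr_half_sqrt[symmetric] powr_powr algebra_simps)
    finally show ?thesis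
      using C(1) by (simp add: ennreal_mult[symmetric] mult.assoc)
  qed
  then show thesis
    using that[of "2 powr t * C"] C(1) by simp
qed

text \<open>By scaling, \<delta> = 1. Then \<open>(1 + x) powr - t\<close> is at most 1 near zero
  and at most \<open>x powr - t\<close> far out; \<open>s > -1\<close> makes the first part converge
  and \<open>t > s + 1\<close> the second.\<close>

lemma nn_integral_halfline_powr_le:
  assumes "s > -1" "t > s + 1"
  obtains C where "C > 0" "\<And>\<delta>. \<delta> > 0 \<Longrightarrow>
    (\<integral>\<^sup>+x. indicator {0<..} x * ennreal (x powr s * (\<delta> + x) powr - t) \<partial>lborel) \<le> ennreal (C * \<delta> powr (s + 1 - t))"
proof -
  define C where "C = 1 / (s + 1) + 1 / (t - s - 1)"
  have C: "C > 0" using assms by (simp add: C_def add_pos_pos)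
  have t: "t > 0" using assms by simp
  have one: "(\<integral>\<^sup>+x. indicator {0<..} x * ennreal (x powr s * (1 + x) powr - t) \<partial>lborel) \<le> ennreal C"
  proof -
    have "(\<integral>\<^sup>+x. indicator {0<..} x * ennreal (x powr s * (1 + x) powr - t) \<partial>lborel)
      \<le> (\<integral>\<^sup>+x. indicator {0..1} x * ennreal (x powr s) + indicator {1..} x * ennreal (x powr - (t - s)) \<partial>lborel)"
    proof (rule nn_integral_mono)
      fix x :: real
      have 1: "x powr s * (1 + x) powr - t \<le> x powr s" if "x > 0"
      proof -
        have "(1 + x) powr - t \<le> 1 powr - t"
          using that t by (intro powr_mono2') auto
        then show ?thesis by (simp add: mult_left_le)
      qed
      have 2: "x powr s * (1 + x) powr - t \<le> x powr - (t - s)" if "x > 0"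
      proof -
        have "(1 + x) powr - t \<le> x powr - t"
          using that t by (intro powr_mono2') auto
        then have "x powr s * (1 + x) powr - t \<le> x powr s * x powr - t"
          by (rule mult_left_mono) simp
        also have "\<dots> = x powr - (t - s)"
          by (simp add: powr_add[symmetric])
        finally show ?thesis .
      qed
      consider "x \<le> 0" | "0 < x" "x < 1" | "x = 1" | "x > 1" by linarith
      then show "indicator {0<..} x * ennreal (x powr s * (1 + x) powr - t)
        \<le> indicator {0..1} x * ennreal (x powr s) + indicator {1..} x * ennreal (x powr - (t - s))"
        using 1 2 by cases (auto intro!: ennreal_leI add_increasing2 intro: order_trans[OF _ one_le_numeral])
    qed
    also have "\<dots> = ennreal (1 / (s + 1)) + ennreal (1 / ((t - s) - 1))"
      using nn_integral_powr_tail[where t="t - s"] nn_integral_powr_unit[where s=s] assms by (subst nn_integral_add) auto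
    also have "\<dots> = ennreal C"
      using assms by (simp add: C_def ennreal_plus[symmetric] del: ennreal_plus)
    finally show ?thesis .
  qed
  have "(\<integral>\<^sup>+x. indicator {0<..} x * ennreal (x powr s * (\<delta> + x) powr - t) \<partial>lborel) \<le> ennreal (C * \<delta> powr (s + 1 - t))"
    if \<delta>: "\<delta> > 0" for \<delta>
  proof -
    have "(\<integral>\<^sup>+x. indicator {0<..} x * ennreal (x powr s * (\<delta> + x) powr - t) \<partial>lborel)
      = ennreal \<delta> * (\<integral>\<^sup>+x. indicator {0<..} (\<delta> * x) * ennreal ((\<delta> * x) powr s * (\<delta> + \<delta> * x) powr - t) \<partial>lborel)"
      using nn_integral_real_affine[of "\<lambda>x. indicator {0<..} x * ennreal (x powr s * (\<delta> + x) powr - t)" \<delta> 0] \<delta> by simp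
    also have "(\<integral>\<^sup>+x. indicator {0<..} (\<delta> * x) * ennreal ((\<delta> * x) powr s * (\<delta> + \<delta> * x) powr - t) \<partial>lborel)
      = (\<integral>\<^sup>+x. ennreal (\<delta> powr (s - t)) * (indicator {0<..} x * ennreal (x powr s * (1 + x) powr - t)) \<partial>lborel)"
    proof (rule nn_integral_cong)
      fix x
      have "(\<delta> * x) powr s * (\<delta> + \<delta> * x) powr - t = \<delta> powr (s - t) * (x powr s * (1 + x) powr - t)" if "x > 0"
      proof -
        have "(\<delta> + \<delta> * x) powr - t = \<delta> powr - t * (1 + x) powr - t"
          using that \<delta> powr_mult[of \<delta> "1 + x" "- t"] by (simp add: algebra_simps)
        moreover have "\<delta> powr (s - t) = \<delta> powr s * \<delta> powr - t"
          by (simp add: powr_add[symmetric])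
        ultimately show ?thesis
          using that \<delta> by (simp add: powr_mult)
      qed
      then show "indicator {0<..} (\<delta> * x) * ennreal ((\<delta> * x) powr s * (\<delta> + \<delta> * x) powr - t)
        = ennreal (\<delta> powr (s - t)) * (indicator {0<..} x * ennreal (x powr s * (1 + x) powr - t))"
        using \<delta> by (auto split: split_indicator simp: zero_less_mult_iff ennreal_mult[symmetric])
    qed
    also have "\<dots> \<le> ennreal (\<delta> powr (s - t)) * ennreal C"
      using one by (subst nn_integral_cmult) (auto intro!: mult_left_mono)
    also have "ennreal \<delta> * (ennreal (\<delta> powr (s - t)) * ennreal C) = ennreal (C * \<delta> powr (s + 1 - t))"
    proof -
      have "\<delta> * \<delta> powr (s - t) = \<delta> powr (s + 1 - t)"
        using \<delta> by (simp add: powr_mult_base algebra_simps)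
      then show ?thesis
        using \<delta> C by (simp add: ennreal_mult[symmetric] mult.commute mult.left_commute)
    qed
    finally show ?thesis
      by (simp add: mult_left_mono)
  qed
  then show thesis
    using that C by blast
qed

section \<open>Integrals of the kernel\<close>

text \<open>The passage from Lebesgue to Borel measure, where the product and shear formulas are
  available.\<close>

lemma nn_integral_siegel:
  fixes F :: "'n::{finite,linorder} cvec \<Rightarrow> ennreal"
  shows "(\<integral>\<^sup>+w. F w \<partial>lebesgue_on siegel) = (\<integral>\<^sup>+w. F w * indicator siegel w \<partial>lborel)"
  by (subst nn_integral_restrict_space) (simp_all add: nn_integral_completion)

text \<open>A box in the Heisenberg coordinates centred at \<open>z\<close>. The height
  \<open>rho_diag w\<close> is left free, so that it can carry a function of its own in
  \<open>nn_integral_hbox\<close>.\<close>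

definition hbox :: "'n::{finite,linorder} cvec \<Rightarrow> real \<Rightarrow> real \<Rightarrow> 'n cvec set" where
  "hbox z d l = {w. (\<forall>b\<in>horizontal_Basis. \<bar>(w - z) \<bullet> b\<bar> \<le> d) \<and> \<bar>2 * Im (rho z w)\<bar> \<le> l}"

lemma indicator_hbox:
  "indicator (hbox z d l) w
   = (\<Prod>b\<in>horizontal_Basis. indicator {-d..d} ((w - z) \<bullet> b)) * (indicator {-l..l} (2 * Im (rho z w)) :: ennreal)"
proof (cases "\<forall>b\<in>horizontal_Basis. \<bar>(w - z) \<bullet> b\<bar> \<le> d")
  case True
  then have "(\<Prod>b\<in>horizontal_Basis. indicator {-d..d} ((w - z) \<bullet> b)) = (1::ennreal)"
    by (intro prod.neutral) (auto simp: abs_le_iff indicator_def)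
  then show ?thesis
    using True by (auto simp: hbox_def indicator_def abs_le_iff)
next
  case False
  then obtain b where "b \<in> horizontal_Basis" "\<not> \<bar>(w - z) \<bullet> b\<bar> \<le> d" by blast
  then have "(\<Prod>b\<in>horizontal_Basis. indicator {-d..d} ((w - z) \<bullet> b)) = (0::ennreal)"
    by (intro prod_zero) (auto intro!: bexI[of _ b] simp: indicator_def)
  then show ?thesis
    using False by (auto simp: hbox_def indicator_def)
qed

lemma hbox_borel [measurable]: "hbox z d l \<in> sets borel"
proof -
  have "hbox z d l = {w \<in> space borel. (\<forall>b\<in>horizontal_Basis. \<bar>(w - z) \<bullet> b\<bar> \<le> d) \<and> \<bar>2 * Im (rho z w)\<bar> \<le> l}"
    by (simp add: hbox_def)
  also have "\<dots> \<in> sets borel"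
    by measurable
  finally show ?thesis .
qed

lemma nn_integral_hbox:
  fixes z :: "'n::{finite,linorder} cvec"
  assumes [measurable]: "\<phi> \<in> borel_measurable borel" and "d \<ge> 0" "l \<ge> 0"
  shows "(\<integral>\<^sup>+w. indicator (hbox z d l) w * \<phi> (rho_diag w) \<partial>lborel)
    = ennreal ((2 * d) ^ (2 * CARD('n) - 2) * (2 * l)) * (\<integral>\<^sup>+x. \<phi> x \<partial>lborel)"
proof -
  have "(\<integral>\<^sup>+w. indicator (hbox z d l) w * \<phi> (rho_diag w) \<partial>lborel)
    = (\<integral>\<^sup>+x. indicator {-d..d} x \<partial>lborel) ^ (2 * CARD('n) - 2) * (\<integral>\<^sup>+x. indicator {-l..l} x \<partial>lborel)
        * (\<integral>\<^sup>+x. \<phi> x \<partial>lborel)"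
    unfolding indicator_hbox by (rule nn_integral_heisenberg) simp_all
  then show ?thesis
    using assms(2,3) by (simp add: ennreal_mult ennreal_power[symmetric])
qed

text \<open>One bound for each kind of one-dimensional integral: a horizontal coordinate, the
  height, and the last real coordinate. The first two come from \<open>Re_rho\<close>; the third
  adds the bound on the imaginary part, which doubles the constant.\<close>

lemma norm_rho_lower:
  assumes "rho_diag z > 0" "rho_diag w > 0"
  shows "b \<in> horizontal_Basis \<Longrightarrow> rho_diag z + ((w - z) \<bullet> b)\<^sup>2 \<le> 2 * cmod (rho z w)"
    and "rho_diag z + rho_diag w \<le> 2 * cmod (rho z w)"
    and "rho_diag z + \<bar>2 * Im (rho z w)\<bar> \<le> 4 * cmod (rho z w)"
proof -
  have R: "2 * cmod (rho z w) \<ge> rho_diag z + rho_diag w + (norm' (w - z))\<^sup>2"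
    using complex_Re_le_cmod[of "rho z w"] Re_rho[of z w] by linarith
  show "b \<in> horizontal_Basis \<Longrightarrow> rho_diag z + ((w - z) \<bullet> b)\<^sup>2 \<le> 2 * cmod (rho z w)"
    using R assms(2) member_le_sum[of b horizontal_Basis "\<lambda>b. ((w - z) \<bullet> b)\<^sup>2"]
    unfolding norm'_horizontal by simp
  show S: "rho_diag z + rho_diag w \<le> 2 * cmod (rho z w)"
    using R by (smt (verit) zero_le_power2)
  show "rho_diag z + \<bar>2 * Im (rho z w)\<bar> \<le> 4 * cmod (rho z w)"
    using S assms abs_Im_le_cmod[of "rho z w"] by linarith
qed

lemma CARD_ge_1: "1 \<le> CARD('n::finite)"
  by (simp add: Suc_leI)

text \<open>
  The exponent \<open>t\<close> is distributed over the Heisenberg coordinates such that each of the resulting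
  one-dimensional integrals converges with the same margin \<open>\<eta>\<close>.
\<close>

lemma kernel_integral_upper:
  fixes s t :: real
  assumes s: "s > -1" and t: "t > real CARD('n) + 1 + s"
  obtains C where "C > 0" "\<And>z :: 'n::{finite,linorder} cvec. z \<in> siegel \<Longrightarrow>
    (\<integral>\<^sup>+w. ennreal (rho_diag w powr s * cmod (rho z w) powr - t) \<partial>lebesgue_on siegel)
    \<le> ennreal (C * rho_diag z powr (real CARD('n) + 1 + s - t))"
proof -
  define n where "n = real CARD('n)"
  have n1: "n \<ge> 1" using CARD_ge_1[where 'n='n] by (simp add: n_def)
  \<comment> \<open>The surplus of \<open>t\<close> is shared equally among the \<open>2 * n\<close>
    real coordinates: \<open>2 * n - 2\<close> horizontal ones, the last real one and the
    height.\<close>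
  define \<eta> where "\<eta> = (t - n - 1 - s) / (2 * n)"
  have \<eta>: "\<eta> > 0" using n1 t by (simp add: \<eta>_def n_def)
  define N where "N = 2 * CARD('n) - 2"
  have N: "real N = 2 * n - 2"
    using CARD_ge_1[where 'n='n] by (simp add: N_def n_def)
  define tb tx tv where "tb = 1 / 2 + \<eta>" and "tx = 1 + \<eta>" and "tv = s + 1 + \<eta>"
  have sum: "real N * tb + tx + tv = t"
    unfolding tb_def tx_def tv_def N \<eta>_def using n1 by (simp add: field_simps)
  obtain Cb where Cb: "Cb > 0" "\<And>\<delta>. \<delta> > 0 \<Longrightarrow>
    (\<integral>\<^sup>+x. ennreal ((\<delta> + x\<^sup>2) powr - tb) \<partial>lborel) \<le> ennreal (Cb * \<delta> powr (1 / 2 - tb))"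
    using nn_integral_square_powr_le[of tb] \<eta> by (auto simp: tb_def)
  obtain Cx where Cx: "Cx > 0" "\<And>\<delta>. \<delta> > 0 \<Longrightarrow>
    (\<integral>\<^sup>+x. ennreal ((\<delta> + \<bar>x\<bar>) powr - tx) \<partial>lborel) \<le> ennreal (Cx * \<delta> powr (1 - tx))"
    using nn_integral_abs_powr_le[of tx] \<eta> by (auto simp: tx_def)
  obtain Cv where Cv: "Cv > 0" "\<And>\<delta>. \<delta> > 0 \<Longrightarrow>
    (\<integral>\<^sup>+x. indicator {0<..} x * ennreal (x powr s * (\<delta> + x) powr - tv) \<partial>lborel) \<le> ennreal (Cv * \<delta> powr (s + 1 - tv))"
    using nn_integral_halfline_powr_le[of s tv] \<eta> s by (auto simp: tv_def)
  define C where "C = 4 powr t * (Cb ^ N * Cx * Cv)"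
  have C: "C > 0" using Cb(1) Cx(1) Cv(1) by (simp add: C_def)
  have "(\<integral>\<^sup>+w. ennreal (rho_diag w powr s * cmod (rho z w) powr - t) \<partial>lebesgue_on siegel)
    \<le> ennreal (C * rho_diag z powr (real CARD('n) + 1 + s - t))" if z: "z \<in> siegel" for z :: "'n cvec"
  proof -
    define \<delta> where "\<delta> = rho_diag z"
    have \<delta>: "\<delta> > 0" using z by (simp add: \<delta>_def siegel_iff)
    define f h \<phi> where "f x = ennreal ((\<delta> + x\<^sup>2) powr - tb)" and "h x = ennreal ((\<delta> + \<bar>x\<bar>) powr - tx)"
      and "\<phi> x = indicator {0<..} x * ennreal (x powr s * (\<delta> + x) powr - tv)" for x :: real
    have [measurable]: "f \<in> borel_measurable borel" "h \<in> borel_measurable borel" "\<phi> \<in> borel_measurable borel"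
      unfolding f_def h_def \<phi>_def by measurable
    have pw: "ennreal (rho_diag w powr s * cmod (rho z w) powr - t) * indicator siegel w
      \<le> ennreal (4 powr t) * ((\<Prod>b\<in>horizontal_Basis. f ((w - z) \<bullet> b)) * h (2 * Im (rho z w)) * \<phi> (rho_diag w))" for w
    proof (cases "w \<in> siegel")
      case True
      then have w: "rho_diag w > 0" by (simp add: siegel_iff)
      \<comment> \<open>The factor 4 is the largest constant in \<open>norm_rho_lower\<close>, so
        that \<open>r\<close> dominates all three sums at once.\<close>
      define r where "r = 4 * cmod (rho z w)"
      have zw: "rho_diag z > 0" using z by (simp add: siegel_iff)
      have r: "r > 0"
        using norm_rho_lower(2)[OF zw w] zw w unfolding r_def by linarith
      have rb: "r powr - tb \<le> (\<delta> + ((w - z) \<bullet> b)\<^sup>2) powr - tb" if "b \<in> horizontal_Basis" for b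
      proof (rule powr_mono2')
        show "\<delta> + ((w - z) \<bullet> b)\<^sup>2 \<le> r"
          using norm_rho_lower(1)[OF zw w that] norm_ge_zero[of "rho z w"] unfolding r_def \<delta>_def by linarith
      qed (use \<delta> \<eta> in \<open>auto simp: tb_def add_pos_nonneg\<close>)
      have rx: "r powr - tx \<le> (\<delta> + \<bar>2 * Im (rho z w)\<bar>) powr - tx"
        using norm_rho_lower(3)[OF zw w] \<delta> \<eta> unfolding r_def \<delta>_def tx_def
        by (intro powr_mono2') (auto simp: add_pos_nonneg)
      have rv: "r powr - tv \<le> (\<delta> + rho_diag w) powr - tv"
        using norm_rho_lower(2)[OF zw w] \<delta> \<eta> s w unfolding r_def \<delta>_def tv_def
        by (intro powr_mono2') (auto simp: add_pos_nonneg)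
      have "cmod (rho z w) = r / 4"
        by (simp add: r_def)
      then have "cmod (rho z w) powr - t = 4 powr t * r powr - t"
        using r powr_divide_minus[of r 4 t] by (simp only:)
      also have "r powr - t = (r powr - tb) ^ N * r powr - tx * r powr - tv"
        using r by (simp add: powr_realpow[symmetric] powr_powr powr_add[symmetric] sum[symmetric] algebra_simps)
      also have "(r powr - tb) ^ N = (\<Prod>b\<in>(horizontal_Basis :: 'n cvec set). r powr - tb)"
        by (simp add: card_horizontal_Basis N_def)
      finally have "rho_diag w powr s * cmod (rho z w) powr - t
        = 4 powr t * ((\<Prod>b\<in>(horizontal_Basis :: 'n cvec set). r powr - tb) * r powr - tx * (rho_diag w powr s * r powr - tv))"
        by simp
      also have "\<dots> \<le> 4 powr t * ((\<Prod>b\<in>horizontal_Basis. (\<delta> + ((w - z) \<bullet> b)\<^sup>2) powr - tb)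
         * (\<delta> + \<bar>2 * Im (rho z w)\<bar>) powr - tx * (rho_diag w powr s * (\<delta> + rho_diag w) powr - tv))"
        using rb rx rv by (intro mult_left_mono mult_mono prod_mono) (auto intro!: prod_nonneg mult_nonneg_nonneg)
      finally show ?thesis
        using True w
        by (simp add: f_def h_def \<phi>_def prod_ennreal ennreal_mult[symmetric] prod_nonneg ennreal_leI)
    qed simp
    have "(\<integral>\<^sup>+w. ennreal (rho_diag w powr s * cmod (rho z w) powr - t) \<partial>lebesgue_on siegel)
      \<le> (\<integral>\<^sup>+w. ennreal (4 powr t) * ((\<Prod>b\<in>horizontal_Basis. f ((w - z) \<bullet> b)) * h (2 * Im (rho z w)) * \<phi> (rho_diag w)) \<partial>lborel)"
      unfolding nn_integral_siegel by (intro nn_integral_mono pw)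
    also have "\<dots> = ennreal (4 powr t) * ((\<integral>\<^sup>+x. f x \<partial>lborel) ^ N * (\<integral>\<^sup>+x. h x \<partial>lborel) * (\<integral>\<^sup>+x. \<phi> x \<partial>lborel))"
      by (subst nn_integral_cmult) (simp_all add: nn_integral_heisenberg N_def)
    also have "\<dots> \<le> ennreal (4 powr t) * (ennreal (Cb * \<delta> powr (1 / 2 - tb)) ^ N * ennreal (Cx * \<delta> powr (1 - tx))
        * ennreal (Cv * \<delta> powr (s + 1 - tv)))"
      unfolding f_def h_def \<phi>_def using Cb(2) Cx(2) Cv(2) \<delta> by (intro mult_left_mono mult_mono power_mono) auto
    also have "\<dots> = ennreal (4 powr t * ((Cb * \<delta> powr (1 / 2 - tb)) ^ N * (Cx * \<delta> powr (1 - tx)) * (Cv * \<delta> powr (s + 1 - tv))))"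
      using Cb(1) Cx(1) Cv(1) by (simp add: ennreal_mult[symmetric] ennreal_power)
    also have "4 powr t * ((Cb * \<delta> powr (1 / 2 - tb)) ^ N * (Cx * \<delta> powr (1 - tx)) * (Cv * \<delta> powr (s + 1 - tv)))
      = C * ((\<delta> powr (1 / 2 - tb)) ^ N * \<delta> powr (1 - tx) * \<delta> powr (s + 1 - tv))"
      by (simp add: C_def power_mult_distrib)
    also have "(\<delta> powr (1 / 2 - tb)) ^ N * \<delta> powr (1 - tx) * \<delta> powr (s + 1 - tv)
      = \<delta> powr (real N * (1 / 2 - tb) + (1 - tx) + (s + 1 - tv))"
      unfolding powr_add using \<delta> by (simp add: powr_realpow[symmetric] powr_powr mult.commute)
    also have "real N * (1 / 2 - tb) + (1 - tx) + (s + 1 - tv) = n + 1 + s - t"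
      using sum N right_diff_distrib[of "real N" "1 / 2" tb] by linarith
    finally show ?thesis
      by (simp add: \<delta>_def n_def)
  qed
  then show thesis
    using that C by blast
qed

text \<open>The widths \<open>sqrt R\<close> and \<open>R\<close> follow the parabolic scaling of
  the domain: the squared horizontal distance and the imaginary part are both of order
  \<open>R\<close>, so that apart from the two heights \<open>rho z w\<close> contributes at most
  \<open>n * R\<close>.\<close>

lemma hbox_rho_bounds:
  fixes z :: "'n::{finite,linorder} cvec"
  assumes w: "w \<in> hbox z (sqrt R) R" and "R \<ge> 0" "rho_diag z > 0" "rho_diag w > 0"
  shows "(rho_diag z + rho_diag w) / 2 \<le> cmod (rho z w)"
    and "cmod (rho z w) \<le> rho_diag z + rho_diag w + real CARD('n) * R"
proof -
  show "(rho_diag z + rho_diag w) / 2 \<le> cmod (rho z w)"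
    using norm_rho_lower(2)[OF assms(3,4)] by simp
  have "(norm' (w - z))\<^sup>2 \<le> (\<Sum>b\<in>(horizontal_Basis::'n cvec set). R)"
    unfolding norm'_horizontal
  proof (rule sum_mono)
    fix b :: "'n cvec" assume "b \<in> horizontal_Basis"
    then have "\<bar>(w - z) \<bullet> b\<bar> \<le> sqrt R"
      using w by (simp add: hbox_def)
    then have "\<bar>(w - z) \<bullet> b\<bar>\<^sup>2 \<le> (sqrt R)\<^sup>2"
      by (intro power_mono) auto
    then show "((w - z) \<bullet> b)\<^sup>2 \<le> R"
      using assms(2) by simp
  qed
  also have "\<dots> = (2 * real CARD('n) - 2) * R"
    using CARD_ge_1[where 'n='n] by (simp add: card_horizontal_Basis)
  finally have "2 * Re (rho z w) \<le> rho_diag z + rho_diag w + (2 * real CARD('n) - 2) * R"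
    by (simp add: Re_rho)
  moreover have "\<bar>2 * Im (rho z w)\<bar> \<le> R"
    using w by (simp add: hbox_def)
  moreover have "0 \<le> Re (rho z w)"
    using Re_rho_pos[of z w] assms(3,4) by (simp add: siegel_iff)
  moreover have "cmod (rho z w) \<le> \<bar>Re (rho z w)\<bar> + \<bar>Im (rho z w)\<bar>"
    by (rule cmod_le)
  ultimately show "cmod (rho z w) \<le> rho_diag z + rho_diag w + real CARD('n) * R"
    using assms by (simp add: algebra_simps)
qed

text \<open>If \<open>s \<le> -1\<close>, the integral diverges at the boundary already over a fixed
  box, on which the kernel is bounded below by a positive constant. If
  \<open>t \<le> n + 1 + s\<close>, it diverges at infinity: a shell at scale \<open>R\<close> has
  volume of order \<open>R powr (n + 1)\<close> and the integrand is of order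
  \<open>R powr (s - t)\<close> there, so each of infinitely many disjoint shells contributes at
  least a fixed amount.\<close>

lemma kernel_integral_lower:
  fixes z :: "'n::{finite,linorder} cvec" and s t :: real
  assumes z: "z \<in> siegel"
    and fin: "(\<integral>\<^sup>+w. ennreal (rho_diag w powr s * cmod (rho z w) powr - t) \<partial>lebesgue_on siegel) < \<infinity>"
  shows "s > -1" and "t > real CARD('n) + 1 + s"
proof -
  define n where "n = real CARD('n)"
  have n1: "n \<ge> 1" using CARD_ge_1[where 'n='n] by (simp add: n_def)
  define N where "N = 2 * CARD('n) - 2"
  have N: "real N = 2 * n - 2"
    using CARD_ge_1[where 'n='n] by (simp add: N_def n_def)
  define \<delta> where "\<delta> = rho_diag z"
  have \<delta>: "\<delta> > 0" using z by (simp add: \<delta>_def siegel_iff)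
  define F where "F w = ennreal (rho_diag w powr s * cmod (rho z w) powr - t) * indicator siegel w" for w
  have [measurable]: "F \<in> borel_measurable borel"
    unfolding F_def by measurable
  have fin': "(\<integral>\<^sup>+w. F w \<partial>lborel) < \<infinity>"
    using fin unfolding nn_integral_siegel F_def .
  show "s > -1"
  proof (rule ccontr)
    assume "\<not> s > -1"
    then have inf: "(\<integral>\<^sup>+x. indicator {0<..<1} x * ennreal (x powr s) \<partial>lborel) = \<infinity>"
      by (intro nn_integral_powr_diverges) simp
    define c where "c = min ((\<delta> / 2) powr - t) ((\<delta> + 1 + n) powr - t)"
    have c: "c > 0" using \<delta> n1 by (simp add: c_def)
    define \<phi> where "\<phi> x = ennreal c * (indicator {0<..<1} x * ennreal (x powr s))" for x
    have [measurable]: "\<phi> \<in> borel_measurable borel"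
      unfolding \<phi>_def by measurable
    have "indicator (hbox z (sqrt 1) 1) w * \<phi> (rho_diag w) \<le> F w" for w
    proof (cases "w \<in> hbox z (sqrt 1) 1 \<and> 0 < rho_diag w \<and> rho_diag w < 1")
      case True
      then have b: "(\<delta> + rho_diag w) / 2 \<le> cmod (rho z w)" "cmod (rho z w) \<le> \<delta> + rho_diag w + n"
        using hbox_rho_bounds[of w z 1] \<delta> by (auto simp: \<delta>_def n_def)
      have "c \<le> cmod (rho z w) powr - t"
        unfolding c_def by (rule powr_lower_bound) (use b \<delta> True in auto)
      then have "c * rho_diag w powr s \<le> rho_diag w powr s * cmod (rho z w) powr - t"
        unfolding mult.commute[of c] by (rule mult_left_mono) simp
      then show ?thesis
        using True c by (simp add: F_def \<phi>_def siegel_iff ennreal_mult[symmetric] ennreal_leI)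
    qed (auto simp: \<phi>_def indicator_def)
    then have "(\<integral>\<^sup>+w. indicator (hbox z (sqrt 1) 1) w * \<phi> (rho_diag w) \<partial>lborel) \<le> (\<integral>\<^sup>+w. F w \<partial>lborel)"
      by (intro nn_integral_mono)
    also have "(\<integral>\<^sup>+w. indicator (hbox z (sqrt 1) 1) w * \<phi> (rho_diag w) \<partial>lborel) = \<infinity>"
    proof -
      have "(\<integral>\<^sup>+x. \<phi> x \<partial>lborel) = \<infinity>"
        unfolding \<phi>_def using c inf by (subst nn_integral_cmult) (auto simp: ennreal_mult_eq_top_iff)
      then show ?thesis
        by (subst nn_integral_hbox) (auto simp: ennreal_mult_eq_top_iff)
    qed
    finally show False
      using fin' by simp
  qed
  show "t > real CARD('n) + 1 + s"
  proof (rule ccontr)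
    assume "\<not> t > real CARD('n) + 1 + s"
    then have ts: "s - t + n + 1 \<ge> 0" by (simp add: n_def)
    \<comment> \<open>Doubling makes the height ranges of the shells disjoint. The factor
      \<open>1 + \<delta>\<close> makes every scale at least 1 and at least \<delta>, so that the
      height of \<open>z\<close> is absorbed into \<open>R k\<close>.\<close>
    define R where "R k = 2 ^ k * (1 + \<delta>)" for k :: nat
    have R: "R k \<ge> 1" "R k \<ge> \<delta>" "R k > 0" for k
    proof -
      have "1 * (1 + \<delta>) \<le> R k"
        unfolding R_def using \<delta> by (intro mult_right_mono) auto
      then show "R k \<ge> 1" "R k \<ge> \<delta>" "R k > 0" using \<delta> by auto
    qed
    \<comment> \<open>On a shell \<open>cmod (rho z w)\<close> lies between \<open>R k / 2\<close>
      and \<open>(3 + n) * R k\<close>: at most \<open>R k\<close> from \<open>z\<close>, at most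
      \<open>2 * R k\<close> from \<open>w\<close> and \<open>n * R k\<close> from the
      widths.\<close>
    define c1 where "c1 = min ((1 / 2) powr - t) ((3 + n) powr - t)"
    define c2 where "c2 = min (1 powr s) (2 powr s :: real)"
    have c: "c1 > 0" "c2 > 0" using n1 by (simp_all add: c1_def c2_def)
    define E where "E k = hbox z (sqrt (R k)) (R k) \<inter> {w. R k \<le> rho_diag w \<and> rho_diag w < 2 * R k}" for k
    define c3 where "c3 = c1 * c2 * (2 ^ N * 2)"
    have c3: "c3 > 0" using c by (simp add: c3_def)
    have [measurable]: "E k \<in> sets borel" for k
    proof -
      have "E k = {w \<in> space borel. w \<in> hbox z (sqrt (R k)) (R k) \<and> R k \<le> rho_diag w \<and> rho_diag w < 2 * R k}"
        by (auto simp: E_def)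
      also have "\<dots> \<in> sets borel" by measurable
      finally show ?thesis .
    qed
    have int: "ennreal c3 \<le> (\<integral>\<^sup>+w. F w * indicator (E k) w \<partial>lborel)" for k
    proof -
      define q where "q = c1 * R k powr - t * (c2 * R k powr s)"
      have q: "q > 0" using c R(3)[of k] by (simp add: q_def)
      define \<phi> where "\<phi> x = ennreal q * indicator {R k..<2 * R k} x" for x
      have [measurable]: "\<phi> \<in> borel_measurable borel"
        unfolding \<phi>_def by measurable
      have "indicator (hbox z (sqrt (R k)) (R k)) w * \<phi> (rho_diag w) \<le> F w * indicator (E k) w" for w
      proof (cases "w \<in> E k")
        case True
        then have v: "R k \<le> rho_diag w" "rho_diag w < 2 * R k" and w: "w \<in> hbox z (sqrt (R k)) (R k)"
          by (auto simp: E_def)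
        have v0: "rho_diag w > 0" using v R[of k] by linarith
        have "(\<delta> + rho_diag w) / 2 \<le> cmod (rho z w)" "cmod (rho z w) \<le> \<delta> + rho_diag w + n * R k"
          using hbox_rho_bounds[OF w] \<delta> R[of k] v0 by (auto simp: \<delta>_def n_def)
        then have b: "1 / 2 \<le> cmod (rho z w) / R k" "cmod (rho z w) / R k \<le> 3 + n"
          using v \<delta> R[of k] by (auto simp: field_simps)
        have "c1 \<le> (cmod (rho z w) / R k) powr - t"
          unfolding c1_def by (rule powr_lower_bound) (use b in auto)
        then have "c1 * R k powr - t \<le> R k powr t * cmod (rho z w) powr - t * R k powr - t"
          using R(3)[of k] by (intro mult_right_mono) (simp_all add: powr_divide_minus)
        also have "\<dots> = cmod (rho z w) powr - t"
          using R(3)[of k] by (simp add: powr_minus)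
        finally have 1: "c1 * R k powr - t \<le> cmod (rho z w) powr - t" .
        have "c2 \<le> (rho_diag w / R k) powr s"
          unfolding c2_def by (rule powr_lower_bound) (use v R[of k] in \<open>auto simp: field_simps\<close>)
        then have 2: "c2 * R k powr s \<le> rho_diag w powr s"
          using R(3)[of k] v0 by (simp add: powr_divide pos_le_divide_eq)
        have "q \<le> rho_diag w powr s * cmod (rho z w) powr - t"
          unfolding q_def mult.commute[of "rho_diag w powr s"] using c by (intro mult_mono 1 2) auto
        then show ?thesis
          using True v v0 w by (simp add: F_def \<phi>_def siegel_iff ennreal_leI)
      qed (auto simp: \<phi>_def indicator_def E_def)
      then have "(\<integral>\<^sup>+w. indicator (hbox z (sqrt (R k)) (R k)) w * \<phi> (rho_diag w) \<partial>lborel) \<le> (\<integral>\<^sup>+w. F w * indicator (E k) w \<partial>lborel)"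
        by (intro nn_integral_mono)
      also have "(\<integral>\<^sup>+w. indicator (hbox z (sqrt (R k)) (R k)) w * \<phi> (rho_diag w) \<partial>lborel)
        = ennreal ((2 * sqrt (R k)) ^ N * (2 * R k)) * (ennreal q * ennreal (R k))"
      proof -
        have "(\<integral>\<^sup>+x. \<phi> x \<partial>lborel) = ennreal q * ennreal (R k)"
          unfolding \<phi>_def using R(3)[of k] by (subst nn_integral_cmult) auto
        then show ?thesis
          using R(3)[of k] by (subst nn_integral_hbox) (auto simp: N_def)
      qed
      also have "\<dots> = ennreal ((2 * sqrt (R k)) ^ N * (2 * R k) * (q * R k))"
        using R[of k] q by (simp add: ennreal_mult[symmetric])
      also have "(2 * sqrt (R k)) ^ N * (2 * R k) * (q * R k) = c3 * R k powr (s - t + n + 1)"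
      proof -
        have "sqrt (R k) ^ N = R k powr (n - 1)"
        proof -
          have "1 / 2 * real N = n - 1" using N by simp
          then show ?thesis
            using R(3)[of k] by (simp only: powr_half_sqrt[symmetric] powr_realpow[symmetric] powr_powr less_imp_le powr_gt_zero)
        qed
        moreover have "R k powr (s - t + n + 1) = R k powr (n - 1) * R k * R k * R k powr - t * R k powr s"
        proof -
          have "R k powr (s - t + n + 1) = R k powr ((n - 1) + 1 + 1 + - t + s)"
            by (simp add: algebra_simps)
          also have "\<dots> = R k powr (n - 1) * R k * R k * R k powr - t * R k powr s"
            unfolding powr_add using R(3)[of k] by simp
          finally show ?thesis .
        qed
        ultimately show ?thesis
          by (simp add: c3_def q_def power_mult_distrib)
      qed
      finally have "ennreal (c3 * R k powr (s - t + n + 1)) \<le> (\<integral>\<^sup>+w. F w * indicator (E k) w \<partial>lborel)" .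
      moreover have "c3 * 1 \<le> c3 * R k powr (s - t + n + 1)"
        using c3 R(1)[of k] ts by (intro mult_left_mono ge_one_powr_ge_zero) auto
      ultimately show ?thesis
        by (metis ennreal_leI mult.right_neutral order_trans)
    qed
    have disj: "disjoint_family E"
    proof -
      have *: "E j \<inter> E k = {}" if "j < k" for j k
      proof -
        have "(2::real) ^ Suc j \<le> 2 ^ k"
          using that by (intro power_increasing) auto
        then have "2 * R j \<le> R k"
          unfolding R_def using \<delta> by (simp add: mult.assoc[symmetric])
        then show ?thesis by (auto simp: E_def)
      qed
      then show ?thesis
        unfolding disjoint_family_on_def by (metis Int_commute nat_neq_iff)
    qed
    have "ennreal (real m * c3) \<le> (\<integral>\<^sup>+w. F w \<partial>lborel)" for m
    proof -
      have "ennreal (real m * c3) = (\<Sum>k<m. ennreal c3)"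
        using c3 by (simp add: ennreal_mult ennreal_of_nat_eq_real_of_nat)
      also have "\<dots> \<le> (\<Sum>k<m. (\<integral>\<^sup>+w. F w * indicator (E k) w \<partial>lborel))"
        by (intro sum_mono int)
      also have "\<dots> = (\<integral>\<^sup>+w. (\<Sum>k<m. F w * indicator (E k) w) \<partial>lborel)"
        by (subst nn_integral_sum) auto
      also have "\<dots> = (\<integral>\<^sup>+w. F w * indicator (\<Union>k<m. E k) w \<partial>lborel)"
        using disjoint_family_on_mono[OF subset_UNIV disj]
        by (subst indicator_UN_disjoint) (simp_all add: sum_distrib_left)
      also have "\<dots> \<le> (\<integral>\<^sup>+w. F w \<partial>lborel)"
        by (intro nn_integral_mono) (auto split: split_indicator)
      finally show ?thesis .
    qed
    moreover obtain D where "D \<ge> 0" "(\<integral>\<^sup>+w. F w \<partial>lborel) = ennreal D"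
      using fin' by (cases "(\<integral>\<^sup>+w. F w \<partial>lborel)") auto
    moreover obtain m :: nat where "D < real m * c3"
      using c3 reals_Archimedean3 by blast
    ultimately show False
      by (metis ennreal_le_iff not_le)
  qed
qed

section \<open>Boxes around the apex\<close>

definition apex :: "real \<Rightarrow> 'n::{finite,linorder} cvec" where
  "apex R = last_axis (\<i> * of_real R)"

lemma last_coord_apex [simp]: "last_coord (apex R) = \<i> * of_real R"
  by (simp add: apex_def last_coord_def)

lemma apex_nth: "j \<noteq> Max UNIV \<Longrightarrow> apex R $ j = 0"
  by (simp add: apex_def axis_def)

lemma inner'_apex [simp]: "inner' z (apex R) = 0" "inner' (apex R) z = 0"
  unfolding inner'_def by (auto intro!: sum.neutral simp: apex_nth)

lemma rho_diag_apex [simp]: "rho_diag (apex R) = R"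
  by (simp add: rho_diag_def norm'_def)

lemma apex_siegel: "R > 0 \<Longrightarrow> apex R \<in> siegel"
  by (simp add: siegel_iff)

lemma norm_inner'_le: "cmod (inner' z w) \<le> norm' z * norm' w"
proof -
  have n: "norm' v = L2_set (\<lambda>j. cmod (v $ j)) (UNIV - {Max UNIV})" for v :: "'a cvec"
    unfolding L2_set_def norm'_squared[symmetric] by (simp add: norm'_def inner'_def sum_nonneg)
  have "cmod (inner' z w) \<le> (\<Sum>j\<in>UNIV - {Max UNIV}. \<bar>cmod (z $ j)\<bar> * \<bar>cmod (w $ j)\<bar>)"
    unfolding inner'_def by (rule order_trans[OF norm_sum]) (simp add: norm_mult)
  also have "\<dots> \<le> norm' z * norm' w"
    unfolding n by (rule L2_set_mult_ineq)
  finally show ?thesis .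
qed

text \<open>The image of the box for \<open>R = 1\<close> under the dilation by
  \<open>sqrt R\<close> in \<open>z'\<close> and by \<open>R\<close> in the last coordinate, which
  preserves the domain. Centring \<open>hbox\<close> at \<open>0\<close> gives the same set as
  centring it at \<open>apex R\<close>: only \<open>z'\<close> and the real part of the last
  coordinate of the centre enter.\<close>

definition apex_box :: "real \<Rightarrow> real \<Rightarrow> 'n::{finite,linorder} cvec set" where
  "apex_box \<epsilon> R = hbox 0 (\<epsilon> * sqrt R) (\<epsilon> * R) \<inter> {w. \<bar>rho_diag w - R\<bar> \<le> \<epsilon> * R}"

lemma apex_box_borel [measurable]: "apex_box \<epsilon> R \<in> sets borel"
proof -
  have "apex_box \<epsilon> R = {w \<in> space borel. w \<in> hbox 0 (\<epsilon> * sqrt R) (\<epsilon> * R) \<and> \<bar>rho_diag w - R\<bar> \<le> \<epsilon> * R}"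
    by (auto simp: apex_box_def)
  also have "\<dots> \<in> sets borel"
    by measurable
  finally show ?thesis .
qed

lemma apex_box_rho_diag:
  assumes "w \<in> apex_box \<epsilon> R" "\<epsilon> \<le> 1 / 2" "R > 0"
  shows "R / 2 \<le> rho_diag w" "rho_diag w \<le> 2 * R"
proof -
  have "\<epsilon> * R \<le> 1 / 2 * R"
    using assms by (intro mult_right_mono) auto
  moreover have "\<bar>rho_diag w - R\<bar> \<le> \<epsilon> * R"
    using assms by (simp add: apex_box_def)
  ultimately show "R / 2 \<le> rho_diag w" "rho_diag w \<le> 2 * R"
    using assms(3) by linarith+
qed

lemma apex_box_siegel:
  assumes "\<epsilon> \<le> 1 / 2" "R > 0"
  shows "apex_box \<epsilon> R \<subseteq> siegel"
  using apex_box_rho_diag[OF _ assms] assms(2) by (force simp: siegel_iff)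

text \<open>
  For \<open>w\<close> close to \<open>apex R\<close>, on the scale of \<open>R\<close>, the quotient \<open>rho z w / rho z (apex R)\<close> is close
  to \<open>1\<close> uniformly in \<open>z\<close>, since \<open>(norm' z)\<^sup>2\<close> is dominated by \<open>Im (last_coord z)\<close>.
\<close>

lemma rho_near_apex:
  fixes z w :: "'n::{finite,linorder} cvec"
  assumes z: "z \<in> siegel" and w: "w \<in> apex_box \<epsilon> R" and \<epsilon>: "0 < \<epsilon>" "\<epsilon> \<le> 1 / 2" and R: "R > 0"
  shows "cmod (rho z w - rho z (apex R)) \<le> 4 * real CARD('n) * \<epsilon> * cmod (rho z (apex R))"
proof -
  define n where "n = real CARD('n)"
  have n1: "n \<ge> 1" using CARD_ge_1[where 'n='n] by (simp add: n_def)
  have hb: "(w \<bullet> b)\<^sup>2 \<le> \<epsilon>\<^sup>2 * R" if "b \<in> horizontal_Basis" for b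
  proof -
    have "\<bar>w \<bullet> b\<bar> \<le> \<epsilon> * sqrt R"
      using w that by (simp add: apex_box_def hbox_def)
    then have "\<bar>w \<bullet> b\<bar>\<^sup>2 \<le> (\<epsilon> * sqrt R)\<^sup>2"
      by (intro power_mono) auto
    then show ?thesis
      using R by (simp add: power_mult_distrib)
  qed
  have "(norm' w)\<^sup>2 \<le> (\<Sum>b\<in>(horizontal_Basis::'n cvec set). \<epsilon>\<^sup>2 * R)"
    unfolding norm'_horizontal by (intro sum_mono hb)
  also have "\<dots> = (2 * n - 2) * (\<epsilon>\<^sup>2 * R)"
    using CARD_ge_1[where 'n='n] by (simp add: card_horizontal_Basis n_def)
  finally have nw: "(norm' w)\<^sup>2 \<le> (2 * n - 2) * (\<epsilon>\<^sup>2 * R)" .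
  \<comment> \<open>Two bounds on \<open>norm' w\<close> are kept. This one, of order
    \<open>\<epsilon> * sqrt R\<close>, is for \<open>inner' z w\<close>; \<open>nw2\<close> is for
    the imaginary part of the last coordinate, where the square occurs.\<close>
  have nw1: "norm' w \<le> 2 * n * \<epsilon> * sqrt R"
  proof (rule power2_le_imp_le)
    have "(norm' w)\<^sup>2 \<le> (2 * n)\<^sup>2 * (\<epsilon>\<^sup>2 * R)"
    proof (rule order_trans[OF nw], rule mult_right_mono)
      have "2 * n * 1 \<le> 2 * n * (2 * n)" using n1 by (intro mult_left_mono) auto
      then show "2 * n - 2 \<le> (2 * n)\<^sup>2" by (simp add: power2_eq_square)
    qed (use R in auto)
    then show "(norm' w)\<^sup>2 \<le> (2 * n * \<epsilon> * sqrt R)\<^sup>2"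
      using R by (simp add: power_mult_distrib)
  qed (use n1 \<epsilon> R in auto)
  have nw2: "(norm' w)\<^sup>2 \<le> (2 * n - 2) * (\<epsilon> * R)"
  proof (rule order_trans[OF nw], rule mult_left_mono)
    have "\<epsilon> * (\<epsilon> * R) \<le> 1 * (\<epsilon> * R)"
      using \<epsilon> R by (intro mult_right_mono) auto
    then show "\<epsilon>\<^sup>2 * R \<le> \<epsilon> * R"
      by (simp add: power2_eq_square)
  qed (use n1 in auto)
  have re: "\<bar>Re (last_coord w)\<bar> \<le> \<epsilon> * R"
    using w by (simp add: apex_box_def hbox_def Im_rho inner'_def last_coord_def)
  have im: "\<bar>Im (last_coord w) - R\<bar> \<le> \<epsilon> * R + (norm' w)\<^sup>2"
    using w by (simp add: apex_box_def rho_diag_def abs_le_iff) (smt (verit) zero_le_power2)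
  have "rho z w - rho z (apex R) = \<i> / 2 * cnj (last_coord w - \<i> * of_real R) - inner' z w"
    by (simp add: rho_def algebra_simps diff_divide_distrib)
  then have "cmod (rho z w - rho z (apex R)) \<le> cmod (last_coord w - \<i> * of_real R) / 2 + cmod (inner' z w)"
    by (metis norm_triangle_ineq4 norm_mult norm_divide norm_ii norm_numeral complex_mod_cnj mult_1 times_divide_eq_left)
  also have "cmod (last_coord w - \<i> * of_real R) \<le> 2 * n * \<epsilon> * R"
    using cmod_le[of "last_coord w - \<i> * of_real R"] re im nw2 by (simp add: algebra_simps)
  also have "cmod (inner' z w) \<le> n * \<epsilon> * (R + (norm' z)\<^sup>2)"
  proof -
    have "cmod (inner' z w) \<le> norm' z * norm' w"
      by (rule norm_inner'_le)
    also have "\<dots> \<le> norm' z * (2 * n * \<epsilon> * sqrt R)"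
      by (intro mult_left_mono nw1) (simp add: norm'_def inner'_def sum_nonneg)
    also have "\<dots> = n * \<epsilon> * (2 * sqrt R * norm' z)"
      by simp
    \<comment> \<open>The product \<open>sqrt R * norm' z\<close> is traded for two squares, each of
      which \<open>Re (rho z (apex R))\<close> controls; this makes the estimate uniform in
      \<open>z\<close>.\<close>
    also have "\<dots> \<le> n * \<epsilon> * ((sqrt R)\<^sup>2 + (norm' z)\<^sup>2)"
      using n1 \<epsilon> by (intro mult_left_mono sum_squares_bound) auto
    finally show ?thesis using R by simp
  qed
  also have "2 * n * \<epsilon> * R / 2 + n * \<epsilon> * (R + (norm' z)\<^sup>2) = n * \<epsilon> * (2 * R + (norm' z)\<^sup>2)"
    by (simp add: algebra_simps)
  also have "\<dots> \<le> n * \<epsilon> * (4 * Re (rho z (apex R)))"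
  proof (rule mult_left_mono)
    have "2 * Re (rho z (apex R)) = R + Im (last_coord z)"
      by (simp add: rho_def)
    then show "2 * R + (norm' z)\<^sup>2 \<le> 4 * Re (rho z (apex R))"
      using z R zero_le_power2[of "norm' z"] unfolding siegel_def mem_Collect_eq by linarith
  qed (use n1 \<epsilon> in auto)
  also have "\<dots> \<le> n * \<epsilon> * (4 * cmod (rho z (apex R)))"
    using n1 \<epsilon> by (intro mult_left_mono complex_Re_le_cmod) auto
  finally show ?thesis
    by (simp add: n_def mult_ac)
qed

text \<open>By the scaling of the box, its volume is of order \<open>R powr (n + 1)\<close> and the
  weight on it of order \<open>R powr b\<close>. Used with the exponent of the operator for images,
  with \<alpha> for norms, and with 0 to see that the domain is not a null set.\<close>

lemma apex_box_weight_lower: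
  fixes b \<epsilon> :: real
  assumes \<epsilon>: "0 < \<epsilon>" "\<epsilon> \<le> 1 / 2"
  obtains c0 where "c0 > 0" "\<And>R. R > 0 \<Longrightarrow>
    ennreal (c0 * R powr (b + real CARD('n) + 1))
    \<le> (\<integral>\<^sup>+w. ennreal (rho_diag w powr b) * indicator (apex_box \<epsilon> R :: 'n::{finite,linorder} cvec set) w \<partial>lebesgue_on siegel)"
proof -
  define n where "n = real CARD('n)"
  define N where "N = 2 * CARD('n) - 2"
  have N: "real N = 2 * n - 2"
    using CARD_ge_1[where 'n='n] by (simp add: N_def n_def)
  define c1 where "c1 = min ((1 / 2) powr b) (2 powr b :: real)"
  have c1: "c1 > 0" by (simp add: c1_def)
  define c0 where "c0 = c1 * (2 * \<epsilon>) ^ N * (2 * \<epsilon>) * (2 * \<epsilon>)"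
  have "ennreal (c0 * R powr (b + n + 1))
    \<le> (\<integral>\<^sup>+w. ennreal (rho_diag w powr b) * indicator (apex_box \<epsilon> R :: 'n cvec set) w \<partial>lebesgue_on siegel)"
    if R: "R > 0" for R
  proof -
    define q where "q = c1 * R powr b"
    have q: "q > 0" using c1 R by (simp add: q_def)
    define \<phi> where "\<phi> x = ennreal q * indicator {R - \<epsilon> * R..R + \<epsilon> * R} x" for x
    have [measurable]: "\<phi> \<in> borel_measurable borel"
      unfolding \<phi>_def by measurable
    have \<phi>: "(\<integral>\<^sup>+x. \<phi> x \<partial>lborel) = ennreal q * ennreal (2 * \<epsilon> * R)"
      unfolding \<phi>_def using \<epsilon> R by (subst nn_integral_cmult) (auto simp: mult_ac)
    have "R powr (b + n + 1) = R powr (b + (n - 1) + 1 + 1)"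
      by (simp add: algebra_simps)
    also have "\<dots> = R powr b * R powr (n - 1) * R * R"
      unfolding powr_add using R by simp
    also have "R powr (n - 1) = sqrt R ^ N"
    proof -
      have "1 / 2 * real N = n - 1" using N by simp
      then show ?thesis
        using R by (simp only: powr_half_sqrt[symmetric] powr_realpow[symmetric] powr_powr less_imp_le powr_gt_zero)
    qed
    finally have "c0 * R powr (b + n + 1) = ((2 * (\<epsilon> * sqrt R)) ^ N * (2 * (\<epsilon> * R))) * (q * (2 * \<epsilon> * R))"
      by (simp add: c0_def q_def power_mult_distrib)
    then have "ennreal (c0 * R powr (b + n + 1))
      = ennreal ((2 * (\<epsilon> * sqrt R)) ^ N * (2 * (\<epsilon> * R))) * (\<integral>\<^sup>+x. \<phi> x \<partial>lborel)"
      unfolding \<phi> using q \<epsilon> R by (simp add: ennreal_mult[symmetric])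
    also have "\<dots> = (\<integral>\<^sup>+w. indicator (hbox (0::'n cvec) (\<epsilon> * sqrt R) (\<epsilon> * R)) w * \<phi> (rho_diag w) \<partial>lborel)"
      using \<epsilon> R by (subst nn_integral_hbox) (auto simp: N_def)
    also have "\<dots> \<le> (\<integral>\<^sup>+w. ennreal (rho_diag w powr b) * indicator (apex_box \<epsilon> R :: 'n cvec set) w * indicator siegel w \<partial>lborel)"
    proof (rule nn_integral_mono)
      fix w :: "'n cvec"
      show "indicator (hbox 0 (\<epsilon> * sqrt R) (\<epsilon> * R)) w * \<phi> (rho_diag w)
        \<le> ennreal (rho_diag w powr b) * indicator (apex_box \<epsilon> R) w * indicator siegel w"
      proof (cases "w \<in> apex_box \<epsilon> R")
        case True
        note v = apex_box_rho_diag[OF True \<epsilon>(2) R]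
        have "c1 \<le> (rho_diag w / R) powr b"
          unfolding c1_def by (rule powr_lower_bound) (use v R in \<open>auto simp: field_simps\<close>)
        then have "q \<le> rho_diag w powr b"
          using R v by (simp add: powr_divide pos_le_divide_eq q_def)
        moreover have "w \<in> siegel"
          using True apex_box_siegel[OF \<epsilon>(2) R] by blast
        ultimately show ?thesis
          using True by (auto simp: \<phi>_def indicator_def ennreal_leI)
      qed (auto simp: \<phi>_def indicator_def apex_box_def abs_le_iff algebra_simps)
    qed
    finally show ?thesis
      unfolding nn_integral_siegel .
  qed
  moreover have "c0 > 0"
    using c1 \<epsilon> by (simp add: c0_def)
  ultimately show thesis
    using that by (simp add: n_def)
qed

lemma apex_box_weight_finite:
  fixes b \<epsilon> :: real
  assumes \<epsilon>: "0 < \<epsilon>" "\<epsilon> \<le> 1 / 2" and R: "R > 0"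
  shows "(\<integral>\<^sup>+w. ennreal (rho_diag w powr b) * indicator (apex_box \<epsilon> R :: 'n::{finite,linorder} cvec set) w \<partial>lebesgue_on siegel) < \<infinity>"
proof -
  define q where "q = max ((R / 2) powr b) ((2 * R) powr b)"
  define \<phi> where "\<phi> x = ennreal q * indicator {R / 2..2 * R} x" for x
  have [measurable]: "\<phi> \<in> borel_measurable borel"
    unfolding \<phi>_def by measurable
  have \<phi>: "(\<integral>\<^sup>+x. \<phi> x \<partial>lborel) = ennreal q * ennreal (2 * R - R / 2)"
    unfolding \<phi>_def using R by (subst nn_integral_cmult) auto
  have "(\<integral>\<^sup>+w. ennreal (rho_diag w powr b) * indicator (apex_box \<epsilon> R) w \<partial>lebesgue_on (siegel :: 'n cvec set))
    \<le> (\<integral>\<^sup>+w. indicator (hbox (0::'n cvec) (\<epsilon> * sqrt R) (\<epsilon> * R)) w * \<phi> (rho_diag w) \<partial>lborel)"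
    unfolding nn_integral_siegel
  proof (rule nn_integral_mono)
    fix w :: "'n cvec"
    show "ennreal (rho_diag w powr b) * indicator (apex_box \<epsilon> R) w * indicator siegel w
      \<le> indicator (hbox 0 (\<epsilon> * sqrt R) (\<epsilon> * R)) w * \<phi> (rho_diag w)"
    proof (cases "w \<in> apex_box \<epsilon> R")
      case True
      note v = apex_box_rho_diag[OF True \<epsilon>(2) R]
      have "rho_diag w powr b \<le> q"
      proof (cases "b \<ge> 0")
        case True
        then have "rho_diag w powr b \<le> (2 * R) powr b" using v R by (intro powr_mono2) auto
        then show ?thesis by (simp add: q_def)
      next
        case False
        then have "rho_diag w powr b \<le> (R / 2) powr b" using v R by (intro powr_mono2') auto
        then show ?thesis by (simp add: q_def)
      qed
      then show ?thesis
        using True v by (auto simp: \<phi>_def indicator_def apex_box_def ennreal_leI)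
    qed auto
  qed
  also have "\<dots> = ennreal ((2 * (\<epsilon> * sqrt R)) ^ (2 * CARD('n) - 2) * (2 * (\<epsilon> * R))) * (ennreal q * ennreal (2 * R - R / 2))"
    using \<epsilon> R by (subst nn_integral_hbox) (auto simp: \<phi>)
  also have "\<dots> < \<infinity>"
    by (simp add: ennreal_mult_less_top)
  finally show ?thesis .
qed

section \<open>Lebesgue measure on the domain\<close>

lemma sigma_finite_siegel: "sigma_finite_measure (lebesgue_on (siegel :: 'n::{finite,linorder} cvec set))"
proof -
  have "sigma_finite_measure (lebesgue :: 'n cvec measure)"
  proof
    obtain A :: "'n cvec set set" where "countable A" "A \<subseteq> sets lborel" "\<Union>A = space lborel" "\<forall>a\<in>A. emeasure lborel a \<noteq> \<infinity>"
      using lborel.sigma_finite_countable by blast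
    then show "\<exists>A :: 'n cvec set set. countable A \<and> A \<subseteq> sets lebesgue \<and> \<Union>A = space lebesgue \<and> (\<forall>a\<in>A. emeasure lebesgue a \<noteq> \<infinity>)"
      by (intro exI[of _ A]) (auto simp: subset_eq)
  qed
  then show ?thesis
    by (rule sigma_finite_measure_restrict_space) simp
qed

lemma borel_imp_measurable_siegel:
  assumes "g \<in> measurable borel N"
  shows "g \<in> measurable (lebesgue_on siegel) N"
  using assms by (intro measurable_restrict_space1 measurable_completion) simp

text \<open>Joint measurability of the kernel can be checked on Borel sets; only the factor
  \<open>f\<close> of an integrand is merely Lebesgue measurable.\<close>

lemma borel_pair_imp_measurable_siegel:
  assumes "g \<in> measurable (borel \<Otimes>\<^sub>M borel) N"
  shows "g \<in> measurable (lebesgue_on siegel \<Otimes>\<^sub>M lebesgue_on siegel) N"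
proof -
  have [measurable]: "(\<lambda>x. x) \<in> measurable (lebesgue_on siegel) borel"
    by (rule borel_imp_measurable_siegel) simp
  have "(\<lambda>x. (fst x, snd x)) \<in> measurable (lebesgue_on siegel \<Otimes>\<^sub>M lebesgue_on siegel) (borel \<Otimes>\<^sub>M borel)"
    by (intro measurable_Pair) (auto intro: measurable_compose[OF measurable_fst] measurable_compose[OF measurable_snd])
  from measurable_compose[OF this assms] show ?thesis
    by simp
qed

text \<open>For p = \<infinity>: on a null space \<open>esssup\<close> would drop below 0, and a
  property holding almost everywhere would not yield a point at which it holds.\<close>

lemma emeasure_siegel_pos: "emeasure (lebesgue_on (siegel :: 'n::{finite,linorder} cvec set)) (space (lebesgue_on siegel)) \<noteq> 0"
proof
  assume 0: "emeasure (lebesgue_on (siegel :: 'n cvec set)) (space (lebesgue_on siegel)) = 0"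
  obtain c0 where c0: "c0 > 0" "\<And>R. R > 0 \<Longrightarrow> ennreal (c0 * R powr (0 + real CARD('n) + 1))
    \<le> (\<integral>\<^sup>+w. ennreal (rho_diag w powr 0) * indicator (apex_box (1/2) R :: 'n cvec set) w \<partial>lebesgue_on siegel)"
    using apex_box_weight_lower[where 'n='n, of "1/2" 0] by auto
  have "(\<integral>\<^sup>+w. u w \<partial>lebesgue_on (siegel :: 'n cvec set)) = 0" for u
  proof -
    have "(\<integral>\<^sup>+w. u w \<partial>lebesgue_on (siegel :: 'n cvec set)) = (\<integral>\<^sup>+w. u w * indicator siegel w \<partial>lebesgue_on siegel)"
      by (rule nn_integral_cong) simp
    then show ?thesis
      using nn_integral_null_set[of siegel "lebesgue_on (siegel :: 'n cvec set)" u] 0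
      by (simp add: null_sets_def sets_restrict_space_iff)
  qed
  then show False
    using c0(2)[of 1] c0(1) by simp
qed

section \<open>Sufficiency: the Schur test\<close>

text \<open>The p-th power of the norm, taken in \<open>ennreal\<close>: estimates can be stated
  before finiteness is known, and no root appears.\<close>

definition weighted_pnorm :: "real \<Rightarrow> real \<Rightarrow> ('n::{finite,linorder} cvec \<Rightarrow> complex) \<Rightarrow> ennreal" where
  "weighted_pnorm p \<alpha> f = (\<integral>\<^sup>+z. ennreal (cmod (f z) powr p * rho_diag z powr \<alpha>) \<partial>lebesgue_on siegel)"

lemma measurable_rho_diag_siegel [measurable]: "rho_diag \<in> borel_measurable (lebesgue_on siegel)"
  by (rule borel_imp_measurable_siegel) simp

lemma nn_integral_weighted_measure:
  assumes [measurable]: "f \<in> borel_measurable (lebesgue_on siegel)"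
  shows "(\<integral>\<^sup>+z. ennreal (cmod (f z) powr p) \<partial>weighted_measure \<alpha>) = weighted_pnorm p \<alpha> f"
  unfolding weighted_measure_def weighted_pnorm_def
  by (subst nn_integral_density) (auto simp: ennreal_mult[symmetric] mult.commute intro!: nn_integral_cong)

lemma Lp_space_ereal_iff:
  "f \<in> Lp_space (ereal p) \<alpha> \<longleftrightarrow> f \<in> borel_measurable (lebesgue_on siegel) \<and> weighted_pnorm p \<alpha> f < \<infinity>"
  by (auto simp: Lp_space_def nn_integral_weighted_measure)

lemma Lp_norm_ereal:
  assumes [measurable]: "f \<in> borel_measurable (lebesgue_on siegel)"
  shows "Lp_norm (ereal p) \<alpha> f = enn2real (weighted_pnorm p \<alpha> f) powr (1 / p)"
proof -
  have "(LINT z|weighted_measure \<alpha>. cmod (f z) powr p) = enn2real (\<integral>\<^sup>+z. ennreal (cmod (f z) powr p) \<partial>weighted_measure \<alpha>)"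
    by (rule integral_eq_nn_integral) (auto simp: weighted_measure_def)
  then show ?thesis
    by (simp add: Lp_norm_def nn_integral_weighted_measure)
qed

lemma esssup_norm_nonneg:
  assumes [measurable]: "f \<in> borel_measurable (lebesgue_on siegel)"
  shows "0 \<le> esssup (lebesgue_on (siegel :: 'n::{finite,linorder} cvec set)) (\<lambda>z. ereal (cmod (f z)))"
proof -
  have "(0::ereal) = esssup (lebesgue_on (siegel :: 'n cvec set)) (\<lambda>z. 0)"
    using emeasure_siegel_pos by (rule esssup_const[symmetric])
  also have "\<dots> \<le> esssup (lebesgue_on siegel) (\<lambda>z. ereal (cmod (f z)))"
    by (rule esssup_mono) auto
  finally show ?thesis .
qed

lemma Lp_space_infinity_AE:
  assumes "f \<in> Lp_space \<infinity> \<alpha>"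
  shows "0 \<le> Lp_norm \<infinity> \<alpha> f" "AE z in lebesgue_on siegel. cmod (f z) \<le> Lp_norm \<infinity> \<alpha> f"
proof -
  have f [measurable]: "f \<in> borel_measurable (lebesgue_on siegel)"
    and "esssup (lebesgue_on siegel) (\<lambda>z. ereal (cmod (f z))) < \<infinity>"
    using assms by (auto simp: Lp_space_def)
  then obtain r where r: "r \<ge> 0" "esssup (lebesgue_on siegel) (\<lambda>z. ereal (cmod (f z))) = ereal r"
    using esssup_norm_nonneg[OF f] by (cases "esssup (lebesgue_on siegel) (\<lambda>z. ereal (cmod (f z)))") auto
  then show "0 \<le> Lp_norm \<infinity> \<alpha> f"
    by (simp add: Lp_norm_def)
  show "AE z in lebesgue_on siegel. cmod (f z) \<le> Lp_norm \<infinity> \<alpha> f"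
    using esssup_AE[of "\<lambda>z. ereal (cmod (f z))" "lebesgue_on siegel"] r by (simp add: Lp_norm_def)
qed

lemma Lp_space_infinity_I:
  assumes f [measurable]: "f \<in> borel_measurable (lebesgue_on siegel)"
    and K: "AE z in lebesgue_on siegel. cmod (f z) \<le> K"
  shows "f \<in> Lp_space \<infinity> \<alpha>" "Lp_norm \<infinity> \<alpha> f \<le> K"
proof -
  have le: "esssup (lebesgue_on siegel) (\<lambda>z. ereal (cmod (f z))) \<le> ereal K"
    using K by (intro esssup_I) auto
  then show "f \<in> Lp_space \<infinity> \<alpha>"
    by (auto simp: Lp_space_def intro: le_less_trans)
  show "Lp_norm \<infinity> \<alpha> f \<le> K"
    using le esssup_norm_nonneg[OF f]
    by (cases "esssup (lebesgue_on siegel) (\<lambda>z. ereal (cmod (f z)))") (auto simp: Lp_norm_def)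
qed

lemma integral_op_boundedD_ereal:
  assumes "integral_op_bounded (ereal p) \<alpha> a k" and p: "p \<ge> 1"
  obtains C where "C \<ge> 0"
    "\<And>f. f \<in> Lp_space (ereal p) \<alpha> \<Longrightarrow> weighted_pnorm p \<alpha> (integral_op a k f) \<le> ennreal C * weighted_pnorm p \<alpha> f"
proof -
  obtain C where C: "\<And>f. f \<in> Lp_space (ereal p) \<alpha> \<Longrightarrow>
      Lp_norm (ereal p) \<alpha> (integral_op a k f) \<le> C * Lp_norm (ereal p) \<alpha> f"
    and L: "\<And>f. f \<in> Lp_space (ereal p) \<alpha> \<Longrightarrow> integral_op a k f \<in> Lp_space (ereal p) \<alpha>"
    using assms(1) unfolding integral_op_bounded_def by blast
  \<comment> \<open>The constant in \<open>integral_op_bounded\<close> may be negative, whereas the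
    constant for p-th powers is a power of it.\<close>
  define D where "D = max C 0"
  have "weighted_pnorm p \<alpha> (integral_op a k f) \<le> ennreal (D powr p) * weighted_pnorm p \<alpha> f"
    if f: "f \<in> Lp_space (ereal p) \<alpha>" for f
  proof -
    obtain x where x: "x \<ge> 0" "weighted_pnorm p \<alpha> f = ennreal x"
      using f by (cases "weighted_pnorm p \<alpha> f") (auto simp: Lp_space_ereal_iff)
    obtain y where y: "y \<ge> 0" "weighted_pnorm p \<alpha> (integral_op a k f) = ennreal y"
      using L[OF f] by (cases "weighted_pnorm p \<alpha> (integral_op a k f)") (auto simp: Lp_space_ereal_iff)
    have "y powr (1 / p) \<le> C * x powr (1 / p)"
      using C[OF f] L[OF f] f x y by (simp add: Lp_norm_ereal Lp_space_ereal_iff)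
    also have "\<dots> \<le> D * x powr (1 / p)"
      by (intro mult_right_mono) (auto simp: D_def)
    finally have "(y powr (1 / p)) powr p \<le> (D * x powr (1 / p)) powr p"
      using p by (intro powr_mono2) auto
    then have "y \<le> D powr p * x"
      using x y p by (simp add: powr_powr powr_mult D_def)
    then show ?thesis
      using x y by (simp add: ennreal_mult[symmetric] ennreal_leI)
  qed
  then show thesis
    using that[of "D powr p"] by simp
qed

lemma integral_op_boundedI_ereal:
  assumes p: "p \<ge> 1" and C: "C \<ge> 0"
    and int: "\<And>f. f \<in> Lp_space (ereal p) \<alpha> \<Longrightarrow> AE z in lebesgue_on siegel. integrable (lebesgue_on siegel) (k f z)"
    and meas: "\<And>f. f \<in> Lp_space (ereal p) \<alpha> \<Longrightarrow> integral_op a k f \<in> borel_measurable (lebesgue_on siegel)"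
    and bd: "\<And>f. f \<in> Lp_space (ereal p) \<alpha> \<Longrightarrow> weighted_pnorm p \<alpha> (integral_op a k f) \<le> ennreal C * weighted_pnorm p \<alpha> f"
  shows "integral_op_bounded (ereal p) \<alpha> a k"
proof -
  have fin: "weighted_pnorm p \<alpha> (integral_op a k f) < \<infinity>" if "f \<in> Lp_space (ereal p) \<alpha>" for f
    using bd[OF that] that by (auto simp: Lp_space_ereal_iff ennreal_mult_less_top intro: le_less_trans)
  have "Lp_norm (ereal p) \<alpha> (integral_op a k f) \<le> C powr (1 / p) * Lp_norm (ereal p) \<alpha> f"
    if f: "f \<in> Lp_space (ereal p) \<alpha>" for f
  proof -
    obtain x where x: "x \<ge> 0" "weighted_pnorm p \<alpha> f = ennreal x"
      using f by (cases "weighted_pnorm p \<alpha> f") (auto simp: Lp_space_ereal_iff)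
    obtain y where y: "y \<ge> 0" "weighted_pnorm p \<alpha> (integral_op a k f) = ennreal y"
      using fin[OF f] by (cases "weighted_pnorm p \<alpha> (integral_op a k f)") auto
    have "y \<le> C * x"
      using bd[OF f] x y C by (simp add: ennreal_mult[symmetric])
    then have "y powr (1 / p) \<le> (C * x) powr (1 / p)"
      using p y by (intro powr_mono2) auto
    then show ?thesis
      using x y C f meas[OF f] by (simp add: Lp_norm_ereal Lp_space_ereal_iff powr_mult)
  qed
  moreover have "integral_op a k f \<in> Lp_space (ereal p) \<alpha>" if "f \<in> Lp_space (ereal p) \<alpha>" for f
    using meas[OF that] fin[OF that] by (simp add: Lp_space_ereal_iff)
  ultimately show ?thesis
    unfolding integral_op_bounded_def using int by blast
qed

text \<open>
  \<open>k\<close> is one of the two functions \<open>\<zeta> \<mapsto> \<zeta> powr - c\<close> and \<open>\<zeta> \<mapsto> cmod \<zeta> powr - c\<close> of \<open>rho z w\<close>; the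
  last assumption is all that is needed to exclude cancellation in the test functions.
\<close>

locale siegel_kernel =
  fixes k :: "complex \<Rightarrow> complex" and c \<eta> :: real
  assumes k_measurable [measurable]: "k \<in> borel_measurable borel"
    and norm_k: "\<And>\<zeta>. Re \<zeta> > 0 \<Longrightarrow> cmod (k \<zeta>) = cmod \<zeta> powr - c"
    and \<eta>_pos: "\<eta> > 0"
    and k_ratio: "\<And>\<zeta> \<zeta>0. Re \<zeta> > 0 \<Longrightarrow> Re \<zeta>0 > 0 \<Longrightarrow> cmod (\<zeta> - \<zeta>0) \<le> \<eta> * cmod \<zeta>0 \<Longrightarrow> Re (k \<zeta> / k \<zeta>0) \<ge> 1 / 2"
begin

definition kernel_integrand :: "real \<Rightarrow> ('n::{finite,linorder} cvec \<Rightarrow> complex) \<Rightarrow> 'n cvec \<Rightarrow> 'n cvec \<Rightarrow> complex" where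
  "kernel_integrand b f z w = of_real (rho_diag w powr b) * k (rho z w) * f w"

lemma norm_kernel_integrand:
  assumes "z \<in> siegel" "w \<in> siegel"
  shows "cmod (kernel_integrand b f z w) = rho_diag w powr b * cmod (rho z w) powr - c * cmod (f w)"
  using assms by (simp add: kernel_integrand_def norm_mult norm_k Re_rho_pos)

lemma measurable_kernel_integrand_pair:
  fixes f :: "'n::{finite,linorder} cvec \<Rightarrow> complex"
  assumes [measurable]: "f \<in> borel_measurable (lebesgue_on siegel)"
  shows "case_prod (kernel_integrand b f) \<in> borel_measurable (lebesgue_on siegel \<Otimes>\<^sub>M lebesgue_on siegel)"
proof -
  have [measurable]: "(\<lambda>(z, w). of_real (rho_diag w powr b) * k (rho z w))
    \<in> borel_measurable (lebesgue_on siegel \<Otimes>\<^sub>M lebesgue_on (siegel :: 'n cvec set))"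
    by (rule borel_pair_imp_measurable_siegel) measurable
  have "(\<lambda>x. (case x of (z, w) \<Rightarrow> of_real (rho_diag w powr b) * k (rho z w)) * f (snd x))
    \<in> borel_measurable (lebesgue_on siegel \<Otimes>\<^sub>M lebesgue_on siegel)"
    by measurable
  then show ?thesis
    by (simp add: kernel_integrand_def case_prod_beta')
qed

lemma measurable_kernel_integrand:
  fixes f :: "'n::{finite,linorder} cvec \<Rightarrow> complex"
  assumes [measurable]: "f \<in> borel_measurable (lebesgue_on siegel)"
  shows "kernel_integrand b f z \<in> borel_measurable (lebesgue_on siegel)"
proof -
  have [measurable]: "(\<lambda>w. of_real (rho_diag w powr b) * k (rho z w)) \<in> borel_measurable (lebesgue_on siegel)"
    by (rule borel_imp_measurable_siegel) measurable
  show ?thesis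
    unfolding kernel_integrand_def by measurable
qed

lemma measurable_kernel_op:
  fixes f :: "'n::{finite,linorder} cvec \<Rightarrow> complex"
  assumes f: "f \<in> borel_measurable (lebesgue_on siegel)"
  shows "integral_op a (kernel_integrand b) f \<in> borel_measurable (lebesgue_on siegel)"
proof -
  interpret sigma_finite_measure "lebesgue_on (siegel :: 'n cvec set)"
    by (rule sigma_finite_siegel)
  have [measurable]: "(\<lambda>z. LINT w|lebesgue_on siegel. kernel_integrand b f z w) \<in> borel_measurable (lebesgue_on siegel)"
    by (rule borel_measurable_lebesgue_integral) (rule measurable_kernel_integrand_pair[OF f])
  show ?thesis
    unfolding integral_op_def by measurable
qed

lemma kernel_op_le:
  assumes f: "f \<in> borel_measurable (lebesgue_on siegel)" and z: "z \<in> siegel"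
    and x: "x \<ge> 0" "(\<integral>\<^sup>+w. ennreal (rho_diag w powr b * cmod (rho z w) powr - c * cmod (f w)) \<partial>lebesgue_on siegel) \<le> ennreal x"
  shows "integrable (lebesgue_on siegel) (kernel_integrand b f z)"
    and "cmod (integral_op a (kernel_integrand b) f z) \<le> rho_diag z powr a * x"
proof -
  have eq: "(\<integral>\<^sup>+w. ennreal (cmod (kernel_integrand b f z w)) \<partial>lebesgue_on siegel)
     = (\<integral>\<^sup>+w. ennreal (rho_diag w powr b * cmod (rho z w) powr - c * cmod (f w)) \<partial>lebesgue_on siegel)"
    by (rule nn_integral_cong) (use z in \<open>simp add: norm_kernel_integrand\<close>)
  show int: "integrable (lebesgue_on siegel) (kernel_integrand b f z)"
    using x measurable_kernel_integrand[OF f] by (intro integrableI_bounded) (auto simp: eq intro: le_less_trans)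
  have "ennreal (cmod (LINT w|lebesgue_on siegel. kernel_integrand b f z w)) \<le> ennreal x"
    using integral_norm_bound_ennreal[OF int] x(2) unfolding eq by (rule order_trans)
  then show "cmod (integral_op a (kernel_integrand b) f z) \<le> rho_diag z powr a * x"
    using x(1) by (simp add: integral_op_def norm_mult mult_left_mono)
qed

end

text \<open>An additive form of Hoelder's inequality that includes p = 1. For \<open>B > 0\<close>
  the two terms balance at \<open>m = (B / A) powr (1 / p)\<close>, whence the factor
  \<open>2 powr p\<close>; for \<open>B = 0\<close> letting \<open>m\<close> shrink gives
  \<open>x = 0\<close>.\<close>

lemma powr_le_of_weighted_sum:
  fixes x A B p :: real
  assumes "x \<ge> 0" "A > 0" "B \<ge> 0" "p \<ge> 1"
    and le: "\<And>m. m > 0 \<Longrightarrow> x \<le> m * A + m powr (1 - p) * B"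
  shows "x powr p \<le> 2 powr p * A powr (p - 1) * B"
proof (cases "B = 0")
  case True
  have "x = 0"
  proof (rule ccontr)
    assume "x \<noteq> 0"
    then have "x > 0" using assms by simp
    then show False
      using le[of "x / (2 * A)"] True assms by simp
  qed
  then show ?thesis using True by simp
next
  case False
  then have B: "B > 0" using assms by simp
  define m where "m = (B / A) powr (1 / p)"
  have m: "m > 0" using B assms by (simp add: m_def)
  have mp: "m powr p = B / A"
    using B assms by (simp add: m_def powr_powr)
  have "m powr (1 - p) * B = m * A"
    using m B assms(2) by (simp add: powr_diff mp)
  then have "x \<le> 2 * m * A"
    using le[OF m] by (simp add: mult_ac)
  then have "x powr p \<le> (2 * m * A) powr p"
    using assms by (intro powr_mono2) auto
  also have "\<dots> = 2 powr p * (B / A) * A powr p"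
    using m assms by (simp add: powr_mult mp)
  also have "\<dots> = 2 powr p * A powr (p - 1) * B"
    using assms by (simp add: powr_diff)
  finally show ?thesis .
qed

text \<open>The four inequalities are what \<open>kernel_integral_upper\<close> asks of the two
  integrals in Schur's test. For \<open>p > 1\<close> they say that \<mu> lies in two open
  intervals. Of the comparisons of endpoints, two are the hypotheses up to a positive factor, and
  the other two amount to \<open>a + b + 1 > 0\<close>, which follows by adding them. For
  \<open>p = 1\<close> the last two inequalities lose \<mu> and are the hypotheses.\<close>

lemma schur_exponent_exists:
  fixes a b \<alpha> p :: real
  assumes p: "p \<ge> 1" and "- p * a < \<alpha> + 1" "\<alpha> + 1 < p * (b + 1)"
  obtains \<mu> where "- (b + 1) < \<mu>" "\<mu> < a" "- (a + \<alpha> + 1) < \<mu> * (p - 1)" "\<mu> * (p - 1) < b - \<alpha>"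
proof (cases "p = 1")
  case True
  then have "- (b + 1) < a" using assms by simp
  then obtain \<mu> where "- (b + 1) < \<mu>" "\<mu> < a" using dense by blast
  then show thesis using that True assms by auto
next
  case False
  then have q: "p - 1 > 0" using p by simp
  have 0: "0 < p * (a + b + 1)"
    using assms by (simp add: algebra_simps)
  then have "0 < a + b + 1"
    using p by (simp add: zero_less_mult_iff)
  then have "0 < (a + b + 1) * (p - 1)"
    using q by simp
  then have "max (- (b + 1)) (- (a + \<alpha> + 1) / (p - 1)) < min a ((b - \<alpha>) / (p - 1))"
    using q assms \<open>0 < a + b + 1\<close> by (simp add: field_simps)
  then obtain \<mu> where "max (- (b + 1)) (- (a + \<alpha> + 1) / (p - 1)) < \<mu>" "\<mu> < min a ((b - \<alpha>) / (p - 1))"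
    using dense by blast
  then show thesis
    using that[of \<mu>] q by (simp add: pos_divide_less_eq pos_less_divide_eq)
qed

context siegel_kernel
begin

text \<open>Schur test with the weight \<open>rho_diag w powr \<mu>\<close>.\<close>

lemma kernel_bounded_finite:
  fixes a b \<alpha> p :: real
  assumes p: "p \<ge> 1" and adm: "- p * a < \<alpha> + 1" "\<alpha> + 1 < p * (b + 1)"
    and c: "c = real CARD('n) + 1 + a + b"
  shows "integral_op_bounded (ereal p) \<alpha> a
    (kernel_integrand b :: ('n::{finite,linorder} cvec \<Rightarrow> complex) \<Rightarrow> 'n cvec \<Rightarrow> 'n cvec \<Rightarrow> complex)"
proof -
  let ?M = "lebesgue_on (siegel :: 'n cvec set)"
  obtain \<mu> where \<mu>: "- (b + 1) < \<mu>" "\<mu> < a" "- (a + \<alpha> + 1) < \<mu> * (p - 1)" "\<mu> * (p - 1) < b - \<alpha>"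
    using schur_exponent_exists[OF p adm] by blast
  \<comment> \<open>The power of the weight that Hoelder's inequality leaves beside
    \<open>cmod (f w) powr p\<close>.\<close>
  define \<nu> where "\<nu> = \<mu> * (p - 1)"
  obtain C1 where C1: "C1 > 0" "\<And>z :: 'n cvec. z \<in> siegel \<Longrightarrow>
    (\<integral>\<^sup>+w. ennreal (rho_diag w powr (b + \<mu>) * cmod (rho z w) powr - c) \<partial>?M) \<le> ennreal (C1 * rho_diag z powr (\<mu> - a))"
    using kernel_integral_upper[where 'n='n, of "b + \<mu>" c] \<mu> c by (auto simp: algebra_simps)
  obtain C2 where C2: "C2 > 0" "\<And>w :: 'n cvec. w \<in> siegel \<Longrightarrow>
    (\<integral>\<^sup>+z. ennreal (rho_diag z powr (a + \<alpha> + \<nu>) * cmod (rho z w) powr - c) \<partial>?M) \<le> ennreal (C2 * rho_diag w powr (\<alpha> + \<nu> - b))"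
  proof -
    obtain C2 where "C2 > 0" "\<And>w :: 'n cvec. w \<in> siegel \<Longrightarrow>
      (\<integral>\<^sup>+z. ennreal (rho_diag z powr (a + \<alpha> + \<nu>) * cmod (rho w z) powr - c) \<partial>?M)
      \<le> ennreal (C2 * rho_diag w powr (real CARD('n) + 1 + (a + \<alpha> + \<nu>) - c))"
      using kernel_integral_upper[where 'n='n, of "a + \<alpha> + \<nu>" c] \<mu> c by (auto simp: \<nu>_def)
    moreover have "real CARD('n) + 1 + (a + \<alpha> + \<nu>) - c = \<alpha> + \<nu> - b"
      using c by simp
    ultimately show thesis
      using that by (simp add: norm_rho_commute)
  qed
  define D where "D = 2 powr p * C1 powr (p - 1) * C2"
  have main: "(AE z in ?M. integrable ?M (kernel_integrand b f z)) \<and>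
      weighted_pnorm p \<alpha> (integral_op a (kernel_integrand b) f) \<le> ennreal D * weighted_pnorm p \<alpha> f"
    if f: "f \<in> Lp_space (ereal p) \<alpha>" for f :: "'n cvec \<Rightarrow> complex"
  proof -
    have fm [measurable]: "f \<in> borel_measurable ?M" and ffin: "weighted_pnorm p \<alpha> f < \<infinity>"
      using f by (auto simp: Lp_space_ereal_iff)
    interpret sigma_finite_measure ?M by (rule sigma_finite_siegel)
    interpret pair_sigma_finite ?M ?M ..
    define B where "B z = (\<integral>\<^sup>+w. ennreal (rho_diag w powr (b - \<nu>) * cmod (rho z w) powr - c * cmod (f w) powr p) \<partial>?M)" for z
    have pm [measurable]: "(\<lambda>(z, w). rho_diag z powr s * (rho_diag w powr t * cmod (rho z w) powr - c))
        \<in> borel_measurable (?M \<Otimes>\<^sub>M ?M)" for s t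
      by (rule borel_pair_imp_measurable_siegel) measurable
    have pm': "(\<lambda>(z, w). ennreal (rho_diag z powr s * (rho_diag w powr t * cmod (rho z w) powr - c * cmod (f w) powr p)))
        \<in> borel_measurable (?M \<Otimes>\<^sub>M ?M)" for s t
    proof -
      have "(\<lambda>x. ennreal ((case x of (z, w) \<Rightarrow> rho_diag z powr s * (rho_diag w powr t * cmod (rho z w) powr - c)) * cmod (f (snd x)) powr p))
        \<in> borel_measurable (?M \<Otimes>\<^sub>M ?M)"
        by measurable
      then show ?thesis
        by (simp add: case_prod_beta' mult.assoc)
    qed
    have m1 [measurable]: "(\<lambda>w. rho_diag w powr t * cmod (rho z w) powr - c) \<in> borel_measurable ?M" for t and z :: "'n cvec"
      by (rule borel_imp_measurable_siegel) measurable
    have m2 [measurable]: "(\<lambda>z. rho_diag z powr t * cmod (rho z w) powr - c) \<in> borel_measurable ?M" for t and w :: "'n cvec"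
      by (rule borel_imp_measurable_siegel) measurable
    have Bm: "(\<lambda>z. ennreal (rho_diag z powr (a + \<alpha> + \<nu>)) * B z) = (\<lambda>z. \<integral>\<^sup>+w. ennreal (rho_diag z powr (a + \<alpha> + \<nu>)
          * (rho_diag w powr (b - \<nu>) * cmod (rho z w) powr - c * cmod (f w) powr p)) \<partial>?M)"
    proof
      fix z
      have "ennreal (rho_diag z powr (a + \<alpha> + \<nu>)) * B z = (\<integral>\<^sup>+w. ennreal (rho_diag z powr (a + \<alpha> + \<nu>))
          * ennreal (rho_diag w powr (b - \<nu>) * cmod (rho z w) powr - c * cmod (f w) powr p) \<partial>?M)"
        unfolding B_def by (rule nn_integral_cmult[symmetric]) measurable
      then show "ennreal (rho_diag z powr (a + \<alpha> + \<nu>)) * B z = (\<integral>\<^sup>+w. ennreal (rho_diag z powr (a + \<alpha> + \<nu>)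
          * (rho_diag w powr (b - \<nu>) * cmod (rho z w) powr - c * cmod (f w) powr p)) \<partial>?M)"
        by (simp only: ennreal_mult[symmetric] mult_nonneg_nonneg powr_ge_zero)
    qed
    have Bmeas: "(\<lambda>z. ennreal (rho_diag z powr (a + \<alpha> + \<nu>)) * B z) \<in> borel_measurable ?M"
      unfolding Bm by (rule sigma_finite_measure.borel_measurable_nn_integral[OF sigma_finite_siegel pm'])
    have Bint: "(\<integral>\<^sup>+z. ennreal (rho_diag z powr (a + \<alpha> + \<nu>)) * B z \<partial>?M) \<le> ennreal C2 * weighted_pnorm p \<alpha> f"
    proof -
      have "(\<integral>\<^sup>+z. ennreal (rho_diag z powr (a + \<alpha> + \<nu>)) * B z \<partial>?M)
        = (\<integral>\<^sup>+w. \<integral>\<^sup>+z. ennreal (rho_diag z powr (a + \<alpha> + \<nu>)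
            * (rho_diag w powr (b - \<nu>) * cmod (rho z w) powr - c * cmod (f w) powr p)) \<partial>?M \<partial>?M)"
        unfolding Bm by (rule Fubini'[symmetric]) (rule pm')
      also have "\<dots> \<le> (\<integral>\<^sup>+w. ennreal C2 * ennreal (cmod (f w) powr p * rho_diag w powr \<alpha>) \<partial>?M)"
      proof (rule nn_integral_mono)
        fix w assume "w \<in> space ?M"
        then have w: "w \<in> siegel" by simp
        have "(\<integral>\<^sup>+z. ennreal (rho_diag z powr (a + \<alpha> + \<nu>) * (rho_diag w powr (b - \<nu>) * cmod (rho z w) powr - c * cmod (f w) powr p)) \<partial>?M)
          = (\<integral>\<^sup>+z. ennreal (rho_diag w powr (b - \<nu>) * cmod (f w) powr p) * ennreal (rho_diag z powr (a + \<alpha> + \<nu>) * cmod (rho z w) powr - c) \<partial>?M)"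
          by (intro nn_integral_cong) (simp add: ennreal_mult[symmetric] mult_ac)
        also have "\<dots> \<le> ennreal (rho_diag w powr (b - \<nu>) * cmod (f w) powr p) * ennreal (C2 * rho_diag w powr (\<alpha> + \<nu> - b))"
          using C2(2)[OF w] by (subst nn_integral_cmult) (auto intro!: mult_left_mono)
        also have "\<dots> = ennreal (C2 * (cmod (f w) powr p * (rho_diag w powr (b - \<nu>) * rho_diag w powr (\<alpha> + \<nu> - b))))"
          using C2(1) by (simp add: ennreal_mult[symmetric] mult_ac)
        also have "rho_diag w powr (b - \<nu>) * rho_diag w powr (\<alpha> + \<nu> - b) = rho_diag w powr \<alpha>"
          by (simp add: powr_add[symmetric])
        finally show "(\<integral>\<^sup>+z. ennreal (rho_diag z powr (a + \<alpha> + \<nu>) * (rho_diag w powr (b - \<nu>) * cmod (rho z w) powr - c * cmod (f w) powr p)) \<partial>?M)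
          \<le> ennreal C2 * ennreal (cmod (f w) powr p * rho_diag w powr \<alpha>)"
          using C2(1) by (simp add: ennreal_mult[symmetric])
      qed
      also have "\<dots> = ennreal C2 * weighted_pnorm p \<alpha> f"
        unfolding weighted_pnorm_def by (rule nn_integral_cmult) measurable
      finally show ?thesis .
    qed
    also have "\<dots> < \<infinity>"
      using ffin by (simp add: ennreal_mult_less_top)
    \<comment> \<open>A finite integral over \<open>z\<close> makes \<open>B z\<close> finite almost
      everywhere; this yields the almost everywhere convergence of the defining integral.\<close>
    finally have "AE z in ?M. ennreal (rho_diag z powr (a + \<alpha> + \<nu>)) * B z \<noteq> \<infinity>"
      by (intro nn_integral_noteq_infinite Bmeas) simp
    then have AEB: "AE z in ?M. z \<in> siegel \<and> B z < \<infinity>"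
    proof (rule AE_mp, intro AE_I2 impI)
      fix z assume "z \<in> space ?M" and fin: "ennreal (rho_diag z powr (a + \<alpha> + \<nu>)) * B z \<noteq> \<infinity>"
      then have z: "z \<in> siegel" by simp
      then have "rho_diag z powr (a + \<alpha> + \<nu>) > 0" using rho_diag_pos[OF z] by simp
      then show "z \<in> siegel \<and> B z < \<infinity>"
        using z fin by (auto simp: ennreal_mult_eq_top_iff less_top)
    qed
    have I: "(\<integral>\<^sup>+w. ennreal (rho_diag w powr b * cmod (rho z w) powr - c * cmod (f w)) \<partial>?M)
        \<le> ennreal (m * (C1 * rho_diag z powr (\<mu> - a))) + ennreal (m powr (1 - p)) * B z"
      if z: "z \<in> siegel" and m: "m > 0" for z and m :: real
    proof -
      have "(\<integral>\<^sup>+w. ennreal (rho_diag w powr b * cmod (rho z w) powr - c * cmod (f w)) \<partial>?M)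
        \<le> (\<integral>\<^sup>+w. ennreal m * ennreal (rho_diag w powr (b + \<mu>) * cmod (rho z w) powr - c)
              + ennreal (m powr (1 - p)) * ennreal (rho_diag w powr (b - \<nu>) * cmod (rho z w) powr - c * cmod (f w) powr p) \<partial>?M)"
      proof (rule nn_integral_mono)
        fix w assume "w \<in> space ?M"
        then have w: "rho_diag w > 0" by (simp add: siegel_iff)
        \<comment> \<open>\<open>f\<close> measured against the weight. A substitute for Young's
          inequality follows: either \<open>x \<le> m\<close>, or
          \<open>x powr (1 - p) \<le> m powr (1 - p)\<close> and \<open>x\<close> is the product of
          this power with \<open>x powr p\<close>.\<close>
        define x where "x = cmod (f w) * rho_diag w powr - \<mu>"
        have x: "x \<ge> 0" by (simp add: x_def)
        have xle: "x \<le> m + m powr (1 - p) * x powr p"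
        proof (cases "x \<le> m")
          case True
          then show ?thesis by (simp add: add_increasing2)
        next
          case False
          then have "x powr (1 - p) \<le> m powr (1 - p)"
            using m p by (intro powr_mono2') auto
          then have "x powr (1 - p) * x powr p \<le> m powr (1 - p) * x powr p"
            by (intro mult_right_mono) auto
          moreover have "x powr (1 - p) * x powr p = x"
            using False m by (simp add: powr_add[symmetric])
          ultimately show ?thesis using m by simp
        qed
        have 1: "rho_diag w powr b * cmod (rho z w) powr - c * cmod (f w)
            = rho_diag w powr (b + \<mu>) * cmod (rho z w) powr - c * x"
          using w by (simp add: x_def powr_add powr_minus)
        have "rho_diag w powr (b + \<mu>) * x powr p = rho_diag w powr (b - \<nu>) * cmod (f w) powr p"
        proof -
          have "x powr p = cmod (f w) powr p * rho_diag w powr (- \<mu> * p)"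
            by (simp add: x_def powr_mult powr_powr)
          moreover have "rho_diag w powr (b - \<nu>) = rho_diag w powr (b + \<mu>) * rho_diag w powr (- \<mu> * p)"
            by (simp add: powr_add[symmetric] \<nu>_def algebra_simps)
          ultimately show ?thesis by simp
        qed
        then have 2: "rho_diag w powr (b + \<mu>) * cmod (rho z w) powr - c * (m + m powr (1 - p) * x powr p)
           = m * (rho_diag w powr (b + \<mu>) * cmod (rho z w) powr - c)
             + m powr (1 - p) * (rho_diag w powr (b - \<nu>) * cmod (rho z w) powr - c * cmod (f w) powr p)"
          by (simp add: algebra_simps)
        have "rho_diag w powr (b + \<mu>) * cmod (rho z w) powr - c * x
          \<le> rho_diag w powr (b + \<mu>) * cmod (rho z w) powr - c * (m + m powr (1 - p) * x powr p)"
          by (intro mult_left_mono xle) simp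
        then show "ennreal (rho_diag w powr b * cmod (rho z w) powr - c * cmod (f w))
          \<le> ennreal m * ennreal (rho_diag w powr (b + \<mu>) * cmod (rho z w) powr - c)
              + ennreal (m powr (1 - p)) * ennreal (rho_diag w powr (b - \<nu>) * cmod (rho z w) powr - c * cmod (f w) powr p)"
          unfolding 1 2 using m by (simp add: ennreal_mult[symmetric] ennreal_plus[symmetric] ennreal_leI del: ennreal_plus)
      qed
      also have "\<dots> = ennreal m * (\<integral>\<^sup>+w. ennreal (rho_diag w powr (b + \<mu>) * cmod (rho z w) powr - c) \<partial>?M)
          + ennreal (m powr (1 - p)) * B z"
        unfolding B_def by (subst nn_integral_add) (auto simp: nn_integral_cmult)
      also have "\<dots> \<le> ennreal m * ennreal (C1 * rho_diag z powr (\<mu> - a)) + ennreal (m powr (1 - p)) * B z"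
        by (intro add_right_mono mult_left_mono C1(2) z) simp
      finally show ?thesis
        using m C1(1) by (simp add: ennreal_mult[symmetric])
    qed
    have key: "integrable ?M (kernel_integrand b f z) \<and>
        ennreal (cmod (integral_op a (kernel_integrand b) f z) powr p * rho_diag z powr \<alpha>)
        \<le> ennreal (2 powr p * C1 powr (p - 1)) * (ennreal (rho_diag z powr (a + \<alpha> + \<nu>)) * B z)"
      if z: "z \<in> siegel" and Bz: "B z < \<infinity>" for z
    proof -
      have rz: "rho_diag z > 0" using z by (rule rho_diag_pos)
      obtain B' where B': "B' \<ge> 0" "B z = ennreal B'"
        using Bz by (cases "B z") auto
      define A where "A = C1 * rho_diag z powr (\<mu> - a)"
      have A: "A > 0" using C1(1) rz by (simp add: A_def)
      have I': "(\<integral>\<^sup>+w. ennreal (rho_diag w powr b * cmod (rho z w) powr - c * cmod (f w)) \<partial>?M)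
        \<le> ennreal (m * A + m powr (1 - p) * B')" if "m > 0" for m
        using I[OF z that] that A B' by (simp add: A_def ennreal_mult[symmetric] ennreal_plus[symmetric] del: ennreal_plus)
      have int: "integrable ?M (kernel_integrand b f z)"
        using kernel_op_le(1)[OF fm z _ I'[of 1]] A B' by simp
      define x where "x = cmod (LINT w|?M. kernel_integrand b f z w)"
      have "x \<le> m * A + m powr (1 - p) * B'" if "m > 0" for m
        using kernel_op_le(2)[OF fm z _ I'[OF that], of 0] that A B' rz by (simp add: x_def integral_op_def)
      then have xp: "x powr p \<le> 2 powr p * A powr (p - 1) * B'"
        using A B' p by (intro powr_le_of_weighted_sum) (auto simp: x_def)
      have "cmod (integral_op a (kernel_integrand b) f z) powr p * rho_diag z powr \<alpha>
        = x powr p * (rho_diag z powr (a * p) * rho_diag z powr \<alpha>)"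
        by (simp add: integral_op_def norm_mult x_def powr_mult powr_powr)
      also have "\<dots> \<le> 2 powr p * A powr (p - 1) * B' * (rho_diag z powr (a * p) * rho_diag z powr \<alpha>)"
        by (intro mult_right_mono xp) simp
      also have "A powr (p - 1) = C1 powr (p - 1) * rho_diag z powr ((\<mu> - a) * (p - 1))"
        using C1(1) by (simp add: A_def powr_mult powr_powr)
      also have "2 powr p * (C1 powr (p - 1) * rho_diag z powr ((\<mu> - a) * (p - 1))) * B' * (rho_diag z powr (a * p) * rho_diag z powr \<alpha>)
        = 2 powr p * C1 powr (p - 1) * (rho_diag z powr ((\<mu> - a) * (p - 1) + a * p + \<alpha>) * B')"
        by (simp add: powr_add)
      also have "(\<mu> - a) * (p - 1) + a * p + \<alpha> = a + \<alpha> + \<nu>"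
        by (simp add: \<nu>_def algebra_simps)
      finally show ?thesis
        using int B' by (simp add: ennreal_mult[symmetric] ennreal_leI)
    qed
    have "weighted_pnorm p \<alpha> (integral_op a (kernel_integrand b) f)
      \<le> (\<integral>\<^sup>+z. ennreal (2 powr p * C1 powr (p - 1)) * (ennreal (rho_diag z powr (a + \<alpha> + \<nu>)) * B z) \<partial>?M)"
      unfolding weighted_pnorm_def
      by (rule nn_integral_mono_AE, rule eventually_mono[OF AEB]) (use key in blast)
    also have "\<dots> = ennreal (2 powr p * C1 powr (p - 1)) * (\<integral>\<^sup>+z. ennreal (rho_diag z powr (a + \<alpha> + \<nu>)) * B z \<partial>?M)"
      by (rule nn_integral_cmult) (rule Bmeas)
    also have "\<dots> \<le> ennreal (2 powr p * C1 powr (p - 1)) * (ennreal C2 * weighted_pnorm p \<alpha> f)"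
      by (intro mult_left_mono Bint) simp
    also have "\<dots> = ennreal D * weighted_pnorm p \<alpha> f"
      using C2(1) by (simp add: D_def ennreal_mult mult.assoc)
    finally have "weighted_pnorm p \<alpha> (integral_op a (kernel_integrand b) f) \<le> ennreal D * weighted_pnorm p \<alpha> f" .
    moreover have "AE z in ?M. integrable ?M (kernel_integrand b f z)"
      by (rule eventually_mono[OF AEB]) (use key in blast)
    ultimately show ?thesis
      by blast
  qed
  show ?thesis
  proof (rule integral_op_boundedI_ereal[OF p])
    show "D \<ge> 0" using C2(1) by (simp add: D_def)
  qed (use main measurable_kernel_op in \<open>auto simp: Lp_space_ereal_iff\<close>)
qed

text \<open>Pulling out the essential bound of \<open>f\<close> leaves the kernel integral, which is
  of order \<open>rho_diag z powr - a\<close>; the prefactor of the operator cancels it. The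
  estimate holds at every point of the domain.\<close>

lemma kernel_bounded_infinity:
  assumes a: "a > 0" and b: "b > -1" and c: "c = real CARD('n) + 1 + a + b"
  shows "integral_op_bounded \<infinity> \<alpha> a
    (kernel_integrand b :: ('n::{finite,linorder} cvec \<Rightarrow> complex) \<Rightarrow> 'n cvec \<Rightarrow> 'n cvec \<Rightarrow> complex)"
proof -
  let ?M = "lebesgue_on (siegel :: 'n cvec set)"
  obtain C where C: "C > 0" "\<And>z :: 'n cvec. z \<in> siegel \<Longrightarrow>
    (\<integral>\<^sup>+w. ennreal (rho_diag w powr b * cmod (rho z w) powr - c) \<partial>?M) \<le> ennreal (C * rho_diag z powr (- a))"
    using kernel_integral_upper[where 'n='n, of b c] a b c by (auto simp: algebra_simps)
  have main: "integrable ?M (kernel_integrand b f z) \<and>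
      cmod (integral_op a (kernel_integrand b) f z) \<le> C * Lp_norm \<infinity> \<alpha> f"
    if f: "f \<in> Lp_space \<infinity> \<alpha>" and z: "z \<in> siegel" for f :: "'n cvec \<Rightarrow> complex" and z
  proof -
    have fm [measurable]: "f \<in> borel_measurable ?M"
      using f by (simp add: Lp_space_def)
    define K where "K = Lp_norm \<infinity> \<alpha> f"
    have K: "K \<ge> 0" "AE w in ?M. cmod (f w) \<le> K"
      using Lp_space_infinity_AE[OF f] by (auto simp: K_def)
    have m1 [measurable]: "(\<lambda>w. rho_diag w powr b * cmod (rho z w) powr - c) \<in> borel_measurable ?M"
      by (rule borel_imp_measurable_siegel) measurable
    have "(\<integral>\<^sup>+w. ennreal (rho_diag w powr b * cmod (rho z w) powr - c * cmod (f w)) \<partial>?M)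
      \<le> (\<integral>\<^sup>+w. ennreal K * ennreal (rho_diag w powr b * cmod (rho z w) powr - c) \<partial>?M)"
      using K(2) by (intro nn_integral_mono_AE)
        (auto elim!: eventually_mono simp: ennreal_mult[symmetric] K(1) mult.commute[of K] intro!: ennreal_leI mult_left_mono)
    also have "\<dots> \<le> ennreal K * ennreal (C * rho_diag z powr (- a))"
      using C(2)[OF z] by (subst nn_integral_cmult) (auto intro!: mult_left_mono)
    also have "\<dots> = ennreal (K * (C * rho_diag z powr (- a)))"
      using K C(1) by (simp add: ennreal_mult)
    finally have le: "(\<integral>\<^sup>+w. ennreal (rho_diag w powr b * cmod (rho z w) powr - c * cmod (f w)) \<partial>?M)
      \<le> ennreal (K * (C * rho_diag z powr (- a)))" .
    have nn: "0 \<le> K * (C * rho_diag z powr (- a))" using K C(1) by simp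
    have "rho_diag z powr a * (K * (C * rho_diag z powr (- a))) = C * K"
      using rho_diag_pos[OF z] by (simp add: powr_minus)
    then show ?thesis
      using kernel_op_le(1)[OF fm z nn le] kernel_op_le(2)[OF fm z nn le, of a] unfolding K_def by (simp only:)
  qed
  have op: "integral_op a (kernel_integrand b) f \<in> Lp_space \<infinity> \<alpha>"
    "Lp_norm \<infinity> \<alpha> (integral_op a (kernel_integrand b) f) \<le> C * Lp_norm \<infinity> \<alpha> f"
    if f: "f \<in> Lp_space \<infinity> \<alpha>" for f :: "'n cvec \<Rightarrow> complex"
  proof -
    have "f \<in> borel_measurable ?M"
      using f by (simp add: Lp_space_def)
    note m = measurable_kernel_op[OF this, of a b]
    have "AE z in ?M. cmod (integral_op a (kernel_integrand b) f z) \<le> C * Lp_norm \<infinity> \<alpha> f"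
      using main[OF f] by (intro AE_I2) simp
    from Lp_space_infinity_I[OF m this]
    show "integral_op a (kernel_integrand b) f \<in> Lp_space \<infinity> \<alpha>"
      "Lp_norm \<infinity> \<alpha> (integral_op a (kernel_integrand b) f) \<le> C * Lp_norm \<infinity> \<alpha> f" .
  qed
  show ?thesis
    unfolding integral_op_bounded_def using op main by (auto intro!: AE_I2)
qed

end

section \<open>Necessity: test functions\<close>

text \<open>For \<open>e \<noteq> 0\<close> the power takes every positive value, in particular one
  exceeding \<open>C / c\<close>. The sign of \<open>e\<close> decides whether this happens at small
  or at large \<open>R\<close>.\<close>

lemma powr_bounded_imp_exponent_zero:
  fixes c e C :: real
  assumes c: "c > 0" and le: "\<And>R. R > 0 \<Longrightarrow> c * R powr e \<le> C"
  shows "e = 0"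
proof (rule ccontr)
  assume e: "e \<noteq> 0"
  have C: "C > 0" using le[of 1] c by simp
  define y where "y = (C + 1) / c"
  have y: "y > 0" using c C by (simp add: y_def)
  have "(y powr (1 / e)) powr e = y"
    using e y by (simp add: powr_powr)
  then have "c * y \<le> C"
    using le[of "y powr (1 / e)"] y by simp
  then show False
    using c by (simp add: y_def)
qed

text \<open>Excludes cancellation: division by one constant \<open>v\<close> turns the integrand so
  that its real part is nonnegative, and the modulus of the integral is then at least the integral
  of that real part.\<close>

lemma norm_integral_ge:
  fixes F :: "'a \<Rightarrow> complex"
  assumes int: "integrable M F" and v: "v \<noteq> 0"
    and le: "\<And>w. w \<in> space M \<Longrightarrow> G w \<le> Re (F w / v)" and nn: "\<And>w. w \<in> space M \<Longrightarrow> 0 \<le> G w"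
  shows "ennreal (cmod v) * (\<integral>\<^sup>+w. ennreal (G w) \<partial>M) \<le> ennreal (cmod (LINT w|M. F w))"
proof -
  have int': "integrable M (\<lambda>w. Re (F w / v))"
    using int by (intro integrable_Re integrable_divide) auto
  have "(\<integral>\<^sup>+w. ennreal (G w) \<partial>M) \<le> (\<integral>\<^sup>+w. ennreal (Re (F w / v)) \<partial>M)"
    by (intro nn_integral_mono ennreal_leI le)
  also have "\<dots> = ennreal (LINT w|M. Re (F w / v))"
    using le nn by (intro nn_integral_eq_integral int' AE_I2) (meson order_trans)
  also have "(LINT w|M. Re (F w / v)) = Re ((LINT w|M. F w) / v)"
    using int by (subst integral_Re) (auto intro!: integrable_divide)
  also have "ennreal \<dots> \<le> ennreal (cmod ((LINT w|M. F w) / v))"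
    by (intro ennreal_leI complex_Re_le_cmod)
  finally have "ennreal (cmod v) * (\<integral>\<^sup>+w. ennreal (G w) \<partial>M) \<le> ennreal (cmod v) * ennreal (cmod ((LINT w|M. F w) / v))"
    by (intro mult_left_mono) auto
  also have "\<dots> = ennreal (cmod (LINT w|M. F w))"
    using v by (simp add: ennreal_mult[symmetric] norm_divide)
  finally show ?thesis .
qed

definition complex_indicator :: "'a set \<Rightarrow> 'a \<Rightarrow> complex" where
  "complex_indicator Q w = of_real (indicator Q w)"

lemma norm_complex_indicator [simp]: "cmod (complex_indicator Q w) = indicator Q w"
  by (simp add: complex_indicator_def)

lemma measurable_complex_indicator [measurable]:
  assumes [measurable]: "Q \<in> sets borel"
  shows "complex_indicator Q \<in> borel_measurable (lebesgue_on siegel)"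
  by (rule borel_imp_measurable_siegel) (simp add: complex_indicator_def[abs_def])

lemma weighted_pnorm_indicator:
  "p > 0 \<Longrightarrow> weighted_pnorm p \<alpha> (complex_indicator Q)
   = (\<integral>\<^sup>+w. ennreal (rho_diag w powr \<alpha>) * indicator Q w \<partial>lebesgue_on siegel)"
  unfolding weighted_pnorm_def by (intro nn_integral_cong) (auto split: split_indicator)

text \<open>If the image of the indicator of \<open>Q\<close> is at least \<open>L\<close> on
  \<open>Q\<close>, it dominates \<open>L\<close> times the indicator, so \<open>L\<close> is
  controlled by the operator norm alone. All exponents are thereby treated alike, and the weight
  enters only through the requirement that \<open>Q\<close> have positive finite measure.\<close>

lemma integral_op_bounded_indicator_test:
  fixes k :: "('n::{finite,linorder} cvec \<Rightarrow> complex) \<Rightarrow> 'n cvec \<Rightarrow> 'n cvec \<Rightarrow> complex"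
  assumes bdd: "integral_op_bounded p \<alpha> a k" and p: "1 \<le> p"
  obtains C where "\<And>Q L. Q \<in> sets borel \<Longrightarrow>
      (\<integral>\<^sup>+w. ennreal (rho_diag w powr \<alpha>) * indicator Q w \<partial>lebesgue_on siegel) \<noteq> 0 \<Longrightarrow>
      (\<integral>\<^sup>+w. ennreal (rho_diag w powr \<alpha>) * indicator Q w \<partial>lebesgue_on siegel) < \<infinity> \<Longrightarrow>
      (AE z in lebesgue_on siegel. z \<in> Q \<longrightarrow> L \<le> cmod (integral_op a k (complex_indicator Q) z)) \<Longrightarrow> L \<le> C"
proof (cases p)
  case (real q)
  then have q: "q \<ge> 1" using p by simp
  obtain C where C: "C \<ge> 0" "\<And>f. f \<in> Lp_space (ereal q) \<alpha> \<Longrightarrow>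
      weighted_pnorm q \<alpha> (integral_op a k f) \<le> ennreal C * weighted_pnorm q \<alpha> f"
    using integral_op_boundedD_ereal[OF bdd[unfolded real] q] by blast
  \<comment> \<open>\<open>C\<close> bounds p-th powers. For \<open>L > 1\<close> one has
    \<open>L \<le> L powr q \<le> C\<close>, so the maximum with 1 avoids taking a root.\<close>
  have "L \<le> max 1 C"
    if [measurable]: "Q \<in> sets borel"
    and pos: "(\<integral>\<^sup>+w. ennreal (rho_diag w powr \<alpha>) * indicator Q w \<partial>lebesgue_on siegel) \<noteq> 0"
    and fin: "(\<integral>\<^sup>+w. ennreal (rho_diag w powr \<alpha>) * indicator Q w \<partial>lebesgue_on siegel) < \<infinity>"
    and L: "AE z in lebesgue_on siegel. z \<in> Q \<longrightarrow> L \<le> cmod (integral_op a k (complex_indicator Q) z)"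
    for Q L
  proof (rule ccontr)
    assume "\<not> L \<le> max 1 C"
    then have L1: "L > 1" "L > C" by auto
    obtain x where x: "x > 0" "(\<integral>\<^sup>+w. ennreal (rho_diag w powr \<alpha>) * indicator Q w \<partial>lebesgue_on siegel) = ennreal x"
      using pos fin by (cases "\<integral>\<^sup>+w. ennreal (rho_diag w powr \<alpha>) * indicator Q w \<partial>lebesgue_on siegel") (auto simp: less_le)
    have nf: "weighted_pnorm q \<alpha> (complex_indicator Q) = ennreal x"
      using q x by (simp add: weighted_pnorm_indicator)
    then have "complex_indicator Q \<in> Lp_space (ereal q) \<alpha>"
      by (simp add: Lp_space_ereal_iff)
    then have "weighted_pnorm q \<alpha> (integral_op a k (complex_indicator Q)) \<le> ennreal (C * x)"
      using C nf x by (force simp: ennreal_mult)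
    moreover have "ennreal (L powr q) * ennreal x \<le> weighted_pnorm q \<alpha> (integral_op a k (complex_indicator Q))"
    proof -
      have [measurable]: "(\<lambda>w. indicator Q w :: ennreal) \<in> borel_measurable (lebesgue_on siegel)"
        by (rule borel_imp_measurable_siegel) simp
      have "ennreal (L powr q) * ennreal x
        = (\<integral>\<^sup>+w. ennreal (L powr q) * (ennreal (rho_diag w powr \<alpha>) * indicator Q w) \<partial>lebesgue_on siegel)"
        unfolding x(2)[symmetric] by (rule nn_integral_cmult[symmetric]) measurable
      also have "\<dots> \<le> weighted_pnorm q \<alpha> (integral_op a k (complex_indicator Q))"
        unfolding weighted_pnorm_def
      proof (rule nn_integral_mono_AE, rule eventually_mono[OF L])
        fix z assume z: "z \<in> Q \<longrightarrow> L \<le> cmod (integral_op a k (complex_indicator Q) z)"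
        show "ennreal (L powr q) * (ennreal (rho_diag z powr \<alpha>) * indicator Q z)
          \<le> ennreal (cmod (integral_op a k (complex_indicator Q) z) powr q * rho_diag z powr \<alpha>)"
        proof (cases "z \<in> Q")
          case True
          then have "L powr q \<le> cmod (integral_op a k (complex_indicator Q) z) powr q"
            using z L1 q by (intro powr_mono2) auto
          then show ?thesis
            using True by (simp add: ennreal_mult[symmetric] ennreal_leI mult_right_mono)
        qed simp
      qed
      finally show ?thesis .
    qed
    ultimately have "ennreal (L powr q * x) \<le> ennreal (C * x)"
      using x by (simp add: ennreal_mult)
    then have "L powr q \<le> C"
      using x C by simp
    moreover have "L powr 1 \<le> L powr q"
      using L1 q by (intro powr_mono) auto
    ultimately show False
      using L1 by simp
  qed
  then show thesis using that by blast
next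
  case PInf
  then have pinf: "p = \<infinity>" by simp
  obtain C where C: "\<And>f. f \<in> Lp_space \<infinity> \<alpha> \<Longrightarrow> Lp_norm \<infinity> \<alpha> (integral_op a k f) \<le> C * Lp_norm \<infinity> \<alpha> f"
    and op: "\<And>f. f \<in> Lp_space \<infinity> \<alpha> \<Longrightarrow> integral_op a k f \<in> Lp_space \<infinity> \<alpha>"
    using bdd unfolding integral_op_bounded_def pinf by blast
  have "L \<le> max C 0"
    if [measurable]: "Q \<in> sets borel"
    and pos: "(\<integral>\<^sup>+w. ennreal (rho_diag w powr \<alpha>) * indicator Q w \<partial>lebesgue_on siegel) \<noteq> 0"
    and L: "AE z in lebesgue_on siegel. z \<in> Q \<longrightarrow> L \<le> cmod (integral_op a k (complex_indicator Q) z)"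
    for Q L
  proof (rule ccontr)
    assume L1: "\<not> L \<le> max C 0"
    have "AE w in lebesgue_on siegel. cmod (complex_indicator Q w) \<le> 1"
      by (simp add: indicator_def)
    then have f: "complex_indicator Q \<in> Lp_space \<infinity> \<alpha>" "Lp_norm \<infinity> \<alpha> (complex_indicator Q) \<le> 1"
      using Lp_space_infinity_I[of "complex_indicator Q" 1 \<alpha>] by auto
    have "C * Lp_norm \<infinity> \<alpha> (complex_indicator Q) \<le> max C 0 * Lp_norm \<infinity> \<alpha> (complex_indicator Q)"
      using Lp_space_infinity_AE(1)[OF f(1)] by (intro mult_right_mono) auto
    also have "\<dots> \<le> max C 0 * 1"
      using f(2) by (intro mult_left_mono) auto
    finally have "Lp_norm \<infinity> \<alpha> (integral_op a k (complex_indicator Q)) \<le> max C 0"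
      using C[OF f(1)] by simp
    then have "AE z in lebesgue_on siegel. cmod (integral_op a k (complex_indicator Q) z) \<le> max C 0"
      by (intro eventually_mono[OF Lp_space_infinity_AE(2)[OF op[OF f(1)]]]) linarith
    with L have "AE z in lebesgue_on siegel. z \<notin> Q"
      by eventually_elim (use L1 in auto)
    then have "(\<integral>\<^sup>+w. ennreal (rho_diag w powr \<alpha>) * indicator Q w \<partial>lebesgue_on siegel) = (\<integral>\<^sup>+w. 0 \<partial>lebesgue_on (siegel :: 'n cvec set))"
      by (intro nn_integral_cong_AE) (auto elim!: eventually_mono)
    then show False using pos by simp
  qed
  then show thesis using that by blast
qed (use p in auto)

lemma Re_of_real_mult: "Re (complex_of_real x * y) = x * Re y"
  by simp

section \<open>Testing an abstract kernel on boxes\<close>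

context siegel_kernel
begin

text \<open>The divisor \<open>4 * n\<close> cancels the constant of \<open>rho_near_apex\<close>.
  The outer \<open>1 / 2\<close> keeps the heights in the box comparable to \<open>R\<close>, and
  the inner one does the same for \<open>cmod (rho z (apex R))\<close>.\<close>

definition box_width :: "'n::{finite,linorder} itself \<Rightarrow> real" where
  "box_width _ = min (1 / 2) (min \<eta> (1 / 2) / (4 * real CARD('n)))"

lemma box_width: "0 < box_width TYPE('n::{finite,linorder})" "box_width TYPE('n) \<le> 1 / 2"
  using \<eta>_pos CARD_ge_1[where 'n='n] by (auto simp: box_width_def)

abbreviation test_box :: "real \<Rightarrow> 'n::{finite,linorder} cvec set" where
  "test_box R \<equiv> apex_box (box_width TYPE('n)) R"

lemma test_box_near:
  fixes z w :: "'n::{finite,linorder} cvec"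
  assumes "z \<in> siegel" "w \<in> test_box R" "R > 0"
  shows "cmod (rho z w - rho z (apex R)) \<le> min \<eta> (1 / 2) * cmod (rho z (apex R))"
proof -
  have "cmod (rho z w - rho z (apex R)) \<le> 4 * real CARD('n) * box_width TYPE('n) * cmod (rho z (apex R))"
    using assms box_width by (intro rho_near_apex) auto
  also have "4 * real CARD('n) * box_width TYPE('n) \<le> 4 * real CARD('n) * (min \<eta> (1 / 2) / (4 * real CARD('n)))"
    by (intro mult_left_mono) (auto simp: box_width_def)
  also have "\<dots> = min \<eta> (1 / 2)"
    using CARD_ge_1[where 'n='n] by simp
  finally show ?thesis
    by (simp add: mult_right_mono)
qed

lemma test_box_siegel:
  "R > 0 \<Longrightarrow> test_box R \<subseteq> (siegel :: 'n::{finite,linorder} cvec set)"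
  by (rule apex_box_siegel) (rule box_width(2))

text \<open>The box occurs in either variable: in the second one as support of a test function, in
  the first one as the place where an image is evaluated. Conjugating \<open>rho\<close> carries one
  closeness estimate over to the other, so no symmetry of \<open>k\<close> is assumed.\<close>

lemma test_box_ratio:
  fixes z w :: "'n::{finite,linorder} cvec"
  assumes z: "z \<in> siegel" and w: "w \<in> test_box R" and R: "R > 0"
  shows "1 / 2 \<le> Re (k (rho z w) / k (rho z (apex R)))" "1 / 2 \<le> Re (k (rho w z) / k (rho (apex R) z))"
proof -
  have ws: "w \<in> siegel" using test_box_siegel[OF R] w by blast
  have le: "cmod (rho z w - rho z (apex R)) \<le> \<eta> * cmod (rho z (apex R))"
    by (rule order_trans[OF test_box_near[OF assms]]) (intro mult_right_mono, auto)
  then show "1 / 2 \<le> Re (k (rho z w) / k (rho z (apex R)))"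
    using z ws R by (intro k_ratio) (auto simp: Re_rho_pos apex_siegel)
  have "rho w z - rho (apex R) z = cnj (rho z w - rho z (apex R))"
    by (simp add: rho_cnj[of w z] rho_cnj[of "apex R" z])
  then have "cmod (rho w z - rho (apex R) z) \<le> \<eta> * cmod (rho (apex R) z)"
    using le by (simp add: norm_rho_commute[of "apex R" z] del: complex_cnj_diff)
  then show "1 / 2 \<le> Re (k (rho w z) / k (rho (apex R) z))"
    using z ws R by (intro k_ratio) (auto simp: Re_rho_pos apex_siegel)
qed

lemma test_box_rho_apex:
  fixes z :: "'n::{finite,linorder} cvec"
  assumes z: "z \<in> test_box R" and R: "R > 0"
  shows "R / 2 \<le> cmod (rho z (apex R))" "cmod (rho z (apex R)) \<le> 2 * R"
proof -
  have "cmod (rho (apex R) z - of_real R) \<le> min \<eta> (1 / 2) * R"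
    using test_box_near[OF apex_siegel[OF R] z R] R by (simp add: rho_same)
  also have "\<dots> \<le> 1 / 2 * R"
    using R by (intro mult_right_mono) auto
  finally have "cmod (rho (apex R) z - of_real R) \<le> R / 2" by simp
  moreover have "cmod (of_real R :: complex) = R" using R by simp
  ultimately show "R / 2 \<le> cmod (rho z (apex R))" "cmod (rho z (apex R)) \<le> 2 * R"
    using norm_triangle_ineq2[of "rho (apex R) z" "of_real R"] norm_triangle_ineq2[of "of_real R" "rho (apex R) z"]
      norm_minus_commute[of "rho (apex R) z" "of_real R"] norm_rho_commute[of z "apex R"] R
    by linarith+
qed

lemma k_nonzero: "Re \<zeta> > 0 \<Longrightarrow> k \<zeta> \<noteq> 0"
  using norm_k[of \<zeta>] by force

text \<open>Over the box the kernel is compared with its value at \<open>apex R\<close>; the real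
  part of the quotient is at least \<open>1 / 2\<close>, so the integral has at least half the size
  it would have with the kernel frozen there. The constant depends on neither \<open>R\<close> nor
  \<open>z\<close>: varying \<open>R\<close> gives homogeneity, varying \<open>z\<close> the growth
  of the image.\<close>

lemma op_test_box_lower:
  fixes a b :: real
  obtains c0 where "c0 > 0" "\<And>R z. R > 0 \<Longrightarrow> z \<in> siegel \<Longrightarrow>
     integrable (lebesgue_on siegel) (kernel_integrand b (complex_indicator (test_box R)) z) \<Longrightarrow>
     c0 * R powr (b + real CARD('n) + 1) * rho_diag z powr a * cmod (rho z (apex R)) powr - c
     \<le> cmod (integral_op a (kernel_integrand b) (complex_indicator (test_box R :: 'n::{finite,linorder} cvec set)) z)"
proof -
  let ?M = "lebesgue_on (siegel :: 'n cvec set)"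
  obtain c0 where c0: "c0 > 0" "\<And>R. R > 0 \<Longrightarrow> ennreal (c0 * R powr (b + real CARD('n) + 1))
    \<le> (\<integral>\<^sup>+w. ennreal (rho_diag w powr b) * indicator (test_box R :: 'n cvec set) w \<partial>?M)"
    using apex_box_weight_lower[where 'n='n, OF box_width] by blast
  have "c0 / 2 * R powr (b + real CARD('n) + 1) * rho_diag z powr a * cmod (rho z (apex R)) powr - c
     \<le> cmod (integral_op a (kernel_integrand b) (complex_indicator (test_box R :: 'n cvec set)) z)"
    if R: "R > 0" and z: "z \<in> siegel"
      and int: "integrable ?M (kernel_integrand b (complex_indicator (test_box R)) z)" for R and z :: "'n cvec"
  proof -
    define v where "v = k (rho z (apex R))"
    have Rv: "Re (rho z (apex R)) > 0" using z R by (intro Re_rho_pos apex_siegel)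
    have v: "v \<noteq> 0" "cmod v = cmod (rho z (apex R)) powr - c"
      using k_nonzero[OF Rv] norm_k[OF Rv] by (auto simp: v_def)
    define G where "G w = 1 / 2 * (rho_diag w powr b * indicator (test_box R) w)" for w :: "'n cvec"
    have le: "G w \<le> Re (kernel_integrand b (complex_indicator (test_box R)) z w / v)" for w
    proof (cases "w \<in> test_box R")
      case True
      have "kernel_integrand b (complex_indicator (test_box R)) z w / v = of_real (rho_diag w powr b) * (k (rho z w) / v)"
        using True by (simp add: kernel_integrand_def complex_indicator_def)
      then have "Re (kernel_integrand b (complex_indicator (test_box R)) z w / v) = rho_diag w powr b * Re (k (rho z w) / v)"
        by (simp only: Re_of_real_mult)
      moreover have "rho_diag w powr b * (1 / 2) \<le> rho_diag w powr b * Re (k (rho z w) / v)"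
        unfolding v_def by (intro mult_left_mono test_box_ratio(1) z True R) simp
      ultimately show ?thesis using True by (simp add: G_def)
    qed (simp add: G_def kernel_integrand_def complex_indicator_def)
    have meas: "(\<lambda>w. ennreal (rho_diag w powr b) * indicator (test_box R :: 'n cvec set) w) \<in> borel_measurable ?M"
      by (rule borel_imp_measurable_siegel) measurable
    have "ennreal (cmod v) * ennreal (1 / 2 * (c0 * R powr (b + real CARD('n) + 1)))
      = ennreal (cmod v) * (ennreal (1 / 2) * ennreal (c0 * R powr (b + real CARD('n) + 1)))"
      using c0(1) by (simp only: ennreal_mult mult_nonneg_nonneg norm_ge_zero powr_ge_zero less_imp_le
          zero_le_divide_1_iff zero_le_numeral)
    also have "\<dots> \<le> ennreal (cmod v) * (ennreal (1 / 2) * (\<integral>\<^sup>+w. ennreal (rho_diag w powr b) * indicator (test_box R :: 'n cvec set) w \<partial>?M))"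
      by (intro mult_left_mono c0(2) R) auto
    also have "ennreal (1 / 2) * (\<integral>\<^sup>+w. ennreal (rho_diag w powr b) * indicator (test_box R :: 'n cvec set) w \<partial>?M)
      = (\<integral>\<^sup>+w. ennreal (1 / 2) * (ennreal (rho_diag w powr b) * indicator (test_box R :: 'n cvec set) w) \<partial>?M)"
      by (rule nn_integral_cmult[symmetric]) (rule meas)
    also have "\<dots> = (\<integral>\<^sup>+w. ennreal (G w) \<partial>?M)"
      unfolding G_def by (intro nn_integral_cong, subst ennreal_mult) (auto split: split_indicator)
    also have "ennreal (cmod v) * (\<integral>\<^sup>+w. ennreal (G w) \<partial>?M)
      \<le> ennreal (cmod (LINT w|?M. kernel_integrand b (complex_indicator (test_box R)) z w))"
      by (rule norm_integral_ge[OF int v(1) le]) (simp add: G_def)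
    finally have "cmod v * (1 / 2 * (c0 * R powr (b + real CARD('n) + 1)))
      \<le> cmod (LINT w|?M. kernel_integrand b (complex_indicator (test_box R)) z w)"
      by (simp add: ennreal_mult[symmetric] c0(1) less_imp_le)
    then have "rho_diag z powr a * (cmod v * (1 / 2 * (c0 * R powr (b + real CARD('n) + 1))))
      \<le> rho_diag z powr a * cmod (LINT w|?M. kernel_integrand b (complex_indicator (test_box R)) z w)"
      by (intro mult_left_mono) auto
    then show ?thesis
      by (simp add: integral_op_def norm_mult v(2) mult_ac)
  qed
  then show thesis
    using that[of "c0 / 2"] c0(1) by simp
qed

lemma test_box_Lp:
  fixes p :: ereal
  assumes "1 \<le> p" "R > 0"
  shows "complex_indicator (test_box R :: 'n::{finite,linorder} cvec set) \<in> Lp_space p \<alpha>"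
proof (cases p)
  case (real q)
  then show ?thesis
    using apex_box_weight_finite[where 'n='n, OF box_width, of R \<alpha>] assms
    by (simp add: Lp_space_ereal_iff weighted_pnorm_indicator)
next
  case PInf
  have "AE w in lebesgue_on siegel. cmod (complex_indicator (test_box R :: 'n cvec set) w) \<le> 1"
    by (simp add: indicator_def)
  then show ?thesis
    using Lp_space_infinity_I(1)[of "complex_indicator (test_box R :: 'n cvec set)" 1 \<alpha>] PInf by auto
qed (use assms in auto)

text \<open>On the box itself the heights and the distances to \<open>apex R\<close> are of order
  \<open>R\<close>, so the image is there at least a constant times
  \<open>R powr (n + 1 + a + b - c)\<close>. This has to stay bounded both as \<open>R\<close> tends
  to 0 and as it tends to infinity.\<close>

lemma kernel_bounded_imp_homogeneous:
  fixes p :: ereal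
  assumes bdd: "integral_op_bounded p \<alpha> a
      (kernel_integrand b :: ('n::{finite,linorder} cvec \<Rightarrow> complex) \<Rightarrow> 'n cvec \<Rightarrow> 'n cvec \<Rightarrow> complex)"
    and p: "1 \<le> p"
  shows "c = real CARD('n) + 1 + a + b"
proof -
  let ?M = "lebesgue_on (siegel :: 'n cvec set)"
  obtain C where C: "\<And>Q L. Q \<in> sets borel \<Longrightarrow>
      (\<integral>\<^sup>+w. ennreal (rho_diag w powr \<alpha>) * indicator Q w \<partial>?M) \<noteq> 0 \<Longrightarrow>
      (\<integral>\<^sup>+w. ennreal (rho_diag w powr \<alpha>) * indicator Q w \<partial>?M) < \<infinity> \<Longrightarrow>
      (AE z in ?M. z \<in> Q \<longrightarrow> L \<le> cmod (integral_op a (kernel_integrand b) (complex_indicator Q) z)) \<Longrightarrow> L \<le> C"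
    using integral_op_bounded_indicator_test[OF bdd p] by blast
  obtain c0 where c0: "c0 > 0" "\<And>R z. R > 0 \<Longrightarrow> z \<in> siegel \<Longrightarrow>
     integrable ?M (kernel_integrand b (complex_indicator (test_box R)) z) \<Longrightarrow>
     c0 * R powr (b + real CARD('n) + 1) * rho_diag z powr a * cmod (rho z (apex R)) powr - c
     \<le> cmod (integral_op a (kernel_integrand b) (complex_indicator (test_box R :: 'n cvec set)) z)"
    using op_test_box_lower[where 'n='n] by blast
  obtain c1 where c1: "c1 > 0" "\<And>R. R > 0 \<Longrightarrow> ennreal (c1 * R powr (\<alpha> + real CARD('n) + 1))
    \<le> (\<integral>\<^sup>+w. ennreal (rho_diag w powr \<alpha>) * indicator (test_box R :: 'n cvec set) w \<partial>?M)"
    using apex_box_weight_lower[where 'n='n, OF box_width] by blast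
  define ca cc where "ca = min ((1 / 2) powr a) (2 powr a)" and "cc = min ((1 / 2) powr - c) (2 powr - c)"
  have pos: "ca > 0" "cc > 0" by (auto simp: ca_def cc_def)
  define e where "e = a + b + real CARD('n) + 1 - c"
  have "(c0 * ca * cc) * R powr e \<le> C" if R: "R > 0" for R
  proof (rule C)
    show "(\<integral>\<^sup>+w. ennreal (rho_diag w powr \<alpha>) * indicator (test_box R :: 'n cvec set) w \<partial>?M) \<noteq> 0"
    proof -
      have "0 < c1 * R powr (\<alpha> + real CARD('n) + 1)" using c1(1) R by simp
      then show ?thesis using c1(2)[OF R] by (auto simp del: zero_less_mult_iff)
    qed
    show "(\<integral>\<^sup>+w. ennreal (rho_diag w powr \<alpha>) * indicator (test_box R :: 'n cvec set) w \<partial>?M) < \<infinity>"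
      by (rule apex_box_weight_finite[OF box_width R])
    have "AE z in ?M. integrable ?M (kernel_integrand b (complex_indicator (test_box R)) z)"
      using bdd test_box_Lp[OF p R] unfolding integral_op_bounded_def by blast
    then show "AE z in ?M. z \<in> test_box R \<longrightarrow>
      (c0 * ca * cc) * R powr e \<le> cmod (integral_op a (kernel_integrand b) (complex_indicator (test_box R)) z)"
    proof (rule eventually_mono, intro impI)
      fix z :: "'n cvec" assume int: "integrable ?M (kernel_integrand b (complex_indicator (test_box R)) z)"
        and z: "z \<in> test_box R"
      have zs: "z \<in> siegel" using z test_box_siegel[OF R] by blast
      have "ca \<le> (rho_diag z / R) powr a"
        unfolding ca_def
        by (rule powr_lower_bound) (use apex_box_rho_diag[OF z box_width(2) R] R in \<open>auto simp: field_simps\<close>)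
      then have 1: "ca * R powr a \<le> rho_diag z powr a"
        using R rho_diag_pos[OF zs] by (simp add: powr_divide pos_le_divide_eq)
      have "cc \<le> (cmod (rho z (apex R)) / R) powr - c"
        unfolding cc_def
        by (rule powr_lower_bound) (use test_box_rho_apex[OF z R] R in \<open>auto simp: field_simps\<close>)
      then have 2: "cc * R powr - c \<le> cmod (rho z (apex R)) powr - c"
        using R by (simp only: powr_divide norm_ge_zero less_imp_le pos_le_divide_eq powr_gt_zero)
      have "R powr e = R powr (b + real CARD('n) + 1) * R powr a * R powr - c"
        by (simp add: e_def powr_add[symmetric] algebra_simps)
      then have "(c0 * ca * cc) * R powr e
        = (c0 * R powr (b + real CARD('n) + 1)) * (ca * R powr a) * (cc * R powr - c)"
        by simp
      also have "\<dots> \<le> (c0 * R powr (b + real CARD('n) + 1)) * rho_diag z powr a * cmod (rho z (apex R)) powr - c"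
        using c0(1) pos by (intro mult_mono mult_left_mono 1 2) auto
      also have "\<dots> \<le> cmod (integral_op a (kernel_integrand b) (complex_indicator (test_box R)) z)"
        by (rule c0(2)[OF R zs int])
      finally show "(c0 * ca * cc) * R powr e \<le> cmod (integral_op a (kernel_integrand b) (complex_indicator (test_box R)) z)" .
    qed
  qed simp
  then have "e = 0"
    using c0(1) pos by (intro powr_bounded_imp_exponent_zero[of "c0 * ca * cc" e C]) auto
  then show ?thesis
    by (simp add: e_def)
qed

text \<open>For the constant function 1 the defining integral is a kernel integral. It converges at
  some point of the domain, and \<open>kernel_integral_lower\<close> reads both inequalities off
  this convergence; by homogeneity the second one then says \<open>a > 0\<close>.\<close>

lemma kernel_bounded_infinity_imp:
  assumes bdd: "integral_op_bounded \<infinity> \<alpha> a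
      (kernel_integrand b :: ('n::{finite,linorder} cvec \<Rightarrow> complex) \<Rightarrow> 'n cvec \<Rightarrow> 'n cvec \<Rightarrow> complex)"
  shows "b > -1" "c > real CARD('n) + 1 + b"
proof -
  let ?M = "lebesgue_on (siegel :: 'n cvec set)"
  have "(\<lambda>w. 1) \<in> Lp_space \<infinity> \<alpha>"
    by (rule Lp_space_infinity_I(1)[where K=1]) auto
  then have AE: "AE z in ?M. integrable ?M (kernel_integrand b (\<lambda>w. 1) z)"
    using bdd unfolding integral_op_bounded_def by blast
  have "\<exists>z\<in>siegel. integrable ?M (kernel_integrand b (\<lambda>w. 1) z)"
  proof (rule ccontr)
    assume "\<not> ?thesis"
    then have "AE z in ?M. False"
      using AE by (elim AE_mp) (auto intro!: AE_I2)
    then have "ae_filter ?M = bot"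
      by (rule trivial_limit_def[THEN iffD2])
    then show False
      using emeasure_siegel_pos[where 'n='n] by (simp only: ae_filter_eq_bot_iff)
  qed
  then obtain z :: "'n cvec" where z: "z \<in> siegel" and int: "integrable ?M (kernel_integrand b (\<lambda>w. 1) z)"
    by blast
  have "(\<integral>\<^sup>+w. ennreal (rho_diag w powr b * cmod (rho z w) powr - c) \<partial>?M)
    = (\<integral>\<^sup>+w. ennreal (cmod (kernel_integrand b (\<lambda>w. 1) z w)) \<partial>?M)"
    by (rule nn_integral_cong) (use z in \<open>simp add: norm_kernel_integrand\<close>)
  also have "\<dots> < \<infinity>"
    using int by (simp add: integrable_iff_bounded)
  finally show "b > -1" "c > real CARD('n) + 1 + b"
    using kernel_integral_lower[OF z] by blast+
qed

text \<open>The image of the indicator of a fixed box is bounded below on the whole domain, so its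
  p-th power norm dominates a kernel integral with exponents \<open>p * a + \<alpha>\<close> and
  \<open>c * p\<close>. The first inequality expresses integrability at the boundary, the second one
  at infinity; for p = 1 homogeneity turns the latter into \<open>\<alpha> < b\<close>.\<close>

lemma kernel_bounded_finite_imp_output:
  assumes bdd: "integral_op_bounded (ereal p) \<alpha> a
      (kernel_integrand b :: ('n::{finite,linorder} cvec \<Rightarrow> complex) \<Rightarrow> 'n cvec \<Rightarrow> 'n cvec \<Rightarrow> complex)"
    and p: "1 \<le> p"
  shows "p * a + \<alpha> > -1" "c * p > real CARD('n) + 1 + (p * a + \<alpha>)"
proof -
  let ?M = "lebesgue_on (siegel :: 'n cvec set)"
  let ?f = "complex_indicator (test_box 1 :: 'n cvec set)"
  obtain c0 where c0: "c0 > 0" "\<And>z. z \<in> siegel \<Longrightarrow> integrable ?M (kernel_integrand b ?f z) \<Longrightarrow>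
     c0 * rho_diag z powr a * cmod (rho z (apex 1)) powr - c \<le> cmod (integral_op a (kernel_integrand b) ?f z)"
  proof -
    obtain c0 where "c0 > 0" "\<And>R z. R > 0 \<Longrightarrow> z \<in> siegel \<Longrightarrow>
       integrable ?M (kernel_integrand b (complex_indicator (test_box R)) z) \<Longrightarrow>
       c0 * R powr (b + real CARD('n) + 1) * rho_diag z powr a * cmod (rho z (apex R)) powr - c
       \<le> cmod (integral_op a (kernel_integrand b) (complex_indicator (test_box R :: 'n cvec set)) z)"
      using op_test_box_lower[where 'n='n] by blast
    from this(1) this(2)[of 1] show thesis
      by (intro that[of c0]) simp_all
  qed
  have f: "?f \<in> Lp_space (ereal p) \<alpha>"
    using p by (intro test_box_Lp) auto
  have fin: "weighted_pnorm p \<alpha> (integral_op a (kernel_integrand b) ?f) < \<infinity>"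
    using bdd f unfolding integral_op_bounded_def by (simp add: Lp_space_ereal_iff)
  have AE: "AE z in ?M. z \<in> siegel \<and> integrable ?M (kernel_integrand b ?f z)"
    using bdd f unfolding integral_op_bounded_def by (auto intro: AE_conjI AE_I2)
  have meas: "(\<lambda>z. ennreal (rho_diag z powr (p * a + \<alpha>) * cmod (rho (apex 1) z) powr - (c * p))) \<in> borel_measurable ?M"
    by (rule borel_imp_measurable_siegel) measurable
  have "ennreal (c0 powr p) * (\<integral>\<^sup>+z. ennreal (rho_diag z powr (p * a + \<alpha>) * cmod (rho (apex 1) z) powr - (c * p)) \<partial>?M)
    = (\<integral>\<^sup>+z. ennreal (c0 powr p) * ennreal (rho_diag z powr (p * a + \<alpha>) * cmod (rho (apex 1) z) powr - (c * p)) \<partial>?M)"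
    by (rule nn_integral_cmult[symmetric]) (rule meas)
  also have "\<dots> \<le> weighted_pnorm p \<alpha> (integral_op a (kernel_integrand b) ?f)"
    unfolding weighted_pnorm_def
  proof (rule nn_integral_mono_AE, rule eventually_mono[OF AE])
    fix z assume z: "z \<in> siegel \<and> integrable ?M (kernel_integrand b ?f z)"
    have "c0 powr p * (rho_diag z powr (p * a + \<alpha>) * cmod (rho (apex 1) z) powr - (c * p))
      = (c0 * rho_diag z powr a * cmod (rho z (apex 1)) powr - c) powr p * rho_diag z powr \<alpha>"
      using c0(1) by (simp add: powr_mult powr_powr powr_add norm_rho_commute[of "apex 1" z] mult_ac)
    also have "\<dots> \<le> cmod (integral_op a (kernel_integrand b) ?f z) powr p * rho_diag z powr \<alpha>"
      using c0 z p by (intro mult_right_mono powr_mono2) auto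
    finally show "ennreal (c0 powr p) * ennreal (rho_diag z powr (p * a + \<alpha>) * cmod (rho (apex 1) z) powr - (c * p))
      \<le> ennreal (cmod (integral_op a (kernel_integrand b) ?f z) powr p * rho_diag z powr \<alpha>)"
      by (simp add: ennreal_mult[symmetric] ennreal_leI)
  qed
  also note fin
  finally have "(\<integral>\<^sup>+z. ennreal (rho_diag z powr (p * a + \<alpha>) * cmod (rho (apex 1) z) powr - (c * p)) \<partial>?M) < \<infinity>"
    using c0(1) by (auto simp: ennreal_mult_less_top ennreal_eq_0_iff)
  then show "p * a + \<alpha> > -1" "c * p > real CARD('n) + 1 + (p * a + \<alpha>)"
    using kernel_integral_lower[of "apex 1 :: 'n cvec"] by (auto simp: apex_siegel)
qed

text \<open>
  The test functions are \<open>rho_diag w powr - (b + 1)\<close> with the phase of the kernel at \<open>apex 1\<close>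
  removed, cut off at height \<open>exp (- K)\<close> above the boundary.
\<close>

lemma kernel_bounded_finite_imp_input:
  assumes bdd: "integral_op_bounded (ereal p) \<alpha> a
      (kernel_integrand b :: ('n::{finite,linorder} cvec \<Rightarrow> complex) \<Rightarrow> 'n cvec \<Rightarrow> 'n cvec \<Rightarrow> complex)"
    and p: "1 < p"
  shows "\<alpha> + 1 < p * (b + 1)"
proof (rule ccontr)
  assume "\<not> \<alpha> + 1 < p * (b + 1)"
  \<comment> \<open>Hence the weighted p-th power of the test function,
    \<open>rho_diag w powr (- p * (b + 1) + \<alpha>)\<close>, is at most
    \<open>rho_diag w powr - 1\<close> at heights up to 1.\<close>
  then have ge: "- p * (b + 1) + \<alpha> \<ge> -1" by simp
  let ?M = "lebesgue_on (siegel :: 'n cvec set)"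
  let ?Q = "test_box 1 :: 'n cvec set"
  define n where "n = real CARD('n)"
  \<comment> \<open>The factor that \<open>nn_integral_hbox\<close> produces for widths 1.\<close>
  define V where "V = (2 * 1) ^ (2 * CARD('n) - 2) * (2 * 1 :: real)"
  have V: "V > 0" by (simp add: V_def)
  obtain C where C: "C \<ge> 0" "\<And>f :: 'n cvec \<Rightarrow> complex. f \<in> Lp_space (ereal p) \<alpha> \<Longrightarrow>
      weighted_pnorm p \<alpha> (integral_op a (kernel_integrand b) f) \<le> ennreal C * weighted_pnorm p \<alpha> f"
    using integral_op_boundedD_ereal[OF bdd] p by (metis less_imp_le)
  obtain c1 where c1: "c1 > 0" "ennreal c1 \<le> (\<integral>\<^sup>+w. ennreal (rho_diag w powr \<alpha>) * indicator ?Q w \<partial>?M)"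
  proof -
    obtain c1 where "c1 > 0" "\<And>R. R > 0 \<Longrightarrow> ennreal (c1 * R powr (\<alpha> + real CARD('n) + 1))
      \<le> (\<integral>\<^sup>+w. ennreal (rho_diag w powr \<alpha>) * indicator (test_box R :: 'n cvec set) w \<partial>?M)"
      using apex_box_weight_lower[where 'n='n, OF box_width] by blast
    from this(1) this(2)[of 1] show thesis
      by (intro that[of c1]) simp_all
  qed
  define ca where "ca = min ((1 / 2) powr a) (2 powr a :: real)"
  \<comment> \<open>Bounds the kernel between \<open>apex 1\<close>, of height 1, and points of
    \<open>P\<close>, of height at most 1: \<open>cmod (rho (apex 1) w)\<close> lies between
    \<open>1 / 2\<close> and \<open>2 + n\<close>.\<close>
  define cc where "cc = min ((1 / 2) powr - c) ((2 + n) powr - c)"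
  have pos: "ca > 0" "cc > 0" by (auto simp: ca_def cc_def n_def)
  define c2 where "c2 = ca * (1 / 2 * cc * V)"
  have c2: "c2 > 0" using pos V by (simp add: c2_def)
  \<comment> \<open>The image contributes a p-th power of \<open>K\<close> and the norm of the test
    function only a single factor \<open>K\<close>; one factor has been divided out.\<close>
  have "(c2 powr p * c1) * K powr (p - 1) \<le> C * V" if K: "K > 0" for K
  proof -
    define P where "P = hbox (apex 1 :: 'n cvec) (sqrt 1) 1 \<inter> {w. exp (- K) \<le> rho_diag w \<and> rho_diag w \<le> 1}"
    have [measurable]: "P \<in> sets borel"
    proof -
      have "P = {w \<in> space borel. w \<in> hbox (apex 1) (sqrt 1) 1 \<and> exp (- K) \<le> rho_diag w \<and> rho_diag w \<le> 1}"
        by (auto simp: P_def)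
      also have "\<dots> \<in> sets borel" by measurable
      finally show ?thesis .
    qed
    have Ppos: "rho_diag w > 0" if "w \<in> P" for w
      using that by (auto simp: P_def intro: less_le_trans[OF exp_gt_zero])
    then have Ps: "w \<in> siegel" if "w \<in> P" for w
      using that by (simp add: siegel_iff)
    have intP: "(\<integral>\<^sup>+w. ennreal (rho_diag w powr - 1) * indicator P w \<partial>?M) = ennreal (V * K)"
    proof -
      define \<phi> where "\<phi> x = indicator {exp (- K)..1} x * ennreal (x powr - 1)" for x :: real
      have [measurable]: "\<phi> \<in> borel_measurable borel"
        unfolding \<phi>_def by measurable
      have \<phi>: "(\<integral>\<^sup>+x. \<phi> x \<partial>lborel) = ennreal K"
        unfolding \<phi>_def using K by (subst nn_integral_powr_minus_one) auto
      have "(\<integral>\<^sup>+w. ennreal (rho_diag w powr - 1) * indicator P w \<partial>?M)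
        = (\<integral>\<^sup>+w. indicator (hbox (apex 1 :: 'n cvec) (sqrt 1) 1) w * \<phi> (rho_diag w) \<partial>lborel)"
        unfolding nn_integral_siegel
      proof (rule nn_integral_cong)
        fix w :: "'n cvec"
        show "ennreal (rho_diag w powr - 1) * indicator P w * indicator siegel w
          = indicator (hbox (apex 1) (sqrt 1) 1) w * \<phi> (rho_diag w)"
          using Ps[of w] by (cases "w \<in> P") (auto simp: \<phi>_def P_def indicator_def)
      qed
      also have "\<dots> = ennreal (V * K)"
        using K V by (subst nn_integral_hbox) (simp_all add: \<phi> V_def ennreal_mult)
      finally show ?thesis .
    qed
    define u where "u w = k (rho (apex 1) w)" for w :: "'n cvec"
    have u: "cmod (u w) = cmod (rho (apex 1) w) powr - c" "u w \<noteq> 0" if "w \<in> siegel" for w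
      using that norm_k k_nonzero by (auto simp: u_def Re_rho_pos apex_siegel)
    define f where "f w = cnj (u w) / of_real (cmod (u w)) * of_real (rho_diag w powr - (b + 1) * indicator P w)" for w
    have fm: "f \<in> borel_measurable ?M"
      unfolding f_def u_def by (rule borel_imp_measurable_siegel) measurable
    have nf: "cmod (f w) = rho_diag w powr - (b + 1) * indicator P w" for w
      using u(2)[OF Ps, of w] by (cases "w \<in> P") (auto simp: f_def norm_mult norm_divide)
    have normf: "weighted_pnorm p \<alpha> f \<le> ennreal (V * K)"
      unfolding weighted_pnorm_def intP[symmetric]
    proof (rule nn_integral_mono)
      fix w :: "'n cvec"
      show "ennreal (cmod (f w) powr p * rho_diag w powr \<alpha>) \<le> ennreal (rho_diag w powr - 1) * indicator P w"
      proof (cases "w \<in> P")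
        case True
        have "cmod (f w) powr p * rho_diag w powr \<alpha> = rho_diag w powr (- p * (b + 1) + \<alpha>)"
          using True by (simp add: nf powr_powr powr_add[symmetric] algebra_simps)
        also have "\<dots> \<le> rho_diag w powr - 1"
          using Ppos[OF True] True ge by (intro powr_mono') (auto simp: P_def)
        finally show ?thesis using True by (simp add: ennreal_leI)
      qed (use p in \<open>simp add: nf\<close>)
    qed
    then have f: "f \<in> Lp_space (ereal p) \<alpha>"
      using fm by (auto simp: Lp_space_ereal_iff intro: le_less_trans)
    have lower: "c2 * K \<le> cmod (integral_op a (kernel_integrand b) f z)"
      if z: "z \<in> ?Q" and int: "integrable ?M (kernel_integrand b f z)" for z
    proof -
      have zs: "z \<in> siegel" using z test_box_siegel[of 1] by auto
      define G where "G w = 1 / 2 * cc * (rho_diag w powr - 1 * indicator P w)" for w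
      \<comment> \<open>The phase is already compensated inside \<open>f\<close>, so the integrand
        is compared with the constant 1. What remains of the kernel is the ratio between
        \<open>rho w z\<close> taken as \<open>rho z w\<close> with \<open>z\<close> in the box and
        its value at \<open>apex 1\<close>.\<close>
      have le: "G w \<le> Re (kernel_integrand b f z w / 1)" for w
      proof (cases "w \<in> P")
        case True
        have w: "rho_diag w > 0" "w \<in> siegel" using True Ppos Ps by auto
        have "cmod (rho (apex 1) w) \<ge> 1 / 2" "cmod (rho (apex 1) w) \<le> 2 + n"
          using hbox_rho_bounds[of w "apex 1" 1] True w by (auto simp: P_def n_def)
        then have cc: "cc \<le> cmod (u w)"
          unfolding cc_def u(1)[OF w(2)] by (intro powr_lower_bound) auto
        have "cnj (u w) / of_real (cmod (u w)) = of_real (cmod (u w)) / u w"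
          using u(2)[OF w(2)] complex_norm_square[of "u w"] by (simp add: field_simps power2_eq_square)
        then have "kernel_integrand b f z w
          = of_real (rho_diag w powr b * rho_diag w powr - (b + 1) * cmod (u w)) * (k (rho z w) / u w)"
          using True by (simp add: kernel_integrand_def f_def)
        also have "rho_diag w powr b * rho_diag w powr - (b + 1) = rho_diag w powr - 1"
          by (simp add: powr_add[symmetric])
        finally have "Re (kernel_integrand b f z w) = rho_diag w powr - 1 * cmod (u w) * Re (k (rho z w) / u w)"
          by (simp only: Re_of_real_mult)
        moreover have "rho_diag w powr - 1 * cc * (1 / 2) \<le> rho_diag w powr - 1 * cmod (u w) * Re (k (rho z w) / u w)"
          unfolding u_def using test_box_ratio(2)[OF w(2) z] cc pos
          by (intro mult_mono) (auto simp: u_def)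
        ultimately show ?thesis using True by (simp add: G_def)
      qed (simp add: G_def kernel_integrand_def f_def)
      have meas: "(\<lambda>w. ennreal (rho_diag w powr - 1) * indicator P w) \<in> borel_measurable ?M"
        by (rule borel_imp_measurable_siegel) measurable
      have "ennreal (1 / 2 * cc * (V * K)) = ennreal (1 / 2 * cc) * ennreal (V * K)"
        using pos V K by (intro ennreal_mult) auto
      also have "\<dots> = (\<integral>\<^sup>+w. ennreal (1 / 2 * cc) * (ennreal (rho_diag w powr - 1) * indicator P w) \<partial>?M)"
        unfolding intP[symmetric] by (rule nn_integral_cmult[symmetric]) (rule meas)
      also have "\<dots> = (\<integral>\<^sup>+w. ennreal (G w) \<partial>?M)"
        unfolding G_def using pos by (intro nn_integral_cong) (auto simp: ennreal_mult[symmetric] split: split_indicator)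
      also have "\<dots> \<le> ennreal (cmod (LINT w|?M. kernel_integrand b f z w))"
        using norm_integral_ge[OF int, of 1 G] le pos by (simp add: G_def)
      finally have "1 / 2 * cc * (V * K) \<le> cmod (LINT w|?M. kernel_integrand b f z w)"
        by simp
      moreover have "ca \<le> rho_diag z powr a"
        unfolding ca_def by (rule powr_lower_bound) (use apex_box_rho_diag[OF z box_width(2)] in auto)
      ultimately have "ca * (1 / 2 * cc * (V * K)) \<le> rho_diag z powr a * cmod (LINT w|?M. kernel_integrand b f z w)"
        using pos V K by (intro mult_mono) auto
      then show ?thesis
        by (simp add: integral_op_def norm_mult c2_def mult_ac)
    qed
    have AE: "AE z in ?M. integrable ?M (kernel_integrand b f z)"
      using bdd f unfolding integral_op_bounded_def by blast
    have meas: "(\<lambda>w. ennreal (rho_diag w powr \<alpha>) * indicator ?Q w) \<in> borel_measurable ?M"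
      by (rule borel_imp_measurable_siegel) measurable
    have "ennreal ((c2 * K) powr p) * ennreal c1
      \<le> ennreal ((c2 * K) powr p) * (\<integral>\<^sup>+w. ennreal (rho_diag w powr \<alpha>) * indicator ?Q w \<partial>?M)"
      by (intro mult_left_mono c1(2)) simp
    also have "\<dots> = (\<integral>\<^sup>+w. ennreal ((c2 * K) powr p) * (ennreal (rho_diag w powr \<alpha>) * indicator ?Q w) \<partial>?M)"
      by (rule nn_integral_cmult[symmetric]) (rule meas)
    also have "\<dots> \<le> weighted_pnorm p \<alpha> (integral_op a (kernel_integrand b) f)"
      unfolding weighted_pnorm_def
    proof (rule nn_integral_mono_AE, rule eventually_mono[OF AE])
      fix z assume int: "integrable ?M (kernel_integrand b f z)"
      show "ennreal ((c2 * K) powr p) * (ennreal (rho_diag z powr \<alpha>) * indicator ?Q z)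
        \<le> ennreal (cmod (integral_op a (kernel_integrand b) f z) powr p * rho_diag z powr \<alpha>)"
      proof (cases "z \<in> ?Q")
        case True
        have "(c2 * K) powr p \<le> cmod (integral_op a (kernel_integrand b) f z) powr p"
          using lower[OF True int] c2 K p by (intro powr_mono2) auto
        then show ?thesis
          using True by (simp add: ennreal_mult[symmetric] ennreal_leI mult_right_mono)
      qed simp
    qed
    also have "\<dots> \<le> ennreal C * ennreal (V * K)"
      using C(2)[OF f] normf by (meson mult_left_mono order_trans zero_le)
    finally have "(c2 * K) powr p * c1 \<le> C * (V * K)"
      using c1(1) C(1) V K by (simp add: ennreal_mult[symmetric])
    moreover have "(c2 * K) powr p = c2 powr p * (K powr (p - 1) * K)"
      using c2 K by (simp add: powr_mult powr_diff)
    ultimately have "((c2 powr p * c1) * K powr (p - 1)) * K \<le> (C * V) * K"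
      by (simp add: mult_ac)
    then show ?thesis
      using K by (simp only: mult_le_cancel_right_pos)
  qed
  then have "p - 1 = 0"
    using c1(1) c2 by (intro powr_bounded_imp_exponent_zero[of "c2 powr p * c1" "p - 1" "C * V"]) auto
  then show False
    using p by simp
qed

lemma kernel_bounded_iff:
  fixes p :: ereal
  assumes p: "1 \<le> p"
  shows "integral_op_bounded p \<alpha> a
      (kernel_integrand b :: ('n::{finite,linorder} cvec \<Rightarrow> complex) \<Rightarrow> 'n cvec \<Rightarrow> 'n cvec \<Rightarrow> complex)
    \<longleftrightarrow> parameters_admissible CARD('n) p \<alpha> a b c"
    (is "?B \<longleftrightarrow> ?A")
proof (cases p)
  case (real q)
  then have q: "1 \<le> q" using p by simp
  show ?thesis
  proof
    assume ?B
    then have B: "integral_op_bounded (ereal q) \<alpha> a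
        (kernel_integrand b :: ('n cvec \<Rightarrow> complex) \<Rightarrow> 'n cvec \<Rightarrow> 'n cvec \<Rightarrow> complex)"
      by (simp add: real)
    have c: "c = real CARD('n) + 1 + a + b"
      using kernel_bounded_imp_homogeneous[OF B] q by simp
    note out = kernel_bounded_finite_imp_output[OF B q]
    \<comment> \<open>For \<open>q = 1\<close> the logarithmic test gives no contradiction, as
      \<open>K powr (q - 1)\<close> is constant; there the decay of the image at infinity supplies
      the bound.\<close>
    have "\<alpha> + 1 < q * (b + 1)"
    proof (cases "q = 1")
      case True
      then show ?thesis using out(2) c by simp
    next
      case False
      then show ?thesis using kernel_bounded_finite_imp_input[OF B] q by simp
    qed
    then show ?A
      using out(1) c by (simp add: parameters_admissible_def real)
  next
    assume ?A
    then show ?B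
      using kernel_bounded_finite[where 'n='n, OF q, of a \<alpha> b] by (simp add: parameters_admissible_def real)
  qed
next
  case PInf
  show ?thesis
  proof
    assume B: ?B
    have c: "c = real CARD('n) + 1 + a + b"
      using kernel_bounded_imp_homogeneous[OF B p] .
    show ?A
      using kernel_bounded_infinity_imp[OF B[unfolded PInf]] c PInf by (simp add: parameters_admissible_def)
  next
    assume ?A
    then show ?B
      using kernel_bounded_infinity[where 'n='n, of a b] PInf by (simp add: parameters_admissible_def)
  qed
qed (use p in auto)

end

section \<open>Slow variation of the two kernels on the right half-plane\<close>

lemma powr_complex_ratio:
  fixes c :: real
  obtains \<eta> where "\<eta> > 0" "\<And>\<zeta> \<zeta>0 :: complex. Re \<zeta> > 0 \<Longrightarrow> Re \<zeta>0 > 0 \<Longrightarrow>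
    cmod (\<zeta> - \<zeta>0) \<le> \<eta> * cmod \<zeta>0 \<Longrightarrow> Re ((1 / \<zeta> powr of_real c) / (1 / \<zeta>0 powr of_real c)) \<ge> 1 / 2"
proof -
  have "isCont (\<lambda>q :: complex. Re (q powr of_real (- c))) 1"
    by (intro continuous_Re isCont_powr_complex) auto
  then obtain \<eta>0 where \<eta>0: "\<eta>0 > 0"
    and near: "\<And>q :: complex. dist q 1 < \<eta>0 \<Longrightarrow> dist (Re (q powr of_real (- c))) (Re (1 powr of_real (- c))) < 1 / 2"
    unfolding continuous_at_eps_delta by (meson half_gt_zero zero_less_one)
  have near: "Re (q powr of_real (- c)) > 1 / 2" if "dist q 1 < \<eta>0" for q :: complex
  proof -
    have "\<bar>Re (q powr of_real (- c)) - 1\<bar> < 1 / 2"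
      using near[OF that] by (simp add: dist_real_def)
    then show ?thesis
      by linarith
  qed
  \<comment> \<open>Halving \<eta>0 gives the strict inequality that continuity requires, and
    \<open>\<eta> < 1\<close> keeps the quotient \<open>q\<close> in the right half-plane.\<close>
  define \<eta> where "\<eta> = min (\<eta>0 / 2) (1 / 2)"
  have \<eta>: "\<eta> > 0" "\<eta> < \<eta>0" "\<eta> < 1" using \<eta>0 by (auto simp: \<eta>_def)
  have "Re ((1 / \<zeta> powr of_real c) / (1 / \<zeta>0 powr of_real c)) \<ge> 1 / 2"
    if pos: "Re \<zeta> > 0" "Re \<zeta>0 > 0" and le: "cmod (\<zeta> - \<zeta>0) \<le> \<eta> * cmod \<zeta>0" for \<zeta> \<zeta>0 :: complex
  proof -
    have nz: "\<zeta> \<noteq> 0" "\<zeta>0 \<noteq> 0" using pos by auto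
    define q where "q = \<zeta> / \<zeta>0"
    have q0: "q \<noteq> 0" using nz by (simp add: q_def)
    have "cmod (q - 1) = cmod (\<zeta> - \<zeta>0) / cmod \<zeta>0"
      using nz by (simp add: q_def norm_divide[symmetric] diff_divide_distrib)
    also have "\<dots> \<le> \<eta>"
      using le nz by (simp add: pos_divide_le_eq)
    finally have q1: "cmod (q - 1) \<le> \<eta>" .
    have "Re q > 0"
      using abs_Re_le_cmod[of "q - 1"] q1 \<eta> by simp
    then have "\<bar>Im (Ln q)\<bar> < pi / 2"
      using Re_Ln_pos_lt[OF q0] by simp
    moreover have "\<bar>Im (Ln \<zeta>0)\<bar> < pi / 2"
      using Re_Ln_pos_lt[OF nz(2)] pos by simp
    \<comment> \<open>Both arguments lie strictly between - pi / 2 and pi / 2, so their sum does not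
      leave the principal range. Hence principal powers are multiplicative here, and the quotient of
      kernel values is a power of \<open>q\<close> alone.\<close>
    ultimately have "Ln (q * \<zeta>0) = Ln q + Ln \<zeta>0"
      using q0 nz by (intro Ln_times_simple) auto
    then have "Ln \<zeta> = Ln q + Ln \<zeta>0"
      using nz by (simp add: q_def)
    then have "\<zeta> powr of_real c = q powr of_real c * \<zeta>0 powr of_real c"
      using nz q0 by (simp add: powr_def exp_add distrib_left)
    then have "(1 / \<zeta> powr of_real c) / (1 / \<zeta>0 powr of_real c) = q powr of_real (- c)"
      using nz q0 by (simp add: powr_def exp_minus field_simps)
    then show ?thesis
      using near[of q] q1 \<eta> by (simp add: dist_norm)
  qed
  then show thesis
    using that \<eta> by blast
qed

text \<open>The real quotient is the modulus of the complex one and hence at least its real part, so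
  the \<eta> of the complex power serves again.\<close>

lemma powr_real_ratio:
  fixes c :: real
  obtains \<eta> where "\<eta> > 0" "\<And>\<zeta> \<zeta>0 :: complex. Re \<zeta> > 0 \<Longrightarrow> Re \<zeta>0 > 0 \<Longrightarrow>
    cmod (\<zeta> - \<zeta>0) \<le> \<eta> * cmod \<zeta>0 \<Longrightarrow>
    Re (complex_of_real (1 / cmod \<zeta> powr c) / complex_of_real (1 / cmod \<zeta>0 powr c)) \<ge> 1 / 2"
proof -
  obtain \<eta> where \<eta>: "\<eta> > 0" "\<And>\<zeta> \<zeta>0 :: complex. Re \<zeta> > 0 \<Longrightarrow> Re \<zeta>0 > 0 \<Longrightarrow>
    cmod (\<zeta> - \<zeta>0) \<le> \<eta> * cmod \<zeta>0 \<Longrightarrow> Re ((1 / \<zeta> powr of_real c) / (1 / \<zeta>0 powr of_real c)) \<ge> 1 / 2"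
    using powr_complex_ratio by blast
  have "Re (complex_of_real (1 / cmod \<zeta> powr c) / complex_of_real (1 / cmod \<zeta>0 powr c)) \<ge> 1 / 2"
    if "Re \<zeta> > 0" "Re \<zeta>0 > 0" "cmod (\<zeta> - \<zeta>0) \<le> \<eta> * cmod \<zeta>0" for \<zeta> \<zeta>0 :: complex
  proof -
    have "1 / 2 \<le> Re ((1 / \<zeta> powr of_real c) / (1 / \<zeta>0 powr of_real c))"
      by (rule \<eta>(2)[OF that])
    also have "\<dots> \<le> cmod ((1 / \<zeta> powr of_real c) / (1 / \<zeta>0 powr of_real c))"
      by (rule complex_Re_le_cmod)
    also have "\<dots> = (1 / cmod \<zeta> powr c) / (1 / cmod \<zeta>0 powr c)"
      by (simp add: norm_divide norm_powr_real_powr')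
    also have "\<dots> = Re (complex_of_real (1 / cmod \<zeta> powr c) / complex_of_real (1 / cmod \<zeta>0 powr c))"
      by (simp only: of_real_divide[symmetric] Re_complex_of_real)
    finally show ?thesis .
  qed
  then show thesis
    using that \<eta>(1) by blast
qed

theorem theorem1:
  fixes a b c \<alpha> :: real and p :: ereal
  assumes "1 \<le> p"
  shows "(T_bounded TYPE('n::{finite,linorder}) p \<alpha> a b c \<longleftrightarrow> S_bounded TYPE('n) p \<alpha> a b c) \<and>
         (S_bounded TYPE('n) p \<alpha> a b c \<longleftrightarrow> parameters_admissible CARD('n) p \<alpha> a b c)"
proof -
  have T: "T_bounded TYPE('n) p \<alpha> a b c \<longleftrightarrow> parameters_admissible CARD('n) p \<alpha> a b c"
  proof -
    obtain \<eta> where \<eta>: "\<eta> > 0" "\<And>\<zeta> \<zeta>0 :: complex. Re \<zeta> > 0 \<Longrightarrow> Re \<zeta>0 > 0 \<Longrightarrow>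
      cmod (\<zeta> - \<zeta>0) \<le> \<eta> * cmod \<zeta>0 \<Longrightarrow> Re ((1 / \<zeta> powr of_real c) / (1 / \<zeta>0 powr of_real c)) \<ge> 1 / 2"
      using powr_complex_ratio by blast
    interpret siegel_kernel "\<lambda>\<zeta>. 1 / \<zeta> powr of_real c" c \<eta>
    proof
      show "(\<lambda>\<zeta>. 1 / \<zeta> powr complex_of_real c) \<in> borel_measurable borel"
        unfolding powr_def by measurable
      show "cmod (1 / \<zeta> powr complex_of_real c) = cmod \<zeta> powr - c" for \<zeta>
        by (simp add: norm_divide norm_powr_real_powr' powr_minus_divide)
    qed (use \<eta> in auto)
    have "(T_integrand b c :: ('n cvec \<Rightarrow> complex) \<Rightarrow> 'n cvec \<Rightarrow> 'n cvec \<Rightarrow> complex) = kernel_integrand b"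
      by (intro ext) (simp add: T_integrand_def kernel_integrand_def)
    then show ?thesis
      unfolding T_bounded_def using kernel_bounded_iff[OF assms] by simp
  qed
  have S: "S_bounded TYPE('n) p \<alpha> a b c \<longleftrightarrow> parameters_admissible CARD('n) p \<alpha> a b c"
  proof -
    obtain \<eta> where \<eta>: "\<eta> > 0" "\<And>\<zeta> \<zeta>0 :: complex. Re \<zeta> > 0 \<Longrightarrow> Re \<zeta>0 > 0 \<Longrightarrow>
      cmod (\<zeta> - \<zeta>0) \<le> \<eta> * cmod \<zeta>0 \<Longrightarrow>
      Re (complex_of_real (1 / cmod \<zeta> powr c) / complex_of_real (1 / cmod \<zeta>0 powr c)) \<ge> 1 / 2"
      using powr_real_ratio by blast
    interpret siegel_kernel "\<lambda>\<zeta>. complex_of_real (1 / cmod \<zeta> powr c)" c \<eta>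
    proof
      show "cmod (complex_of_real (1 / cmod \<zeta> powr c)) = cmod \<zeta> powr - c" for \<zeta>
        by (simp add: norm_divide powr_minus_divide)
    qed (use \<eta> in auto)
    have "(S_integrand b c :: ('n cvec \<Rightarrow> complex) \<Rightarrow> 'n cvec \<Rightarrow> 'n cvec \<Rightarrow> complex) = kernel_integrand b"
      unfolding S_integrand_def kernel_integrand_def by (intro ext) simp
    then show ?thesis
      unfolding S_bounded_def using kernel_bounded_iff[OF assms] by simp
  qed
  show ?thesis
    using S T by blast
qed

end
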